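(* Let $H$ and $A$ be commuting operators on $\mathcal H_1$ such that $0\le A\le2H$. Let $\mathcal P_{(H,A),t}=e^{t\mathcal L_{-H,A}}$, $t\ge0$, be the Fermionic Mehler semigroup with parameters $H$ and $A$, and let $T=\lim_{\epsilon\downarrow0}(2H+\epsilon1)^{-1/2}A(2H+\epsilon1)^{-1/2}$. Then $$\mathcal P_{(H,A),t}=\Phi_{e^{-tH},(1-e^{-2tH})T}$$ for all $t\ge0$. Moreover, for each $t\ge0$, $\mathcal P^\dagger_{(H,A),t}$ is self-adjoint with respect to the GNS inner product induced by $\rho_T$, and $\rho_T$ is a steady state of the semigroup; that is, $\mathcal P_{(H,A),t}\rho_T=\rho_T$ for all $t$. If $H>0$, so that $\ker(H)=0$, then $\rho_T$ is the unique steady state, and for all states $\rho$ on $\mathscr A_{\mathcal H_1}$, $\lim_{t\to\infty}\mathcal P_{(H,A),t}\rho=\rho_T$.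
   Context: Let $\mathcal H_1$ be a complex Hilbert space of finite dimension $N$ (inner product conjugate linear in the first variable). A CAR field over $\mathcal H_1$ is a conjugate linear map $\psi\mapsto Z(\psi)$ into bounded operators on a Hilbert space $\mathscr K$ with, writing $Z^*(\psi)=Z(\psi)^*$, $Z(\psi)Z^*(\phi)+Z^*(\phi)Z(\psi)=\langle\psi,\phi\rangle1$ and $Z(\psi)Z(\phi)+Z(\phi)Z(\psi)=0$. Fix one acting irreducibly; then $\dim\mathscr K=2^N$ and the generated $*$-algebra is $\mathscr A_{\mathcal H_1}=\mathcal B(\mathscr K)$. Let $\tau=2^{-N}\mathrm{Tr}$; states are identified with density matrices $\rho\ge0$, $\tau(\rho)=1$. The number operator is $\mathcal N=\sum_jZ^*(\psi_j)Z(\psi_j)$ (any orthonormal basis). $\mathscr Q=\{Q\in\mathcal B(\mathcal H_1):0\le Q\le1\}$; for $Q=\sum_j\mu_j|\psi_j\rangle\langle\psi_j|\in\mathscr Q$ (spectral decomposition) $\rho_Q=\prod_{j=1}^N\big((1-\mu_j)2Z(\psi_j)Z^*(\psi_j)+\mu_j2Z^*(\psi_j)Z(\psi_j)\big)$ is the density matrix of the gauge invariant Gaussian (GIG) state with symbol $Q$. The (possibly degenerate) GNS inner product induced by $\rho_T$ is $\langle X,Y\rangle_{GNS,\rho_T}=\tau(X^*Y\rho_T)$. A dagger denotes the adjoint of a map on $\mathscr A_{\mathcal H_1}$ for the inner product $\tau(X^*Y)$. Evans-Hugenholtz-Kadison (EHK) operation. A pair $(S,R)$ of operators on $\mathcal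 H_1$ is compatible if $S$ is a contraction and $0\le R\le1-SS^*$. For such a pair there is a unique $T_{S,R}\in\mathscr Q$ with $\ker(1-SS^* )\subseteq\ker T_{S,R}$ and $R=(1-SS^* )^{1/2}T_{S,R}(1-SS^* )^{1/2}$. On $\mathscr K\otimes\mathscr K$ consider the CAR field over $\mathcal H_1\oplus\mathcal H_1$, $Z(\psi\oplus\eta)=Z(\psi)\otimes W+1\otimes Z(\eta)$ with $W=e^{i\pi\mathcal N}$; let $\mathscr A$, $\mathscr B$ be the $*$-algebras generated by $\{Z(\psi\oplus0)\}$, $\{Z(0\oplus\psi)\}$, each identified with $\mathscr A_{\mathcal H_1}$ via $Z(\psi\oplus0)\leftrightarrow Z(\psi)$, $Z(0\oplus\psi)\leftrightarrow Z(\psi)$. Let $U_S=\begin{pmatrix}-(1-SS^* )^{1/2}&S\\S^*&(1-S^*S)^{1/2}\end{pmatrix}$, a self-adjoint unitary on $\mathcal H_1\oplus\mathcal H_1$, and $\alpha_{U_S}$ the (involutive) $*$-automorphism with $\alpha_{U_S}(Z(\xi))=Z(U_S\xi)$ for $\xi\in\mathcal H_1\oplus\mathcal H_1$. Let $\rho_{T_{S,R}}\in\mathscr A$ be the GIG density matrix with symbol $T_{S,R}$, and $\mathbb E_{\mathscr A}$ the orthogonal projection of $\mathscr A_{\mathcal H_1\oplus\mathcal H_1}$ onto $\mathscr A$ for the inner product given by the normalized trace. Then $\Phi_{S,R}(\rho)=\mathbb E_{\mathscr A}(\alpha_{U_S}(\rho_{T_{S,R}}\rho))$ for $\rho\in\mathscr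 B\cong\mathscr A_{\mathcal H_1}$, extended linearly, regarded as a map on $\mathscr A_{\mathcal H_1}$. Generator. For $H\ge0$ and $0\le A\le2H$, put $R_t=\int_0^te^{-sH}Ae^{-sH}ds$; then $(e^{-tH},R_t)$ is compatible and $\mathcal L^\dagger_{-H,A}(X):=\lim_{t\downarrow0}\frac1t(\Phi^\dagger_{e^{-tH},R_t}(X)-X)$; $\mathcal L_{-H,A}$ is its adjoint for $\tau(X^*Y)$. (Explicitly, with $T$ as in the claim, $T\eta_j=\lambda_j\eta_j$ for an orthonormal basis $\{\eta_j\}$, $\phi_j=(2H)^{1/2}\eta_j$, $\mathcal L^\dagger_{-H,A}(X)=\sum_j(1-\lambda_j)\big(Z^*(\phi_j)WXWZ(\phi_j)-\frac12Z^*(\phi_j)Z(\phi_j)X-\frac12XZ^*(\phi_j)Z(\phi_j)\big)+\sum_j\lambda_j\big(Z(\phi_j)WXWZ^*(\phi_j)-\frac12Z(\phi_j)Z^*(\phi_j)X-\frac12XZ(\phi_j)Z^*(\phi_j)\big)$.) *)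

theory Defs
  imports "HOL-Analysis.Analysis"
begin

text \<open>
  An $N$-dimensional complex Hilbert space is \<^typ>\<open>complex ^ 'n\<close> with $N$ the cardinality of
  the index type, and operators on it are matrices \<^typ>\<open>complex ^ 'n ^ 'n\<close> with product
  \<open>**\<close> and identity \<^term>\<open>mat 1\<close>.  (The instances \<open>*\<close>, \<open>1\<close> and \<open>\<le>\<close> on this type are
  componentwise and are never used.)
\<close>


section \<open>Linear algebra\<close>

definition cinner :: "complex ^ 'n \<Rightarrow> complex ^ 'n \<Rightarrow> complex" where
  "cinner \<psi> \<phi> = (\<Sum>i\<in>UNIV. cnj (\<psi> $ i) * \<phi> $ i)"

definition adj :: "complex ^ 'n ^ 'm \<Rightarrow> complex ^ 'm ^ 'n" where
  "adj M = (\<chi> i j. cnj (M $ j $ i))"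

definition cscale :: "complex \<Rightarrow> complex ^ 'n ^ 'm \<Rightarrow> complex ^ 'n ^ 'm" (infixr "*\<^sub>C" 75) where
  "c *\<^sub>C M = (\<chi> i j. c * M $ i $ j)"

definition psd :: "complex ^ 'n ^ 'n \<Rightarrow> bool" where
  "psd M \<longleftrightarrow> (\<forall>v. Im (cinner v (M *v v)) = 0 \<and> 0 \<le> Re (cinner v (M *v v)))"

definition pos_def :: "complex ^ 'n ^ 'n \<Rightarrow> bool" where
  "pos_def M \<longleftrightarrow> psd M \<and> (\<forall>v. v \<noteq> 0 \<longrightarrow> 0 < Re (cinner v (M *v v)))"

definition op_le :: "complex ^ 'n ^ 'n \<Rightarrow> complex ^ 'n ^ 'n \<Rightarrow> bool" (infix "\<preceq>" 50) where
  "X \<preceq> Y \<longleftrightarrow> psd (Y - X)"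

definition op_ker :: "complex ^ 'n ^ 'm \<Rightarrow> (complex ^ 'n) set" where
  "op_ker M = {v. M *v v = 0}"

definition op_sqrt :: "complex ^ 'n ^ 'n \<Rightarrow> complex ^ 'n ^ 'n" where
  "op_sqrt M = (THE P. psd P \<and> P ** P = M)"

definition op_exp :: "complex ^ 'n ^ 'n \<Rightarrow> complex ^ 'n ^ 'n" where
  "op_exp M = (\<Sum>k. (1 / fact k) *\<^sub>R (((**) M ^^ k) (mat 1)))"

definition outer :: "complex ^ 'n \<Rightarrow> complex ^ 'n \<Rightarrow> complex ^ 'n ^ 'n" where
  "outer \<psi> \<phi> = (\<chi> i j. \<psi> $ i * cnj (\<phi> $ j))"

text \<open>Only the values \<open>\<psi> 0, \<dots>, \<psi> (N - 1)\<close> matter.\<close>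

definition orthonormal_basis :: "(nat \<Rightarrow> complex ^ 'n) \<Rightarrow> bool" where
  "orthonormal_basis \<psi> \<longleftrightarrow>
     (\<forall>i<CARD('n). \<forall>j<CARD('n). cinner (\<psi> i) (\<psi> j) = (if i = j then 1 else 0))"

definition dsum :: "complex ^ 'n \<Rightarrow> complex ^ 'm \<Rightarrow> complex ^ ('n + 'm)" where
  "dsum \<psi> \<eta> = (\<chi> i. case i of Inl a \<Rightarrow> \<psi> $ a | Inr b \<Rightarrow> \<eta> $ b)"

definition block_matrix ::
  "complex ^ 'n ^ 'n \<Rightarrow> complex ^ 'm ^ 'n \<Rightarrow> complex ^ 'n ^ 'm \<Rightarrow> complex ^ 'm ^ 'm
     \<Rightarrow> complex ^ ('n + 'm) ^ ('n + 'm)" where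
  "block_matrix M11 M12 M21 M22 = (\<chi> i j.
     (case i of
        Inl a \<Rightarrow> (case j of Inl b \<Rightarrow> M11 $ a $ b | Inr b \<Rightarrow> M12 $ a $ b)
      | Inr a \<Rightarrow> (case j of Inl b \<Rightarrow> M21 $ a $ b | Inr b \<Rightarrow> M22 $ a $ b)))"

definition kron ::
  "complex ^ 'k ^ 'k \<Rightarrow> complex ^ 'l ^ 'l \<Rightarrow> complex ^ ('k \<times> 'l) ^ ('k \<times> 'l)" where
  "kron X Y = (\<chi> i j. X $ fst i $ fst j * Y $ snd i $ snd j)"


section \<open>CAR fields\<close>

definition car_field :: "(complex ^ 'n \<Rightarrow> complex ^ 'k ^ 'k) \<Rightarrow> bool" where
  "car_field Z \<longleftrightarrow>
     (\<forall>\<psi> \<phi>. Z (\<psi> + \<phi>) = Z \<psi> + Z \<phi>) \<and>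
     (\<forall>c \<psi>. Z (c *s \<psi>) = cnj c *\<^sub>C Z \<psi>) \<and>
     (\<forall>\<psi> \<phi>. Z \<psi> ** adj (Z \<phi>) + adj (Z \<phi>) ** Z \<psi> = cinner \<psi> \<phi> *\<^sub>C mat 1) \<and>
     (\<forall>\<psi> \<phi>. Z \<psi> ** Z \<phi> + Z \<phi> ** Z \<psi> = 0)"

definition irreducible_field :: "(complex ^ 'n \<Rightarrow> complex ^ 'k ^ 'k) \<Rightarrow> bool" where
  "irreducible_field Z \<longleftrightarrow>
     (\<forall>V. vec.subspace V \<and> (\<forall>\<psi>. \<forall>v\<in>V. Z \<psi> *v v \<in> V \<and> adj (Z \<psi>) *v v \<in> V)
        \<longrightarrow> V = {0} \<or> V = UNIV)"

definition number_op :: "(complex ^ 'n \<Rightarrow> complex ^ 'k ^ 'k) \<Rightarrow> complex ^ 'k ^ 'k" where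
  "number_op Z = (\<Sum>j\<in>UNIV. adj (Z (axis j 1)) ** Z (axis j 1))"

definition W_op :: "(complex ^ 'n \<Rightarrow> complex ^ 'k ^ 'k) \<Rightarrow> complex ^ 'k ^ 'k" where
  "W_op Z = op_exp ((\<i> * of_real pi) *\<^sub>C number_op Z)"

text \<open>
  The normalized trace.  On the space of an irreducible CAR field over an $N$-dimensional space
  the dimension is $2^N$, so this is $2^{-N}\,\mathrm{Tr}$ there.
\<close>

definition ntr :: "complex ^ 'k ^ 'k \<Rightarrow> complex" where
  "ntr X = trace X / of_nat CARD('k)"

definition is_state :: "complex ^ 'k ^ 'k \<Rightarrow> bool" where
  "is_state \<rho> \<longleftrightarrow> psd \<rho> \<and> ntr \<rho> = 1"

definition gns_inner ::
  "complex ^ 'k ^ 'k \<Rightarrow> complex ^ 'k ^ 'k \<Rightarrow> complex ^ 'k ^ 'k \<Rightarrow> complex" where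
  "gns_inner \<rho> X Y = ntr (adj X ** Y ** \<rho>)"

definition dagger ::
  "(complex ^ 'k ^ 'k \<Rightarrow> complex ^ 'k ^ 'k) \<Rightarrow> complex ^ 'k ^ 'k \<Rightarrow> complex ^ 'k ^ 'k" where
  "dagger F = (THE G. \<forall>X Y. ntr (adj (G X) ** Y) = ntr (adj X ** F Y))"

text \<open>
  The factors of the product commute, and the product does not depend on the choice of the
  spectral decomposition.
\<close>

definition gig_product ::
  "(complex ^ 'n \<Rightarrow> complex ^ 'k ^ 'k) \<Rightarrow> (nat \<Rightarrow> complex ^ 'n) \<Rightarrow> (nat \<Rightarrow> real) \<Rightarrow> complex ^ 'k ^ 'k"
  where
  "gig_product Z \<psi> \<mu> =
     foldr (\<lambda>j M. ((1 - \<mu> j) *\<^sub>R (2 *\<^sub>R (Z (\<psi> j) ** adj (Z (\<psi> j))))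
                   + \<mu> j *\<^sub>R (2 *\<^sub>R (adj (Z (\<psi> j)) ** Z (\<psi> j)))) ** M)
       [0..<CARD('n)] (mat 1)"

definition gig_state ::
  "(complex ^ 'n \<Rightarrow> complex ^ 'k ^ 'k) \<Rightarrow> complex ^ 'n ^ 'n \<Rightarrow> complex ^ 'k ^ 'k" where
  "gig_state Z Q = (THE \<rho>. \<exists>\<psi> \<mu>. orthonormal_basis \<psi> \<and>
     Q = (\<Sum>j<CARD('n). \<mu> j *\<^sub>R outer (\<psi> j) (\<psi> j)) \<and> \<rho> = gig_product Z \<psi> \<mu>)"


section \<open>Generated algebras and their identifications\<close>

inductive_set star_algebra :: "(complex ^ 'k ^ 'k) set \<Rightarrow> (complex ^ 'k ^ 'k) set"
  for G :: "(complex ^ 'k ^ 'k) set" where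
  gen: "X \<in> G \<Longrightarrow> X \<in> star_algebra G"
| one: "mat 1 \<in> star_algebra G"
| add: "X \<in> star_algebra G \<Longrightarrow> Y \<in> star_algebra G \<Longrightarrow> X + Y \<in> star_algebra G"
| scale: "X \<in> star_algebra G \<Longrightarrow> c *\<^sub>C X \<in> star_algebra G"
| mult: "X \<in> star_algebra G \<Longrightarrow> Y \<in> star_algebra G \<Longrightarrow> X ** Y \<in> star_algebra G"
| star: "X \<in> star_algebra G \<Longrightarrow> adj X \<in> star_algebra G"

definition star_hom :: "(complex ^ 'k ^ 'k \<Rightarrow> complex ^ 'l ^ 'l) \<Rightarrow> bool" where
  "star_hom f \<longleftrightarrow>
     (\<forall>X Y. f (X + Y) = f X + f Y) \<and> (\<forall>c X. f (c *\<^sub>C X) = c *\<^sub>C f X) \<and>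
     (\<forall>X Y. f (X ** Y) = f X ** f Y) \<and> (\<forall>X. f (adj X) = adj (f X)) \<and> f (mat 1) = mat 1"

text \<open>
  For an irreducible CAR field \<open>Z\<close> (which generates the full matrix algebra) and a CAR field
  \<open>Z'\<close> over the same space: the *-isomorphism onto the algebra generated by \<open>Z'\<close> that sends
  \<open>Z \<psi>\<close> to \<open>Z' \<psi>\<close>.
\<close>

definition car_iso ::
  "(complex ^ 'n \<Rightarrow> complex ^ 'k ^ 'k) \<Rightarrow> (complex ^ 'n \<Rightarrow> complex ^ 'l ^ 'l)
     \<Rightarrow> complex ^ 'k ^ 'k \<Rightarrow> complex ^ 'l ^ 'l" where
  "car_iso Z Z' = (THE f. star_hom f \<and> bij_betw f UNIV (star_algebra (range Z')) \<and>
     (\<forall>\<psi>. f (Z \<psi>) = Z' \<psi>))"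

text \<open>The field $Z(\psi\oplus\eta) = Z(\psi)\otimes W + 1\otimes Z(\eta)$ on the tensor square.\<close>

definition double_field ::
  "(complex ^ 'n \<Rightarrow> complex ^ 'k ^ 'k) \<Rightarrow> complex ^ ('n + 'n) \<Rightarrow> complex ^ ('k \<times> 'k) ^ ('k \<times> 'k)"
  where
  "double_field Z \<xi> =
     kron (Z (\<chi> i. \<xi> $ Inl i)) (W_op Z) + kron (mat 1) (Z (\<chi> i. \<xi> $ Inr i))"

definition field_A ::
  "(complex ^ 'n \<Rightarrow> complex ^ 'k ^ 'k) \<Rightarrow> complex ^ 'n \<Rightarrow> complex ^ ('k \<times> 'k) ^ ('k \<times> 'k)" where
  "field_A Z \<psi> = double_field Z (dsum \<psi> 0)"

definition field_B ::
  "(complex ^ 'n \<Rightarrow> complex ^ 'k ^ 'k) \<Rightarrow> complex ^ 'n \<Rightarrow> complex ^ ('k \<times> 'k) ^ ('k \<times> 'k)" where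
  "field_B Z \<psi> = double_field Z (dsum 0 \<psi>)"

definition alg_A ::
  "(complex ^ 'n \<Rightarrow> complex ^ 'k ^ 'k) \<Rightarrow> (complex ^ ('k \<times> 'k) ^ ('k \<times> 'k)) set" where
  "alg_A Z = star_algebra (range (field_A Z))"

definition iota_A ::
  "(complex ^ 'n \<Rightarrow> complex ^ 'k ^ 'k) \<Rightarrow> complex ^ 'k ^ 'k \<Rightarrow> complex ^ ('k \<times> 'k) ^ ('k \<times> 'k)"
  where
  "iota_A Z = car_iso Z (field_A Z)"

definition iota_B ::
  "(complex ^ 'n \<Rightarrow> complex ^ 'k ^ 'k) \<Rightarrow> complex ^ 'k ^ 'k \<Rightarrow> complex ^ ('k \<times> 'k) ^ ('k \<times> 'k)"
  where
  "iota_B Z = car_iso Z (field_B Z)"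

definition alpha ::
  "(complex ^ 'n \<Rightarrow> complex ^ 'k ^ 'k) \<Rightarrow> complex ^ ('n + 'n) ^ ('n + 'n)
     \<Rightarrow> complex ^ ('k \<times> 'k) ^ ('k \<times> 'k) \<Rightarrow> complex ^ ('k \<times> 'k) ^ ('k \<times> 'k)" where
  "alpha Z U = car_iso (double_field Z) (\<lambda>\<xi>. double_field Z (U *v \<xi>))"

definition cond_exp_A ::
  "(complex ^ 'n \<Rightarrow> complex ^ 'k ^ 'k)
     \<Rightarrow> complex ^ ('k \<times> 'k) ^ ('k \<times> 'k) \<Rightarrow> complex ^ ('k \<times> 'k) ^ ('k \<times> 'k)" where
  "cond_exp_A Z X = (THE Y. Y \<in> alg_A Z \<and> (\<forall>V\<in>alg_A Z. ntr (adj V ** (X - Y)) = 0))"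


section \<open>Evans--Hugenholtz--Kadison operations\<close>

text \<open>
  The definitions below are meaningful for compatible pairs, i.e. for \<open>S\<close> a contraction and
  $0 \le R \le 1 - SS^*$.
\<close>

definition T_symbol :: "complex ^ 'n ^ 'n \<Rightarrow> complex ^ 'n ^ 'n \<Rightarrow> complex ^ 'n ^ 'n" where
  "T_symbol S R = (THE Q. 0 \<preceq> Q \<and> Q \<preceq> mat 1 \<and>
     op_ker (mat 1 - S ** adj S) \<subseteq> op_ker Q \<and>
     R = op_sqrt (mat 1 - S ** adj S) ** Q ** op_sqrt (mat 1 - S ** adj S))"

definition U_op :: "complex ^ 'n ^ 'n \<Rightarrow> complex ^ ('n + 'n) ^ ('n + 'n)" where
  "U_op S = block_matrix
     (- op_sqrt (mat 1 - S ** adj S)) S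
     (adj S) (op_sqrt (mat 1 - adj S ** S))"

definition ehk ::
  "(complex ^ 'n \<Rightarrow> complex ^ 'k ^ 'k) \<Rightarrow> complex ^ 'n ^ 'n \<Rightarrow> complex ^ 'n ^ 'n
     \<Rightarrow> complex ^ 'k ^ 'k \<Rightarrow> complex ^ 'k ^ 'k" where
  "ehk Z S R X = inv (iota_A Z) (cond_exp_A Z
     (alpha Z (U_op S) (iota_A Z (gig_state Z (T_symbol S R)) ** iota_B Z X)))"


section \<open>The Fermionic Mehler semigroup\<close>

definition R_op :: "complex ^ 'n ^ 'n \<Rightarrow> complex ^ 'n ^ 'n \<Rightarrow> real \<Rightarrow> complex ^ 'n ^ 'n" where
  "R_op H A t = integral {0..t} (\<lambda>s. op_exp ((- s) *\<^sub>R H) ** A ** op_exp ((- s) *\<^sub>R H))"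

definition mehler_gen_dagger ::
  "(complex ^ 'n \<Rightarrow> complex ^ 'k ^ 'k) \<Rightarrow> complex ^ 'n ^ 'n \<Rightarrow> complex ^ 'n ^ 'n
     \<Rightarrow> complex ^ 'k ^ 'k \<Rightarrow> complex ^ 'k ^ 'k" where
  "mehler_gen_dagger Z H A X =
     Lim (at_right 0) (\<lambda>t::real.
       (1 / t) *\<^sub>R (dagger (ehk Z (op_exp ((- t) *\<^sub>R H)) (R_op H A t)) X - X))"

definition mehler_gen ::
  "(complex ^ 'n \<Rightarrow> complex ^ 'k ^ 'k) \<Rightarrow> complex ^ 'n ^ 'n \<Rightarrow> complex ^ 'n ^ 'n
     \<Rightarrow> complex ^ 'k ^ 'k \<Rightarrow> complex ^ 'k ^ 'k" where
  "mehler_gen Z H A = dagger (mehler_gen_dagger Z H A)"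

definition mehler_semigroup ::
  "(complex ^ 'n \<Rightarrow> complex ^ 'k ^ 'k) \<Rightarrow> complex ^ 'n ^ 'n \<Rightarrow> complex ^ 'n ^ 'n \<Rightarrow> real
     \<Rightarrow> complex ^ 'k ^ 'k \<Rightarrow> complex ^ 'k ^ 'k" where
  "mehler_semigroup Z H A t X = (\<Sum>m. (t ^ m / fact m) *\<^sub>R ((mehler_gen Z H A ^^ m) X))"

definition steady_state ::
  "(real \<Rightarrow> complex ^ 'k ^ 'k \<Rightarrow> complex ^ 'k ^ 'k) \<Rightarrow> complex ^ 'k ^ 'k \<Rightarrow> bool" where
  "steady_state P \<rho> \<longleftrightarrow> is_state \<rho> \<and> (\<forall>t\<ge>0. P t \<rho> = \<rho>)"

definition T_limit :: "complex ^ 'n ^ 'n \<Rightarrow> complex ^ 'n ^ 'n \<Rightarrow> complex ^ 'n ^ 'n" where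
  "T_limit H A = Lim (at_right 0) (\<lambda>\<epsilon>::real.
     matrix_inv (op_sqrt (2 *\<^sub>R H + \<epsilon> *\<^sub>R mat 1)) ** A **
     matrix_inv (op_sqrt (2 *\<^sub>R H + \<epsilon> *\<^sub>R mat 1)))"

end

theory Submission
  imports Defs
begin

text \<open>
  Diagonalize \<open>H\<close> and \<open>A\<close> simultaneously, with eigenvalues $h_j$, $a_j$, so that \<open>T\<close> has eigenvalues
  $\lambda_j = a_j / (2 h_j)$, and let $z_j$ be the field operators of the eigenvectors.  The products
  over \<open>j\<close> of one of $1, z_j, z_j^*, z_j^* z_j - \lambda_j$ span the whole algebra.  Since
  $\alpha_U$ maps $z_j$ to $- c_j z_j^A + s_j z_j^B$ and the Gaussian state on \<open>\<A>\<close> annihilates every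
  charged or centred diagonal factor, each product is an eigenvector of the dual of
  $\Phi_{e^{-tH},(1-e^{-2tH})T}$ with eigenvalue $e^{-t \sum_j d_j h_j}$, where
  $d_j \in \{0,1,1,2\}$.  Hence these maps form a semigroup, and as the products are orthogonal in the
  GNS inner product of $\rho_T$, the dual maps are self-adjoint, $\rho_T$ is fixed, and everything but
  the constant component decays when \<open>H > 0\<close>.

  The isomorphisms between the algebras of CAR fields exist because the normalized trace of a word in
  the field operators depends only on the anticommutation relations.  The Gaussian state is
  independent of the eigenbasis because it is characterized by the KMS relation
  $Z((1-Q)\phi)\,\rho = \rho\, Z(Q\phi)$ and its adjoint.
\<close>

section \<open>Matrices and traces\<close>

text \<open>Almost every object in the claim is a definite description or a limit and has to be
  identified before it can be used. The trace pairing \<open>ntr (V ** X)\<close> does this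
  uniformly: it is nondegenerate, so an operator is known once its pairings with a spanning family
  are known, and convergence can be tested on that family as well. The maps are therefore studied
  only through their pairings with the monomials. There each of them is a scalar
  \<open>exp (- t * r)\<close>, and the generator, its power series and the long-time limit become
  statements about such scalars.

  Two obstacles shape the tools. Eigenvalues of \<open>T\<close> may be 0 or 1, so \<rho>_T may be
  singular and the modular relations have to be written without inverses. Distinct modes
  anticommute, so a single mode cannot simply be factored out of a trace; multiplied by a parity
  operator it commutes with the other modes and keeps its number operator. A further degeneracy sits
  at \<open>t = 0\<close> and on the kernel of \<open>H\<close>, where the symbol of the auxiliary
  Gaussian state is forced to be 0 by its kernel condition.\<close>

lemma cscale_component [simp]: "(c *\<^sub>C M) $ i $ j = c * M $ i $ j"
  by (simp add: cscale_def)

lemma adj_component [simp]: "adj M $ i $ j = cnj (M $ j $ i)"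
  by (simp add: adj_def)

lemma scaleR_cscale: "r *\<^sub>R (M :: complex ^ 'n ^ 'm) = complex_of_real r *\<^sub>C M"
  unfolding vec_eq_iff by (metis cscale_component scaleR_conv_of_real vector_scaleR_component)

lemma cscale_simps:
  "c *\<^sub>C (M + N) = c *\<^sub>C M + c *\<^sub>C N"
  "c *\<^sub>C (M - N) = c *\<^sub>C M - c *\<^sub>C N"
  "c *\<^sub>C (- M) = - (c *\<^sub>C M)"
  "c *\<^sub>C d *\<^sub>C M = (c * d) *\<^sub>C M"
  "1 *\<^sub>C M = M" "0 *\<^sub>C M = 0" "c *\<^sub>C (0 :: complex ^ 'n ^ 'm) = 0"
  "(-1) *\<^sub>C M = - M"
  by (simp_all add: vec_eq_iff algebra_simps)

lemma cscale_left:
  "(c + d) *\<^sub>C M = c *\<^sub>C M + d *\<^sub>C M" "(c - d) *\<^sub>C M = c *\<^sub>C M - d *\<^sub>C M"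
  "(- c) *\<^sub>C M = - (c *\<^sub>C M)"
  by (simp_all add: vec_eq_iff algebra_simps)

lemma cscale_cancel: "c *\<^sub>C M = c *\<^sub>C N \<longleftrightarrow> c = 0 \<or> M = N"
  by (auto simp: vec_eq_iff)

lemma cscale_mult:
  "(c *\<^sub>C M) ** N = c *\<^sub>C (M ** N)" "M ** (c *\<^sub>C N) = c *\<^sub>C (M ** N)"
  by (simp_all add: vec_eq_iff matrix_matrix_mult_def sum_distrib_left mult_ac)

lemma mat_mult_simps:
  fixes A :: "complex ^ 'n ^ 'm"
  shows "A ** (B + C) = A ** B + A ** C" "(A + A') ** B = A ** B + A' ** B"
    "A ** (B - C) = A ** B - A ** C" "(A - A') ** B = A ** B - A' ** B"
    "A ** (- B) = - (A ** B)" "(- A) ** B = - (A ** B)"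
    "A ** (0 :: complex ^ 'l ^ 'n) = 0" "(0 :: complex ^ 'n ^ 'm) ** B = 0"
  by (simp_all add: vec_eq_iff matrix_matrix_mult_def algebra_simps sum.distrib sum_subtractf
      sum_negf)

lemma mat_mult_sum:
  "M ** (\<Sum>i\<in>I. f i) = (\<Sum>i\<in>I. M ** f i)" "(\<Sum>i\<in>I. f i) ** M = (\<Sum>i\<in>I. f i ** (M :: complex ^ 'n ^ 'n))"
  by (induction I rule: infinite_finite_induct) (auto simp: mat_mult_simps)

lemma cscale_sum: "c *\<^sub>C (\<Sum>i\<in>I. f i) = (\<Sum>i\<in>I. c *\<^sub>C f i)"
  by (induction I rule: infinite_finite_induct) (auto simp: cscale_simps)

lemma cscale_mult_vec: "(c *\<^sub>C M) *v v = c *s (M *v v)"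
  by (simp add: vec_eq_iff matrix_vector_mult_def sum_distrib_left mult_ac)

lemma mult_vec_smult: "M *v (c *s v) = c *s (M *v (v :: complex ^ 'n))"
  by (simp add: vec_eq_iff matrix_vector_mult_def sum_distrib_left mult_ac)

lemma mult_vec_sum:
  fixes M :: "complex ^ 'n ^ 'm"
  shows "M *v (\<Sum>i\<in>I. f i) = (\<Sum>i\<in>I. M *v f i)"
  by (induction I rule: infinite_finite_induct) (auto simp: matrix_vector_right_distrib)

lemma sum_mult_vec: "(\<Sum>i\<in>I. f i) *v v = (\<Sum>i\<in>I. f i *v (v :: complex ^ 'n))"
  by (induction I rule: infinite_finite_induct) (auto simp: matrix_vector_mult_add_rdistrib)

lemma adj_simps [simp]:
  "adj (M + N) = adj M + adj N" "adj (M - N) = adj M - adj N" "adj (- M) = - adj M"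
  "adj (c *\<^sub>C M) = cnj c *\<^sub>C adj M" "adj (adj M) = M" "adj 0 = 0" "adj (mat 1) = mat 1"
  "adj (r *\<^sub>R M) = r *\<^sub>R adj M"
  by (auto simp add: vec_eq_iff mat_def)

lemma adj_mult [simp]: "adj (M ** N) = adj N ** adj M"
  by (simp add: vec_eq_iff matrix_matrix_mult_def mult.commute)

lemma adj_sum: "adj (\<Sum>i\<in>I. f i) = (\<Sum>i\<in>I. adj (f i))"
  by (induction I rule: infinite_finite_induct) auto

lemma adj_eq_iff [simp]: "adj M = adj N \<longleftrightarrow> M = N"
  by (metis adj_simps(5))

lemma ntr_simps:
  "ntr (M + N) = ntr M + ntr N" "ntr (M - N) = ntr M - ntr N" "ntr (- M) = - ntr M"
  "ntr (c *\<^sub>C M) = c * ntr M" "ntr 0 = 0" "ntr (mat 1 :: complex ^ 'k ^ 'k) = 1"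
  by (simp_all add: ntr_def trace_def mat_def sum.distrib sum_subtractf sum_negf
      add_divide_distrib diff_divide_distrib sum_distrib_left)

lemma ntr_sum: "ntr (\<Sum>i\<in>I. f i) = (\<Sum>i\<in>I. ntr (f i))"
  by (induction I rule: infinite_finite_induct) (auto simp: ntr_simps)

lemma ntr_commute: "ntr (M ** N) = ntr (N ** (M :: complex ^ 'k ^ 'k))"
  unfolding ntr_def by (subst trace_mul_sym) (rule refl)

lemma ntr_adj: "ntr (adj M) = cnj (ntr M)"
  by (simp add: ntr_def trace_def)

text \<open>Up to the dimension this number is the sum of the squared moduli of the entries, so the
  trace is faithful.\<close>

lemma ntr_adj_self_eq_0:
  assumes "ntr (adj X ** X) = 0" shows "X = 0"
proof -
  have "ntr (adj X ** X) = of_real (\<Sum>i\<in>UNIV. \<Sum>j\<in>UNIV. (cmod (X $ j $ i))\<^sup>2) / of_nat CARD('a)"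
    by (simp add: ntr_def trace_def matrix_matrix_mult_def complex_norm_square mult.commute
        del: of_real_power)
  then have "(\<Sum>i\<in>UNIV. \<Sum>j\<in>UNIV. (cmod (X $ j $ i))\<^sup>2) = 0"
    using assms by (simp del: of_real_sum)
  then show ?thesis
    by (simp add: sum_nonneg_eq_0_iff sum_nonneg vec_eq_iff)
qed

lemma ntr_eqI:
  assumes "\<And>V. ntr (V ** X) = ntr (V ** Y)" shows "X = Y"
  using ntr_adj_self_eq_0[of "X - Y"] assms[of "adj (X - Y)"]
  by (simp add: mat_mult_simps ntr_simps del: adj_simps)

lemma matrix_unit_expansion:
  fixes V :: "complex ^ 'n ^ 'n"
  shows "V = (\<Sum>i\<in>UNIV. \<Sum>j\<in>UNIV. V $ i $ j *\<^sub>C outer (axis i 1) (axis j 1))"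
proof -
  have *: "cnj (axis j 1 $ l) = (if l = j then 1 else 0)" for j l :: 'n
    by (simp add: axis_def)
  have **: "axis i (1::complex) $ l = (if l = i then 1 else 0)" for i l :: 'n
    by (simp add: axis_def)
  have "(\<Sum>i\<in>UNIV. \<Sum>j\<in>UNIV. V $ i $ j *
      ((if k = i then 1 else 0) * (if l = j then 1 else 0))) = V $ k $ l" for k l
  proof -
    have "(\<Sum>j\<in>UNIV. V $ i $ j * ((if k = i then 1 else 0) * (if l = j then 1 else 0)))
        = (if k = i then V $ i $ l else 0)" for i
      by (simp add: if_distrib[of "\<lambda>x. _ * x"] cong: if_cong)
    then show ?thesis by simp
  qed
  then show ?thesis
    by (simp add: vec_eq_iff outer_def * ** if_distrib[of cnj] cong: if_cong)
qed

text \<open>Riesz representation for the bilinear trace pairing. The indices of \<open>Y\<close> are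
  transposed because the trace of V Y sums V_ij Y_ji, and the factor \<open>CARD('k)\<close> undoes
  the normalization of \<open>ntr\<close>. Adjoints and the conditional expectation get their
  existence from here.\<close>

lemma linear_functional_ntr:
  fixes F :: "complex ^ 'k ^ 'k \<Rightarrow> complex"
  assumes add: "\<And>X Y. F (X + Y) = F X + F Y" and scale: "\<And>c X. F (c *\<^sub>C X) = c * F X"
  obtains Y where "\<And>V. F V = ntr (V ** Y)"
proof
  define Y :: "complex ^ 'k ^ 'k" where
    "Y = (\<chi> j i. of_nat CARD('k) * F (outer (axis i 1) (axis j 1)))"
  have F0: "F 0 = 0" using scale[of 0 0] by (simp add: cscale_simps)
  have Fsum: "F (\<Sum>i\<in>I. f i) = (\<Sum>i\<in>I. F (f i))" for f and I :: "'k set"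
    by (induction I rule: infinite_finite_induct) (auto simp: add F0)
  fix V
  have "F V = (\<Sum>i\<in>UNIV. \<Sum>j\<in>UNIV. V $ i $ j * F (outer (axis i 1) (axis j 1)))"
    by (subst matrix_unit_expansion[of V]) (simp add: Fsum scale)
  also have "\<dots> = ntr (V ** Y)"
    by (simp add: ntr_def trace_def matrix_matrix_mult_def Y_def sum_distrib_left
        sum_divide_distrib)
  finally show "F V = ntr (V ** Y)" .
qed

section \<open>Inner product, rank-one operators and positivity\<close>

lemma cinner_simps:
  "cinner (u + v) w = cinner u w + cinner v w" "cinner u (v + w) = cinner u v + cinner u w"
  "cinner (u - v) w = cinner u w - cinner v w" "cinner u (v - w) = cinner u v - cinner u w"
  "cinner (c *s u) v = cnj c * cinner u v" "cinner u (c *s v) = c * cinner u v"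
  "cinner 0 v = 0" "cinner u 0 = 0" "cinner (- u) v = - cinner u v" "cinner u (- v) = - cinner u v"
  by (simp_all add: cinner_def algebra_simps sum.distrib sum_subtractf sum_distrib_left sum_negf)

lemma cinner_sum: "cinner u (\<Sum>i\<in>I. f i) = (\<Sum>i\<in>I. cinner u (f i))"
  by (induction I rule: infinite_finite_induct) (auto simp: cinner_simps)

lemma cnj_cinner: "cnj (cinner u v) = cinner v u"
  by (simp add: cinner_def mult.commute)

lemma cinner_adj: "cinner (adj M *v u) v = cinner u (M *v v)"
proof -
  have "cinner (adj M *v u) v = (\<Sum>j\<in>UNIV. \<Sum>i\<in>UNIV. M $ i $ j * cnj (u $ i) * v $ j)"
    by (simp add: cinner_def matrix_vector_mult_def sum_distrib_left sum_distrib_right)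
  also have "\<dots> = cinner u (M *v v)"
    by (subst sum.swap) (simp add: cinner_def matrix_vector_mult_def sum_distrib_left mult_ac)
  finally show ?thesis .
qed

lemma cinner_self: "cinner v v = of_real ((norm v)\<^sup>2)"
proof -
  have "(norm v)\<^sup>2 = (\<Sum>i\<in>UNIV. (cmod (v $ i))\<^sup>2)"
    by (simp add: norm_vec_def L2_set_def sum_nonneg)
  then show ?thesis
    by (simp add: cinner_def complex_norm_square mult.commute del: of_real_power)
qed

lemma cinner_self_eq_0 [simp]: "cinner v v = 0 \<longleftrightarrow> v = 0"
  by (simp add: cinner_self)

lemma outer_mult_vec: "outer u v *v w = cinner v w *s u"
  by (simp add: vec_eq_iff outer_def matrix_vector_mult_def cinner_def sum_distrib_left
      sum_distrib_right mult_ac)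

lemma adj_outer: "adj (outer u v) = outer v u"
  by (simp add: vec_eq_iff outer_def)

lemma matrix_eqI_vec: "(\<And>v. M *v v = N *v v) \<Longrightarrow> M = (N :: complex ^ 'n ^ 'm)"
  by (simp add: matrix_eq)

text \<open>\<open>psd\<close> only constrains the quadratic form, but over the complex numbers the
  form determines the operator: the form of \<open>adj M - M\<close> vanishes, and polarization with
  \<open>u + w\<close> and \<open>u + \<i> *s w\<close> kills all its matrix elements.\<close>

lemma psd_imp_adj: assumes "psd M" shows "adj M = M"
proof -
  have im: "Im (cinner v (M *v v)) = 0" for v using assms by (simp add: psd_def)
  have real: "cinner v (adj M *v v) = cinner v (M *v v)" for v
  proof -
    have "cinner v (adj M *v v) = cnj (cinner v (M *v v))"
      by (metis cinner_adj cnj_cinner)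
    also have "\<dots> = cinner v (M *v v)" using im[of v] by (simp add: complex_eq_iff)
    finally show ?thesis .
  qed
  define D where "D = adj M - M"
  have D0: "cinner v (D *v v) = 0" for v
    using real by (simp add: D_def matrix_vector_mult_diff_rdistrib cinner_simps)
  have "cinner u (D *v w) = 0" for u w
  proof -
    have "0 = cinner (u + w) (D *v (u + w))" using D0 by simp
    also have "\<dots> = cinner u (D *v w) + cinner w (D *v u)"
      by (simp add: matrix_vector_right_distrib cinner_simps D0)
    finally have 1: "cinner u (D *v w) + cinner w (D *v u) = 0" by simp
    have "0 = cinner (u + \<i> *s w) (D *v (u + \<i> *s w))" using D0 by simp
    also have "\<dots> = \<i> * cinner u (D *v w) - \<i> * cinner w (D *v u)"
      by (simp add: matrix_vector_right_distrib cinner_simps mult_vec_smult D0)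
    finally have 2: "\<i> * cinner u (D *v w) - \<i> * cinner w (D *v u) = 0" by simp
    have "\<i> * (cinner u (D *v w) - cinner w (D *v u)) = 0"
      using 2 by (simp add: algebra_simps)
    with 1 show ?thesis by simp
  qed
  then have "D *v w = 0" for w using cinner_self_eq_0 by blast
  then have "D = 0" by (intro matrix_eqI_vec) simp
  then show ?thesis unfolding D_def by (rule eq_iff_diff_eq_0[THEN iffD2])
qed

section \<open>Spectral decomposition\<close>

lemma orthogonal_card_le:
  fixes B :: "(complex ^ 'n) set"
  assumes "finite B" "0 \<notin> B" "\<And>u v. u \<in> B \<Longrightarrow> v \<in> B \<Longrightarrow> u \<noteq> v \<Longrightarrow> cinner u v = 0"
  shows "card B \<le> CARD('n)"
proof -
  have "vec.independent B"
  proof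
    assume "vec.dependent B"
    then obtain c v where cv: "v \<in> B" "c v \<noteq> 0" "(\<Sum>w\<in>B. c w *s w) = 0"
      using vec.dependent_finite[OF assms(1)] by blast
    have "0 = cinner v (\<Sum>w\<in>B. c w *s w)" by (simp add: cv cinner_simps)
    also have "\<dots> = (\<Sum>w\<in>B. c w * cinner v w)" by (simp add: cinner_sum cinner_simps)
    also have "\<dots> = (\<Sum>w\<in>B. if w = v then c v * cinner v v else 0)"
      by (intro sum.cong) (use assms(3) cv(1) in auto)
    also have "\<dots> = c v * cinner v v" using cv assms(1) by simp
    finally show False using cv assms(2) by auto
  qed
  then have "card B \<le> vec.dim (UNIV :: (complex ^ 'n) set)"
    by (intro vec.independent_card_le_dim) auto
  then show ?thesis by (simp only: vec_dim_card)
qed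

lemma orthonormal_residual:
  fixes \<eta> :: "nat \<Rightarrow> complex ^ 'n"
  assumes "\<And>i j. i < k \<Longrightarrow> j < k \<Longrightarrow> cinner (\<eta> i) (\<eta> j) = (if i = j then 1 else 0)" "i < k"
  shows "cinner (\<eta> i) (v - (\<Sum>j<k. cinner (\<eta> j) v *s \<eta> j)) = 0"
proof -
  have "cinner (\<eta> i) (\<Sum>j<k. cinner (\<eta> j) v *s \<eta> j) = (\<Sum>j<k. if i = j then cinner (\<eta> j) v else 0)"
    unfolding cinner_sum by (intro sum.cong) (simp_all add: cinner_simps assms)
  then have "cinner (\<eta> i) (\<Sum>j<k. cinner (\<eta> j) v *s \<eta> j) = cinner (\<eta> i) v"
    using assms(2) by simp
  then show ?thesis by (simp add: cinner_simps)
qed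

lemma orthonormal_extend:
  fixes \<eta> :: "nat \<Rightarrow> complex ^ 'n"
  assumes on: "\<And>i j. i < k \<Longrightarrow> j < k \<Longrightarrow> cinner (\<eta> i) (\<eta> j) = (if i = j then 1 else 0)"
    and k: "k < CARD('n)"
  obtains v where "v \<noteq> 0" "\<And>i. i < k \<Longrightarrow> cinner (\<eta> i) v = 0"
proof (rule ccontr)
  assume neg: "\<not> thesis"
  have "v \<in> vec.span (\<eta> ` {..<k})" for v
  proof -
    have "v - (\<Sum>j<k. cinner (\<eta> j) v *s \<eta> j) = 0"
      using neg that[of "v - (\<Sum>j<k. cinner (\<eta> j) v *s \<eta> j)"] orthonormal_residual[of k \<eta> _ v] on
      by blast
    then have "v = (\<Sum>j<k. cinner (\<eta> j) v *s \<eta> j)" by simp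
    also have "\<dots> \<in> vec.span (\<eta> ` {..<k})"
      by (intro vec.span_sum vec.span_scale vec.span_base) auto
    finally show ?thesis .
  qed
  then have "vec.dim (UNIV :: (complex ^ 'n) set) \<le> card (\<eta> ` {..<k})"
    by (intro vec.dim_le_card) auto
  also have "\<dots> \<le> k" using card_image_le[of "{..<k}" \<eta>] by simp
  finally show False using k by (simp only: vec_dim_card)
qed

lemma onb_cinner:
  "orthonormal_basis \<eta> \<Longrightarrow> i < CARD('n) \<Longrightarrow> j < CARD('n) \<Longrightarrow>
    cinner (\<eta> i) (\<eta> j :: complex ^ 'n) = (if i = j then 1 else 0)"
  by (simp add: orthonormal_basis_def)

text \<open>A nonzero residual would be orthogonal to all \<open>CARD('n)\<close> basis vectors,
  which is one nonzero pairwise orthogonal vector too many.\<close>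

lemma onb_expand:
  fixes v :: "complex ^ 'n"
  assumes "orthonormal_basis \<eta>"
  shows "v = (\<Sum>j<CARD('n). cinner (\<eta> j) v *s \<eta> j)"
proof (rule ccontr)
  define w where "w = v - (\<Sum>j<CARD('n). cinner (\<eta> j) v *s \<eta> j)"
  assume "v \<noteq> (\<Sum>j<CARD('n). cinner (\<eta> j) v *s \<eta> j)"
  then have w0: "w \<noteq> 0" by (simp add: w_def)
  have wo: "cinner (\<eta> i) w = 0" if "i < CARD('n)" for i
    unfolding w_def by (rule orthonormal_residual) (use assms that in \<open>auto simp: onb_cinner\<close>)
  have wo': "cinner w (\<eta> i) = 0" if "i < CARD('n)" for i
    using wo[OF that] cnj_cinner[of "\<eta> i" w] by simp
  have nz: "\<eta> i \<noteq> 0" if "i < CARD('n)" for i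
    using onb_cinner[OF assms that that] by (auto simp: cinner_simps)
  have inj: "inj_on \<eta> {..<CARD('n)}"
  proof
    fix i j assume "i \<in> {..<CARD('n)}" "j \<in> {..<CARD('n)}" "\<eta> i = \<eta> j"
    then show "i = j" using onb_cinner[OF assms, of i j] onb_cinner[OF assms, of i i]
      by (auto split: if_splits)
  qed
  have "card (insert w (\<eta> ` {..<CARD('n)})) \<le> CARD('n)"
  proof (rule orthogonal_card_le)
    fix u v assume "u \<in> insert w (\<eta> ` {..<CARD('n)})" "v \<in> insert w (\<eta> ` {..<CARD('n)})" "u \<noteq> v"
    then show "cinner u v = 0" using wo wo' onb_cinner[OF assms] by auto
  qed (use w0 nz in auto)
  moreover have "w \<notin> \<eta> ` {..<CARD('n)}"
    using wo nz cinner_self_eq_0 by (metis imageE lessThan_iff)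
  ultimately show False using inj by (simp add: card_image)
qed

lemma onb_matrix_eqI:
  fixes M M' :: "complex ^ 'n ^ 'm"
  assumes "orthonormal_basis \<eta>" "\<And>j. j < CARD('n) \<Longrightarrow> M *v \<eta> j = M' *v \<eta> j"
  shows "M = M'"
proof (rule matrix_eqI_vec)
  fix v
  have "M *v (\<Sum>j<CARD('n). cinner (\<eta> j) v *s \<eta> j) = M' *v (\<Sum>j<CARD('n). cinner (\<eta> j) v *s \<eta> j)"
    unfolding mult_vec_sum mult_vec_smult by (intro sum.cong) (simp_all add: assms(2))
  then show "M *v v = M' *v v" using onb_expand[OF assms(1), of v] by simp
qed

lemma onb_cinner_eqI:
  fixes v w :: "complex ^ 'n"
  assumes "orthonormal_basis \<eta>" "\<And>j. j < CARD('n) \<Longrightarrow> cinner (\<eta> j) v = cinner (\<eta> j) w"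
  shows "v = w"
proof -
  have "(\<Sum>j<CARD('n). cinner (\<eta> j) v *s \<eta> j) = (\<Sum>j<CARD('n). cinner (\<eta> j) w *s \<eta> j)"
    by (intro sum.cong) (simp_all add: assms(2))
  then show ?thesis
    using onb_expand[OF assms(1), of v] onb_expand[OF assms(1), of w] by simp
qed

lemma complex_subspace_closed:
  fixes V :: "(complex ^ 'n) set"
  assumes "vec.subspace V" shows "closed V"
proof (rule closed_subspace)
  have "r *\<^sub>R v = complex_of_real r *s v" for r and v :: "complex ^ 'n"
    by (simp add: vec_eq_iff) (simp add: scaleR_conv_of_real)
  then show "subspace V" using assms
    by (auto simp: subspace_def vec.subspace_0 vec.subspace_add vec.subspace_scale)
qed

text \<open>The Rayleigh quotient attains its maximum on the unit sphere of an invariant subspace,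
  and a maximizer is an eigenvector.\<close>

lemma invariant_subspace_eigenvector:
  fixes M :: "complex ^ 'n ^ 'n"
  assumes V: "vec.subspace V" "v0 \<in> V" "v0 \<noteq> 0"
    and inv: "\<And>v. v \<in> V \<Longrightarrow> M *v v \<in> V" and M: "adj M = M"
  obtains v \<mu> where "v \<in> V" "norm v = 1" "M *v v = complex_of_real \<mu> *s v"
proof -
  define q where "q v = Re (cinner v (M *v v))" for v
  have norm_smult: "norm (c *s v) = cmod c * norm v" for c and v :: "complex ^ 'n"
  proof -
    have "complex_of_real ((norm (c *s v))\<^sup>2) = of_real ((cmod c * norm v)\<^sup>2)"
      unfolding cinner_self[symmetric] cinner_simps
      by (simp add: cinner_self power_mult_distrib complex_norm_square mult_ac flip: of_real_power)
    then have "(norm (c *s v))\<^sup>2 = (cmod c * norm v)\<^sup>2" by (simp only: of_real_eq_iff)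
    then show ?thesis by (simp add: power2_eq_iff_nonneg)
  qed
  define v1 where "v1 = complex_of_real (1 / norm v0) *s v0"
  have v1: "v1 \<in> V" "norm v1 = 1"
    using V by (auto simp: v1_def norm_smult vec.subspace_scale norm_divide)
  have comp: "compact (sphere 0 1 \<inter> V)"
    by (intro compact_Int_closed compact_sphere complex_subspace_closed V)
  have cont: "continuous_on (sphere 0 1 \<inter> V) q"
    unfolding q_def cinner_def matrix_vector_mult_def by (intro continuous_intros)
  obtain v where v: "v \<in> V" "norm v = 1" and max: "\<And>w. w \<in> V \<Longrightarrow> norm w = 1 \<Longrightarrow> q w \<le> q v"
  proof -
    have "sphere 0 1 \<inter> V \<noteq> {}" using v1 by auto
    then obtain v where "v \<in> sphere 0 1 \<inter> V" "\<forall>w\<in>sphere 0 1 \<inter> V. q w \<le> q v"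
      using continuous_attains_sup[OF comp _ cont] by blast
    then show ?thesis using that[of v] by simp
  qed
  define \<mu> where "\<mu> = q v"
  have bound: "q w \<le> \<mu> * (norm w)\<^sup>2" if "w \<in> V" for w
  proof (cases "w = 0")
    case False
    define u where "u = complex_of_real (1 / norm w) *s w"
    have "q u \<le> \<mu>" unfolding \<mu>_def
      by (rule max) (use that V False in \<open>auto simp: u_def norm_smult vec.subspace_scale norm_divide\<close>)
    moreover have "q u = (1 / norm w)\<^sup>2 * q w"
      by (simp add: q_def u_def mult_vec_smult cinner_simps power2_eq_square flip: of_real_mult
          of_real_divide mult.assoc)
    ultimately show ?thesis using False by (simp add: field_simps)
  qed (simp add: q_def cinner_simps)
  \<comment> \<open>\<open>B\<close> is \<mu> - \<open>M\<close>. Its quadratic form is nonnegative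
    on \<open>V\<close> and zero at \<open>v\<close>, so along the line \<open>v + t B v\<close> its
    linear term, the squared norm of \<open>B v\<close>, has to vanish.\<close>
  define B where "B w = complex_of_real \<mu> *s w - M *v w" for w
  have qB: "Re (cinner w (B w)) = \<mu> * (norm w)\<^sup>2 - q w" for w
    by (simp add: B_def cinner_simps q_def cinner_self flip: of_real_power)
  have B_sym: "cinner (B u) w = cinner u (B w)" for u w
    using cinner_adj[of M u w] by (simp add: B_def cinner_simps M)
  have B_add: "B (u + complex_of_real t *s w) = B u + complex_of_real t *s B w" for u t w
    by (simp add: B_def matrix_vector_right_distrib mult_vec_smult vec.scale_right_distrib
        vec.scale_right_diff_distrib mult.commute)
  have BV: "B w \<in> V" if "w \<in> V" for w
    unfolding B_def using that V inv by (intro vec.subspace_diff vec.subspace_scale)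
  have Bv0: "Re (cinner v (B v)) = 0" using v(2) by (simp add: qB \<mu>_def)
  define a where "a = (norm (B v))\<^sup>2"
  define b where "b = Re (cinner (B v) (B (B v)))"
  have b0: "b \<ge> 0" using bound[OF BV[OF v(1)]] by (simp add: b_def qB)
  have BB: "Re (cinner v (B (B v))) = a"
    unfolding B_sym[of v "B v", symmetric] a_def cinner_self by simp
  have pos: "0 \<le> 2 * t * a + t\<^sup>2 * b" for t :: real
  proof -
    have "v + complex_of_real t *s B v \<in> V"
      using v BV V by (intro vec.subspace_add vec.subspace_scale) auto
    then have "0 \<le> Re (cinner (v + complex_of_real t *s B v) (B (v + complex_of_real t *s B v)))"
      using bound by (simp add: qB)
    also have "\<dots> = 2 * t * a + t\<^sup>2 * b"
      using Bv0 BB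
      by (simp add: B_add cinner_simps a_def b_def cinner_self[of "B v"] algebra_simps
          power2_eq_square flip: of_real_power of_real_mult)
    finally show ?thesis .
  qed
  have "a = 0"
  proof (rule ccontr)
    assume "a \<noteq> 0"
    then have a: "a > 0" by (simp add: a_def)
    \<comment> \<open>The shift by 1 keeps the denominator positive even for \<open>b = 0\<close>;
      at \<open>t = - a / c\<close> the quadratic becomes strictly negative.\<close>
    define c where "c = b + 1"
    have c: "c > 0" "b = c - 1" using b0 by (auto simp: c_def)
    have "2 * (- a / c) * a + (- a / c)\<^sup>2 * b = - (a\<^sup>2 * (c + 1)) / c\<^sup>2"
      using c(1) unfolding c(2) by (simp add: divide_simps) (simp add: algebra_simps power2_eq_square)
    also have "\<dots> < 0" using a c by (simp add: divide_neg_pos)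
    finally show False using pos[of "- a / c"] by linarith
  qed
  then have "B v = 0" by (simp add: a_def)
  then have "M *v v = complex_of_real \<mu> *s v" by (simp add: B_def)
  with v that show ?thesis by blast
qed

text \<open>Induction on the number of vectors found. The orthogonal complement of the earlier ones
  is invariant under both operators. Inside it an eigenspace of \<open>H\<close> is invariant under
  \<open>A\<close> because the two commute, and \<open>A\<close> has an eigenvector there.\<close>

lemma commuting_selfadjoint_onb:
  fixes H A :: "complex ^ 'n ^ 'n"
  assumes H: "adj H = H" and A: "adj A = A" and comm: "H ** A = A ** H"
  shows "\<exists>\<eta> h a. orthonormal_basis \<eta> \<and>
    (\<forall>j<CARD('n). H *v \<eta> j = complex_of_real (h j) *s \<eta> j) \<and>
    (\<forall>j<CARD('n). A *v \<eta> j = complex_of_real (a j) *s \<eta> j)"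
proof -
  have "\<exists>\<eta> :: nat \<Rightarrow> complex ^ 'n.
      (\<forall>i<k. \<forall>j<k. cinner (\<eta> i) (\<eta> j) = (if i = j then 1 else 0)) \<and>
      (\<forall>j<k. \<exists>h a. H *v \<eta> j = complex_of_real h *s \<eta> j \<and> A *v \<eta> j = complex_of_real a *s \<eta> j)"
    if "k \<le> CARD('n)" for k
    using that
  proof (induction k)
    case (Suc k)
    then obtain \<eta> :: "nat \<Rightarrow> complex ^ 'n" where
      on: "\<And>i j. i < k \<Longrightarrow> j < k \<Longrightarrow> cinner (\<eta> i) (\<eta> j) = (if i = j then 1 else 0)" and
      ev: "\<And>j. j < k \<Longrightarrow> \<exists>h a. H *v \<eta> j = complex_of_real h *s \<eta> j \<and> A *v \<eta> j = complex_of_real a *s \<eta> j"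
      by auto
    define V where "V = {v. \<forall>i<k. cinner (\<eta> i) v = 0}"
    obtain v0 where v0: "v0 \<in> V" "v0 \<noteq> 0"
      using orthonormal_extend[OF on, of k] Suc.prems unfolding V_def by auto
    have V: "vec.subspace V"
      unfolding vec.subspace_def V_def by (auto simp: cinner_simps)
    have orth: "cinner (\<eta> i) (M *v v) = 0"
      if "adj M = M" "v \<in> V" "i < k" "M *v \<eta> i = c *s \<eta> i" for M v i c
    proof -
      have "cinner (\<eta> i) (M *v v) = cinner (M *v \<eta> i) v" using cinner_adj[of M "\<eta> i" v] that by simp
      then show ?thesis using that by (simp add: V_def cinner_simps)
    qed
    have HV: "H *v v \<in> V" and AV: "A *v v \<in> V" if "v \<in> V" for v
      unfolding V_def using orth[OF H that] orth[OF A that] ev by blast+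
    obtain v1 h where v1: "v1 \<in> V" "norm v1 = 1" "H *v v1 = complex_of_real h *s v1"
      using invariant_subspace_eigenvector[OF V v0 HV H] by blast
    define V' where "V' = {v\<in>V. H *v v = complex_of_real h *s v}"
    have V': "vec.subspace V'"
      using V unfolding V'_def vec.subspace_def
      by (auto simp: matrix_vector_right_distrib mult_vec_smult vec.scale_right_distrib mult.commute)
    have AV': "A *v v \<in> V'" if "v \<in> V'" for v
    proof -
      have "H *v (A *v v) = A *v (H *v v)" by (simp add: matrix_vector_mul_assoc comm)
      then show ?thesis using that AV by (simp add: V'_def mult_vec_smult)
    qed
    have "v1 \<in> V'" "v1 \<noteq> 0" using v1 by (auto simp: V'_def)
    then obtain v a where v: "v \<in> V'" "norm v = 1" "A *v v = complex_of_real a *s v"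
      using invariant_subspace_eigenvector[OF V' _ _ AV' A] by blast
    have o: "cinner (\<eta> i) v = 0" "cinner v (\<eta> i) = 0" if "i < k" for i
      using v that cnj_cinner[of "\<eta> i" v] by (auto simp: V'_def V_def)
    have vv: "cinner v v = 1" using v by (simp add: cinner_self)
    have Hv: "H *v v = complex_of_real h *s v" using v by (simp add: V'_def)
    show ?case
      by (rule exI[of _ "\<eta>(k := v)"]) (use on ev o vv Hv v in \<open>auto simp: less_Suc_eq\<close>)
  qed auto
  from this[of "CARD('n)"] obtain \<eta> :: "nat \<Rightarrow> complex ^ 'n" where
    on: "orthonormal_basis \<eta>" and
    ev: "\<forall>j<CARD('n). \<exists>h a. H *v \<eta> j = complex_of_real h *s \<eta> j \<and> A *v \<eta> j = complex_of_real a *s \<eta> j"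
    unfolding orthonormal_basis_def by auto
  then obtain h a where "\<forall>j<CARD('n). H *v \<eta> j = complex_of_real (h j) *s \<eta> j"
    "\<forall>j<CARD('n). A *v \<eta> j = complex_of_real (a j) *s \<eta> j"
    by metis
  with on show ?thesis by blast
qed

section \<open>Functional calculus in a fixed orthonormal basis\<close>

definition spec :: "(nat \<Rightarrow> complex ^ 'n) \<Rightarrow> (nat \<Rightarrow> complex) \<Rightarrow> complex ^ 'n ^ 'n" where
  "spec \<eta> d = (\<Sum>j<CARD('n). d j *\<^sub>C outer (\<eta> j) (\<eta> j))"

lemma spec_mult_vec:
  "spec \<eta> d *v v = (\<Sum>j<CARD('n). (d j * cinner (\<eta> j) v) *s (\<eta> j :: complex ^ 'n))"
  by (simp add: spec_def sum_mult_vec cscale_mult_vec outer_mult_vec)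

lemma spec_basis:
  fixes \<eta> :: "nat \<Rightarrow> complex ^ 'n"
  assumes "orthonormal_basis \<eta>" "j < CARD('n)"
  shows "spec \<eta> d *v \<eta> j = d j *s \<eta> j"
proof -
  have "spec \<eta> d *v \<eta> j = (\<Sum>i<CARD('n). if i = j then d j *s \<eta> j else 0)"
    unfolding spec_mult_vec by (intro sum.cong) (auto simp: onb_cinner[OF assms(1)] assms(2))
  then show ?thesis using assms(2) by simp
qed

lemma spec_eqI:
  fixes \<eta> :: "nat \<Rightarrow> complex ^ 'n"
  assumes "orthonormal_basis \<eta>" "\<And>j. j < CARD('n) \<Longrightarrow> M *v \<eta> j = d j *s \<eta> j"
  shows "M = spec \<eta> d"
  by (rule onb_matrix_eqI[OF assms(1)]) (simp add: spec_basis assms)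

lemma spec_cong:
  fixes \<eta> :: "nat \<Rightarrow> complex ^ 'n"
  shows "(\<And>j. j < CARD('n) \<Longrightarrow> d j = e j) \<Longrightarrow> spec \<eta> d = spec \<eta> e"
  by (simp add: spec_def)

lemma spec_linear:
  fixes \<eta> :: "nat \<Rightarrow> complex ^ 'n"
  shows "spec \<eta> d + spec \<eta> e = spec \<eta> (\<lambda>j. d j + e j)"
    "spec \<eta> d - spec \<eta> e = spec \<eta> (\<lambda>j. d j - e j)"
    "c *\<^sub>C spec \<eta> d = spec \<eta> (\<lambda>j. c * d j)"
    "r *\<^sub>R spec \<eta> d = spec \<eta> (\<lambda>j. of_real r * d j)"
    "- spec \<eta> d = spec \<eta> (\<lambda>j. - d j)"
  by (simp_all add: spec_def cscale_left sum.distrib sum_subtractf cscale_sum cscale_simps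
      scaleR_cscale sum_negf)

lemma spec_adj: "adj (spec \<eta> d) = spec \<eta> (\<lambda>j. cnj (d j))"
  by (simp add: spec_def adj_sum adj_outer)

context
  fixes \<eta> :: "nat \<Rightarrow> complex ^ 'n"
  assumes onb: "orthonormal_basis \<eta>"
begin

lemma spec_mult: "spec \<eta> d ** spec \<eta> e = spec \<eta> (\<lambda>j. d j * e j)"
  by (rule spec_eqI[OF onb])
    (simp add: matrix_vector_mul_assoc[symmetric] spec_basis[OF onb] mult_vec_smult)

lemma spec_one: "spec \<eta> (\<lambda>j. 1) = mat 1"
  by (rule spec_eqI[OF onb, symmetric]) simp

lemma spec_cinner: "cinner v (spec \<eta> d *v v) = (\<Sum>j<CARD('n). d j * of_real ((cmod (cinner (\<eta> j) v))\<^sup>2))"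
proof -
  have "cinner v (spec \<eta> d *v v) = (\<Sum>j<CARD('n). d j * (cinner (\<eta> j) v * cinner v (\<eta> j)))"
    by (simp add: spec_mult_vec cinner_sum cinner_simps mult.assoc)
  moreover have "cinner (\<eta> j) v * cinner v (\<eta> j) = of_real ((cmod (cinner (\<eta> j) v))\<^sup>2)" for j
    unfolding complex_norm_square using cnj_cinner[of "\<eta> j" v] by simp
  ultimately show ?thesis by simp
qed

lemma psd_spec:
  assumes "\<And>j. j < CARD('n) \<Longrightarrow> 0 \<le> d j"
  shows "psd (spec \<eta> (\<lambda>j. complex_of_real (d j)))"
  unfolding psd_def spec_cinner of_real_mult[symmetric] of_real_sum[symmetric]
  using assms by (auto intro!: sum_nonneg)

lemma psd_spec_ge_0:
  assumes "psd (spec \<eta> (\<lambda>j. complex_of_real (d j)))" "j < CARD('n)"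
  shows "0 \<le> d j"
proof -
  have "0 \<le> Re (cinner (\<eta> j) (spec \<eta> (\<lambda>j. complex_of_real (d j)) *v \<eta> j))"
    using assms by (simp add: psd_def)
  then show ?thesis
    using assms(2) by (simp add: spec_basis[OF onb] cinner_simps onb_cinner[OF onb])
qed

text \<open>The substance is uniqueness. For another positive root \<open>P\<close>, the defect
  \<open>w\<close> of \<open>\<eta> j\<close> satisfies \<open>P w = - p w\<close> with
  \<open>p = sqrt (d j)\<close>. If \<open>p > 0\<close>, positivity leaves only
  \<open>w = 0\<close>; if \<open>p = 0\<close>, then \<open>w = P \<eta> j\<close> has norm zero
  because \<open>P\<close> is self-adjoint and \<open>P ** P\<close> kills
  \<open>\<eta> j\<close>.\<close>

lemma op_sqrt_spec:
  assumes "\<And>j. j < CARD('n) \<Longrightarrow> 0 \<le> d j"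
  shows "op_sqrt (spec \<eta> (\<lambda>j. complex_of_real (d j))) = spec \<eta> (\<lambda>j. complex_of_real (sqrt (d j)))"
  unfolding op_sqrt_def
proof (rule the_equality)
  show "psd (spec \<eta> (\<lambda>j. complex_of_real (sqrt (d j)))) \<and>
      spec \<eta> (\<lambda>j. complex_of_real (sqrt (d j))) ** spec \<eta> (\<lambda>j. complex_of_real (sqrt (d j)))
        = spec \<eta> (\<lambda>j. complex_of_real (d j))"
    using assms by (auto simp: spec_mult simp flip: of_real_mult intro!: psd_spec spec_cong)
next
  fix P assume P: "psd P \<and> P ** P = spec \<eta> (\<lambda>j. complex_of_real (d j))"
  have Pa: "adj P = P" using P psd_imp_adj by blast
  show "P = spec \<eta> (\<lambda>j. complex_of_real (sqrt (d j)))"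
  proof (rule spec_eqI[OF onb])
    fix j assume j: "j < CARD('n)"
    define p where "p = sqrt (d j)"
    have p: "p \<ge> 0" "p * p = d j" using assms[OF j] by (auto simp: p_def)
    have PP: "P *v (P *v \<eta> j) = complex_of_real (p * p) *s \<eta> j"
      using P p by (simp add: matrix_vector_mul_assoc spec_basis[OF onb j])
    define w where "w = P *v \<eta> j - complex_of_real p *s \<eta> j"
    have Pw: "P *v w = - (complex_of_real p *s w)"
      using PP by (simp add: w_def matrix_vector_mult_diff_distrib mult_vec_smult
          vec.scale_right_diff_distrib)
    have ww: "0 \<le> - p * (norm w)\<^sup>2"
      using P unfolding psd_def
      by (elim conjE, elim allE[of _ w]) (simp add: Pw cinner_simps cinner_self flip: of_real_power)
    have "w = 0"
    proof (cases "p = 0")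
      case True
      have "cinner (P *v \<eta> j) (P *v \<eta> j) = cinner (\<eta> j) (P *v (P *v \<eta> j))"
        using cinner_adj[of P "\<eta> j" "P *v \<eta> j"] Pa by simp
      then show ?thesis using PP True by (simp add: w_def cinner_simps)
    next
      case False
      then have "p > 0" using p by simp
      with ww have "(norm w)\<^sup>2 \<le> 0" by (simp add: mult_le_0_iff)
      then show ?thesis by simp
    qed
    then show "P *v \<eta> j = complex_of_real (sqrt (d j)) *s \<eta> j" by (simp add: w_def p_def)
  qed
qed

text \<open>\<open>matrix_inv\<close> is a choice operator; its value is pinned down by cancelling
  against an explicit two-sided inverse.\<close>

lemma matrix_inv_spec:
  assumes "\<And>j. j < CARD('n) \<Longrightarrow> d j \<noteq> 0"
  shows "matrix_inv (spec \<eta> d) = spec \<eta> (\<lambda>j. inverse (d j))"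
proof -
  have 1: "spec \<eta> d ** spec \<eta> (\<lambda>j. inverse (d j)) = mat 1"
    "spec \<eta> (\<lambda>j. inverse (d j)) ** spec \<eta> d = mat 1"
    unfolding spec_mult spec_one[symmetric] by (rule spec_cong, simp add: assms)+
  then have "matrix_inv (spec \<eta> d) ** spec \<eta> d = mat 1"
    unfolding matrix_inv_def
    by (metis (mono_tags, lifting) someI_ex)
  then have "matrix_inv (spec \<eta> d) ** (spec \<eta> d ** spec \<eta> (\<lambda>j. inverse (d j)))
      = spec \<eta> (\<lambda>j. inverse (d j))"
    by (simp add: matrix_mul_assoc)
  then show ?thesis by (simp add: 1)
qed

lemma tendsto_spec:
  assumes "\<And>j. j < CARD('n) \<Longrightarrow> ((\<lambda>x. d x j) \<longlongrightarrow> e j) F"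
  shows "((\<lambda>x. spec \<eta> (d x)) \<longlongrightarrow> spec \<eta> e) F"
proof -
  have comp: "spec \<eta> d $ i $ k = (\<Sum>j<CARD('n). d j * outer (\<eta> j) (\<eta> j) $ i $ k)" for d i k
    by (simp add: spec_def)
  show ?thesis
    by (intro vec_tendstoI) (unfold comp, intro tendsto_sum tendsto_mult tendsto_const assms, simp)
qed

text \<open>Kept as a convergent series, not just a value, because the partial sums serve to place
  the parity operator in the generated algebra.\<close>

lemma exp_series_spec_sums:
  "(\<lambda>k. (1 / fact k) *\<^sub>R (((**) (spec \<eta> d) ^^ k) (mat 1))) sums spec \<eta> (\<lambda>j. exp (d j))"
proof -
  have pow: "((**) (spec \<eta> d) ^^ k) (mat 1) = spec \<eta> (\<lambda>j. d j ^ k)" for k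
    by (induction k) (simp_all add: spec_one spec_mult)
  have sum: "(\<Sum>k<m. spec \<eta> (e k)) = spec \<eta> (\<lambda>j. \<Sum>k<m. e k j)" for e and m :: nat
    by (induction m) (simp_all add: spec_linear, simp add: spec_def cscale_simps)
  have "(\<lambda>k. (1 / fact k) *\<^sub>R spec \<eta> (\<lambda>j. d j ^ k)) sums spec \<eta> (\<lambda>j. exp (d j))"
    unfolding sums_def spec_linear sum
  proof (rule tendsto_spec)
    fix j
    have "(\<lambda>k. d j ^ k /\<^sub>R fact k) sums exp (d j)" by (rule exp_converges)
    then show "(\<lambda>m. \<Sum>k<m. complex_of_real (1 / fact k) * d j ^ k) \<longlonglongrightarrow> exp (d j)"
      by (simp add: sums_def scaleR_conv_of_real divide_inverse)
  qed
  then show ?thesis unfolding pow .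
qed

lemma op_exp_spec: "op_exp (spec \<eta> d) = spec \<eta> (\<lambda>j. exp (d j))"
  unfolding op_exp_def by (rule sums_unique[OF exp_series_spec_sums, symmetric])

end

section \<open>The parity operator of a CAR field\<close>

lemma matrix_mult_assoc_right:
  fixes A :: "complex ^ 'a ^ 'b"
  shows "(A ** B) ** C = A ** (B ** C)"
  by (rule matrix_mul_assoc[symmetric])

locale car =
  fixes Z :: "complex ^ 'n \<Rightarrow> complex ^ 'k ^ 'k"
  assumes car: "car_field Z"
begin

lemma Z_add: "Z (\<psi> + \<phi>) = Z \<psi> + Z \<phi>"
  and Z_smult: "Z (c *s \<psi>) = cnj c *\<^sub>C Z \<psi>"
  and Z_adj: "Z \<psi> ** adj (Z \<phi>) + adj (Z \<phi>) ** Z \<psi> = cinner \<psi> \<phi> *\<^sub>C mat 1"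
  and Z_Z: "Z \<psi> ** Z \<phi> + Z \<phi> ** Z \<psi> = 0"
  using car by (simp_all add: car_field_def)

lemma Z_zero [simp]: "Z 0 = 0"
  using Z_smult[of 0 0] by (simp add: cscale_simps)

lemma Z_sum: "Z (\<Sum>i\<in>I. f i) = (\<Sum>i\<in>I. Z (f i))"
  by (induction I rule: infinite_finite_induct) (auto simp: Z_add)

lemma Z_anti: "Z \<psi> ** Z \<phi> = - (Z \<phi> ** Z \<psi>)"
  using Z_Z by (simp add: eq_neg_iff_add_eq_0)

lemma adj_Z_anti: "adj (Z \<psi>) ** adj (Z \<phi>) = - (adj (Z \<phi>) ** adj (Z \<psi>))"
  using Z_anti[of \<phi> \<psi>] by (metis adj_mult adj_simps(3))

lemma adj_Z_swap: "adj (Z \<phi>) ** Z \<psi> = cinner \<psi> \<phi> *\<^sub>C mat 1 - Z \<psi> ** adj (Z \<phi>)"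
  using Z_adj[of \<psi> \<phi>] by (simp add: algebra_simps)

definition W where "W = W_op Z"

text \<open>Each \<open>Z \<psi>\<close> lowers the particle number by one: moving it past one
  summand of the number operator costs \<open>cinner \<psi> e *\<^sub>C Z e\<close>, and over the
  standard basis these costs add up to \<open>Z \<psi>\<close>.\<close>

lemma number_op_comm: "number_op Z ** Z \<psi> = Z \<psi> ** number_op Z - Z \<psi>"
proof -
  have t: "adj (Z e) ** Z e ** Z \<psi> = Z \<psi> ** (adj (Z e) ** Z e) - cinner \<psi> e *\<^sub>C Z e" for e
  proof -
    have "adj (Z e) ** Z e ** Z \<psi> = - (adj (Z e) ** Z \<psi> ** Z e)"
      using Z_anti[of e \<psi>] by (simp add: matrix_mult_assoc_right mat_mult_simps)
    then show ?thesis
      by (simp add: adj_Z_swap mat_mult_simps cscale_mult matrix_mult_assoc_right)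
  qed
  have "\<psi> = (\<Sum>j\<in>UNIV. \<psi> $ j *s axis j 1)"
    by (simp add: basis_expansion)
  then have "Z \<psi> = (\<Sum>j\<in>UNIV. cnj (\<psi> $ j) *\<^sub>C Z (axis j 1))"
    by (metis (no_types, lifting) Z_smult Z_sum sum.cong)
  moreover have "cinner \<psi> (axis j 1) = cnj (\<psi> $ j)" for j
    by (simp add: cinner_def axis_def if_distrib[of "\<lambda>x. _ * x"] cong: if_cong)
  ultimately have "(\<Sum>j\<in>UNIV. cinner \<psi> (axis j 1) *\<^sub>C Z (axis j 1)) = Z \<psi>" by simp
  then show ?thesis
    by (simp add: number_op_def mat_mult_sum t sum_subtractf)
qed

lemma number_op_adj: "adj (number_op Z) = number_op Z"
  by (simp add: number_op_def adj_sum)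

lemma number_op_spectrum:
  "\<exists>\<eta> \<nu>. orthonormal_basis \<eta> \<and> number_op Z = spec \<eta> (\<lambda>j. complex_of_real (\<nu> j))"
proof -
  obtain \<eta> \<nu> where onb: "orthonormal_basis \<eta>"
    and ev: "\<And>j. j < CARD('k) \<Longrightarrow> number_op Z *v \<eta> j = complex_of_real (\<nu> j) *s \<eta> j"
    using commuting_selfadjoint_onb[OF number_op_adj number_op_adj refl] by blast
  have "number_op Z = spec \<eta> (\<lambda>j. complex_of_real (\<nu> j))" by (rule spec_eqI[OF onb ev])
  with onb show ?thesis by blast
qed

lemma number_op_cinner:
  "cinner v (number_op Z *v v) = of_real (\<Sum>j\<in>UNIV. (norm (Z (axis j 1) *v v))\<^sup>2)"
proof -
  have "cinner v (adj (Z e) *v (Z e *v v)) = of_real ((norm (Z e *v v))\<^sup>2)" for e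
    using cinner_adj[of "adj (Z e)" v "Z e *v v"] by (simp add: cinner_self)
  then show ?thesis
    by (simp add: number_op_def sum_mult_vec cinner_sum matrix_vector_mul_assoc[symmetric])
qed

lemma number_op_eigenvalue_lower:
  assumes "number_op Z *v v = complex_of_real \<nu> *s v"
  shows "number_op Z *v (Z \<psi> *v v) = complex_of_real (\<nu> - 1) *s (Z \<psi> *v v)"
proof -
  have "number_op Z *v (Z \<psi> *v v) = Z \<psi> *v (number_op Z *v v) - Z \<psi> *v v"
    by (simp add: matrix_vector_mul_assoc number_op_comm matrix_vector_mult_diff_rdistrib)
  then show ?thesis by (simp add: assms mult_vec_smult vec.scale_left_diff_distrib)
qed

text \<open>Integrality of the eigenvalues in the form that makes \<open>W\<close> an involution.
  Lowering an eigenvector reduces \<nu> by one and flips the sign of the exponential. No eigenvalue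
  is negative, so the descent ends at a vector killed by all \<open>Z (axis j 1)\<close>, where
  \<nu> = 0. The induction runs on an integer bound for \<nu>.\<close>

lemma number_op_eigenvalue_int:
  assumes "number_op Z *v v = complex_of_real \<nu> *s v" "v \<noteq> 0"
  shows "exp (\<i> * of_real pi * of_real \<nu>) ^ 2 = 1"
proof -
  have "\<forall>\<nu> v. number_op Z *v v = complex_of_real \<nu> *s v \<longrightarrow> v \<noteq> 0 \<longrightarrow> \<nu> < real k \<longrightarrow>
      exp (\<i> * of_real pi * of_real \<nu>) ^ 2 = 1" for k
  proof (induction k)
    case 0
    have "\<nu> \<ge> 0" if "number_op Z *v v = complex_of_real \<nu> *s v" "v \<noteq> 0" for \<nu> v
    proof -
      have "complex_of_real (\<nu> * (norm v)\<^sup>2) = of_real (\<Sum>j\<in>UNIV. (norm (Z (axis j 1) *v v))\<^sup>2)"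
        using number_op_cinner[of v] that by (simp add: cinner_simps cinner_self)
      then have "\<nu> * (norm v)\<^sup>2 = (\<Sum>j\<in>UNIV. (norm (Z (axis j 1) *v v))\<^sup>2)"
        by (simp only: of_real_eq_iff)
      then have "\<nu> * (norm v)\<^sup>2 \<ge> 0" by (simp add: sum_nonneg)
      then show ?thesis using that by (simp add: zero_le_mult_iff)
    qed
    then show ?case by force
  next
    case (Suc k)
    show ?case
    proof (intro allI impI)
      fix \<nu> v assume v: "number_op Z *v v = complex_of_real \<nu> *s v" "v \<noteq> 0" "\<nu> < real (Suc k)"
      show "exp (\<i> * of_real pi * of_real \<nu>) ^ 2 = 1"
      proof (cases "\<forall>j. Z (axis j 1) *v v = 0")
        case True
        then have "number_op Z *v v = 0"
          by (simp add: number_op_def sum_mult_vec matrix_vector_mul_assoc[symmetric])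
        then have "\<nu> = 0" using v by (simp add: vec.scale_eq_0_iff)
        then show ?thesis by simp
      next
        case False
        then obtain j where j: "Z (axis j 1) *v v \<noteq> 0" by blast
        have "exp (\<i> * of_real pi * of_real (\<nu> - 1)) ^ 2 = 1"
          using Suc.IH number_op_eigenvalue_lower[OF v(1)] j v(3) by fastforce
        moreover have "exp (\<i> * of_real pi * of_real (\<nu> - 1)) = - exp (\<i> * of_real pi * of_real \<nu>)"
          by (simp add: algebra_simps exp_diff)
        ultimately show ?thesis by simp
      qed
    qed
  qed
  moreover obtain k where "\<nu> < real k" using reals_Archimedean2 by blast
  ultimately show ?thesis using assms by blast
qed

lemma W_spectrum:
  assumes "orthonormal_basis \<eta>" "number_op Z = spec \<eta> (\<lambda>j. complex_of_real (\<nu> j))"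
  shows "W = spec \<eta> (\<lambda>j. exp (\<i> * of_real pi * of_real (\<nu> j)))"
  by (simp add: W_def W_op_def assms spec_linear op_exp_spec)

text \<open>Arbitrary eigenvectors are covered since \<open>Z \<psi>\<close> takes basis vectors to
  eigenvectors outside the chosen basis. The component of \<open>v\<close> along
  \<open>\<eta> j\<close> vanishes unless \<open>\<mu> j = \<nu>\<close>.\<close>

lemma W_eigenvector:
  assumes v: "number_op Z *v v = complex_of_real \<nu> *s v"
  shows "W *v v = exp (\<i> * of_real pi * of_real \<nu>) *s v"
proof -
  obtain \<eta> \<mu> where onb: "orthonormal_basis \<eta>" and N: "number_op Z = spec \<eta> (\<lambda>j. complex_of_real (\<mu> j))"
    using number_op_spectrum by blast
  show ?thesis
  proof (rule onb_cinner_eqI[OF onb])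
    fix j assume j: "j < CARD('k)"
    have sp: "cinner (\<eta> j) (spec \<eta> d *v v) = d j * cinner (\<eta> j) v" for d
    proof -
      have "cinner (\<eta> j) (spec \<eta> d *v v) = cinner (spec \<eta> (\<lambda>j. cnj (d j)) *v \<eta> j) v"
        using cinner_adj[of "spec \<eta> d" "\<eta> j" v] by (simp add: spec_adj)
      then show ?thesis by (simp add: spec_basis[OF onb j] cinner_simps)
    qed
    have "complex_of_real (\<mu> j) * cinner (\<eta> j) v = complex_of_real \<nu> * cinner (\<eta> j) v"
      using sp[of "\<lambda>j. complex_of_real (\<mu> j)"] v by (auto simp: N cinner_simps)
    then have "\<mu> j = \<nu> \<or> cinner (\<eta> j) v = 0" by (metis mult_cancel_right of_real_eq_iff)
    then show "cinner (\<eta> j) (W *v v) = cinner (\<eta> j) (exp (\<i> * of_real pi * of_real \<nu>) *s v)"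
      by (auto simp: W_spectrum[OF onb N] sp cinner_simps)
  qed
qed

text \<open>Lowering the eigenvalue by one contributes the factor exp (- i \<pi>) = -1.\<close>

lemma W_Z: "W ** Z \<psi> = - (Z \<psi> ** W)"
proof -
  obtain \<eta> \<mu> where onb: "orthonormal_basis \<eta>" and N: "number_op Z = spec \<eta> (\<lambda>j. complex_of_real (\<mu> j))"
    using number_op_spectrum by blast
  have ev: "number_op Z *v \<eta> j = complex_of_real (\<mu> j) *s \<eta> j" if "j < CARD('k)" for j
    by (simp add: N spec_basis[OF onb that])
  show ?thesis
  proof (rule onb_matrix_eqI[OF onb])
    fix j assume j: "j < CARD('k)"
    have "exp (\<i> * of_real pi * of_real (\<mu> j - 1)) = - exp (\<i> * of_real pi * of_real (\<mu> j))"
      by (simp add: algebra_simps exp_diff)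
    then show "(W ** Z \<psi>) *v \<eta> j = (- (Z \<psi> ** W)) *v \<eta> j"
      using W_eigenvector[OF number_op_eigenvalue_lower[OF ev[OF j]], of \<psi>] W_eigenvector[OF ev[OF j]]
      by (simp add: matrix_vector_mul_assoc[symmetric] mult_vec_smult mat_mult_simps(6)[symmetric]
          flip: vec.neg)
        (simp add: matrix_vector_mult_def vec_eq_iff sum_negf sum_distrib_left mult_ac)
  qed
qed

text \<open>The eigenvalues of \<open>W\<close> are unimodular with square one, hence real.\<close>

lemma W_W: "W ** W = mat 1" and W_adj: "adj W = W"
proof -
  obtain \<eta> \<mu> where onb: "orthonormal_basis \<eta>" and N: "number_op Z = spec \<eta> (\<lambda>j. complex_of_real (\<mu> j))"
    using number_op_spectrum by blast
  have ev: "number_op Z *v \<eta> j = complex_of_real (\<mu> j) *s \<eta> j" if "j < CARD('k)" for j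
    by (simp add: N spec_basis[OF onb that])
  define w where "w j = exp (\<i> * of_real pi * of_real (\<mu> j))" for j
  have W: "W = spec \<eta> w" using W_spectrum[OF onb N] by (simp add: w_def[abs_def])
  have ww: "w j * w j = 1" if "j < CARD('k)" for j
  proof -
    have "\<eta> j \<noteq> 0" using onb_cinner[OF onb that that] by (auto simp: cinner_simps)
    then show ?thesis
      using number_op_eigenvalue_int[OF ev[OF that]] by (simp add: w_def power2_eq_square)
  qed
  have cw: "cnj (w j) = w j" if "j < CARD('k)" for j
  proof -
    have "cnj (w j) * w j = 1"
      by (simp add: w_def exp_cnj exp_add[symmetric])
    then have "cnj (w j) * (w j * w j) = w j" by (simp add: mult.assoc[symmetric])
    then show ?thesis by (simp add: ww[OF that])
  qed
  show "W ** W = mat 1"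
    unfolding W spec_mult[OF onb] spec_one[OF onb, symmetric] by (rule spec_cong) (rule ww)
  show "adj W = W"
    unfolding W spec_adj by (rule spec_cong) (rule cw)
qed

lemma W_adj_Z: "W ** adj (Z \<psi>) = - (adj (Z \<psi>) ** W)"
proof -
  have "adj (W ** Z \<psi>) = adj (- (Z \<psi> ** W))" by (simp only: W_Z)
  then have "adj (Z \<psi>) ** W = - (W ** adj (Z \<psi>))" by (simp add: W_adj)
  then show ?thesis by simp
qed

end

section \<open>Closure properties of the generated algebra\<close>

lemma star_algebra_zero: "0 \<in> star_algebra G"
  using star_algebra.scale[OF star_algebra.one, of 0 G] by (simp add: cscale_simps)

lemma star_algebra_neg: "X \<in> star_algebra G \<Longrightarrow> - X \<in> star_algebra G"
  using star_algebra.scale[of X G "-1"] by (simp add: cscale_simps)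

lemma star_algebra_sum: "(\<And>i. i \<in> I \<Longrightarrow> f i \<in> star_algebra G) \<Longrightarrow> (\<Sum>i\<in>I. f i) \<in> star_algebra G"
  by (induction I rule: infinite_finite_induct) (auto intro: star_algebra_zero star_algebra.add)

lemma star_algebra_closed: "closed (star_algebra G)"
  by (rule closed_subspace)
    (auto simp: subspace_def scaleR_cscale intro: star_algebra_zero star_algebra.add star_algebra.scale)

text \<open>All partial sums of the exponential series lie in the algebra, which is closed as a
  subspace of a finite-dimensional space.\<close>

lemma (in car) W_in_star_algebra: "W \<in> star_algebra (range Z)"
proof -
  obtain \<eta> \<mu> where onb: "orthonormal_basis \<eta>" and N: "number_op Z = spec \<eta> (\<lambda>j. complex_of_real (\<mu> j))"
    using number_op_spectrum by blast
  define M where "M = (\<i> * of_real pi) *\<^sub>C number_op Z"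
  have M: "M = spec \<eta> (\<lambda>j. \<i> * of_real pi * of_real (\<mu> j))" by (simp add: M_def N spec_linear)
  have "number_op Z \<in> star_algebra (range Z)"
    unfolding number_op_def
    by (intro star_algebra_sum star_algebra.mult star_algebra.star star_algebra.gen) auto
  then have "M \<in> star_algebra (range Z)" unfolding M_def by (rule star_algebra.scale)
  then have pow: "((**) M ^^ k) (mat 1) \<in> star_algebra (range Z)" for k
    by (induction k) (auto intro: star_algebra.one star_algebra.mult)
  have "(\<lambda>k. (1 / fact k) *\<^sub>R (((**) M ^^ k) (mat 1))) sums W"
    unfolding M W_spectrum[OF onb N] by (rule exp_series_spec_sums[OF onb])
  then have lim: "(\<lambda>m. \<Sum>k<m. (1 / fact k) *\<^sub>R (((**) M ^^ k) (mat 1))) \<longlonglongrightarrow> W"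
    by (simp add: sums_def)
  show ?thesis
    by (rule closed_sequentially[OF star_algebra_closed _ lim])
      (intro star_algebra_sum, unfold scaleR_cscale, intro star_algebra.scale pow)
qed

section \<open>Words in the field operators and induced isomorphisms\<close>

type_synonym 'n letter = "bool \<times> (complex, 'n) vec"

fun letter :: "(complex ^ 'n \<Rightarrow> complex ^ 'k ^ 'k) \<Rightarrow> 'n letter \<Rightarrow> complex ^ 'k ^ 'k" where
  "letter Z (b, \<psi>) = (if b then adj (Z \<psi>) else Z \<psi>)"

fun pairing :: "'n::finite letter \<Rightarrow> 'n letter \<Rightarrow> complex" where
  "pairing (b, \<psi>) (b', \<phi>) = (if b = b' then 0 else if b then cinner \<phi> \<psi> else cinner \<psi> \<phi>)"

definition word :: "(complex ^ 'n \<Rightarrow> complex ^ 'k ^ 'k) \<Rightarrow> 'n letter list \<Rightarrow> complex ^ 'k ^ 'k" where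
  "word Z w = foldr (\<lambda>l M. letter Z l ** M) w (mat 1)"

lemma word_simps [simp]: "word Z [] = mat 1" "word Z (l # w) = letter Z l ** word Z w"
  by (simp_all add: word_def)

lemma word_append: "word Z (v @ w) = word Z v ** word Z w"
  by (induction v) (simp_all add: matrix_mul_assoc)

lemma adj_letter: "adj (letter Z l) = letter Z (\<not> fst l, snd l)"
  by (cases l) simp

lemma adj_word: "adj (word Z w) = word Z (rev (map (\<lambda>l. (\<not> fst l, snd l)) w))"
  by (induction w) (simp_all add: word_append adj_letter)

context car
begin

lemma letter_swap:
  "letter Z a ** letter Z b = pairing a b *\<^sub>C mat 1 - letter Z b ** letter Z a"
proof -
  obtain b1 \<psi> where a: "a = (b1, \<psi>)" by (cases a)
  obtain b2 \<phi> where b: "b = (b2, \<phi>)" by (cases b)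
  show ?thesis
    using Z_anti[of \<psi> \<phi>] adj_Z_anti[of \<psi> \<phi>] adj_Z_swap[of \<phi> \<psi>] adj_Z_swap[of \<psi> \<phi>]
    by (auto simp: a b cscale_simps)
qed

lemma W_letter: "W ** letter Z l = - (letter Z l ** W)"
  by (cases l) (simp add: W_Z W_adj_Z)

lemma W_word: "W ** word Z w = (-1) ^ length w *\<^sub>C (word Z w ** W)"
proof (induction w)
  case (Cons l w)
  have "W ** word Z (l # w) = - (letter Z l ** (W ** word Z w))"
    by (simp add: matrix_mul_assoc W_letter mat_mult_simps)
  also have "\<dots> = (-1) ^ length (l # w) *\<^sub>C (word Z (l # w) ** W)"
    unfolding Cons.IH by (simp add: cscale_mult matrix_mul_assoc cscale_left)
  finally show ?case .
qed (simp add: cscale_simps)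

text \<open>\<open>W\<close> squares to one and anticommutes with every letter, so sending one copy
  of it around the trace turns an odd word into its negative.\<close>

lemma ntr_word_odd: assumes "odd (length w)" shows "ntr (word Z w) = 0"
proof -
  have "ntr (word Z w) = ntr (W ** (W ** word Z w))"
    by (simp add: matrix_mul_assoc W_W)
  also have "\<dots> = - ntr (W ** (word Z w ** W))"
    unfolding W_word using assms by (simp add: cscale_mult ntr_simps cscale_simps mat_mult_simps)
  also have "ntr (W ** (word Z w ** W)) = ntr (word Z w)"
    by (subst ntr_commute) (simp add: matrix_mul_assoc[symmetric] W_W)
  finally show ?thesis by simp
qed

end

text \<open>Cycling one letter once around an even word flips the sign of the trace up to shorter words,
  so the trace is determined by the anticommutators alone.\<close>

lemma ntr_word_eq:
  assumes "car_field Z" "car_field Z'"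
  shows "ntr (word Z w) = ntr (word Z' w)"
proof (induction "length w" arbitrary: w rule: less_induct)
  case less
  interpret Z: car Z by unfold_locales fact
  interpret Z': car Z' by unfold_locales fact
  define \<delta> where "\<delta> w = ntr (word Z w) - ntr (word Z' w)" for w
  have short: "\<delta> v = 0" if "length v < length w" for v
    using less that by (simp add: \<delta>_def)
  have move: "\<delta> (xs @ a # ys) = (-1) ^ length ys * \<delta> (xs @ ys @ [a])"
    if "length xs + length ys < length w" for xs a ys
    using that
  proof (induction ys arbitrary: xs)
    case (Cons y ys)
    have "\<delta> (xs @ a # y # ys) = pairing a y * \<delta> (xs @ ys) - \<delta> ((xs @ [y]) @ a # ys)"
      by (simp add: \<delta>_def word_append matrix_mul_assoc[of "letter _ a"] Z.letter_swap[of a y]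
          Z'.letter_swap[of a y] mat_mult_simps cscale_mult ntr_simps matrix_mul_assoc[symmetric]
          right_diff_distrib)
    also have "\<delta> (xs @ ys) = 0" by (rule short) (use Cons.prems in simp)
    also have "\<delta> ((xs @ [y]) @ a # ys) = (-1) ^ length ys * \<delta> ((xs @ [y]) @ ys @ [a])"
      by (rule Cons.IH) (use Cons.prems in simp)
    finally show ?case by simp
  qed simp
  show ?case
  proof (cases "odd (length w) \<or> w = []")
    case True
    then show ?thesis by (auto simp: Z.ntr_word_odd Z'.ntr_word_odd ntr_simps)
  next
    case False
    then obtain a ys where w: "w = a # ys" and odd: "odd (length ys)" by (cases w) auto
    have "\<delta> w = - \<delta> (ys @ [a])" using move[of "[]" ys a] odd by (simp add: w)
    also have "\<delta> (ys @ [a]) = \<delta> w"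
      by (simp add: \<delta>_def w word_append ntr_commute[of "word _ ys"])
    finally show ?thesis by (simp add: \<delta>_def)
  qed
qed

section \<open>Noncommutative polynomials in the field operators\<close>

type_synonym 'n ncpoly = "(complex \<times> 'n letter list) list"

text \<open>Polynomials stay unreduced lists of terms, so no quotient by the relations is formed;
  that maps between fields are well defined is shown by comparing evaluations.\<close>

definition ncpoly_eval ::
  "(complex ^ 'n \<Rightarrow> complex ^ 'k ^ 'k) \<Rightarrow> 'n ncpoly \<Rightarrow> complex ^ 'k ^ 'k" where
  "ncpoly_eval Z p = (\<Sum>(c, w)\<leftarrow>p. c *\<^sub>C word Z w)"

definition ncpoly_scale :: "complex \<Rightarrow> 'n::finite ncpoly \<Rightarrow> 'n ncpoly" where
  "ncpoly_scale c p = map (\<lambda>(d, w). (c * d, w)) p"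

definition ncpoly_mult :: "'n::finite ncpoly \<Rightarrow> 'n ncpoly \<Rightarrow> 'n ncpoly" where
  "ncpoly_mult p q = concat (map (\<lambda>(c, v). map (\<lambda>(d, w). (c * d, v @ w)) q) p)"

definition ncpoly_adj :: "'n::finite ncpoly \<Rightarrow> 'n ncpoly" where
  "ncpoly_adj p = map (\<lambda>(c, w). (cnj c, rev (map (\<lambda>l. (\<not> fst l, snd l)) w))) p"

lemma ncpoly_eval_append: "ncpoly_eval Z (p @ q) = ncpoly_eval Z p + ncpoly_eval Z q"
  by (simp add: ncpoly_eval_def)

lemma ncpoly_eval_Nil [simp]: "ncpoly_eval Z [] = 0"
  by (simp add: ncpoly_eval_def)

lemma ncpoly_eval_Cons: "ncpoly_eval Z ((c, w) # p) = c *\<^sub>C word Z w + ncpoly_eval Z p"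
  by (simp add: ncpoly_eval_def)

lemma ncpoly_eval_scale: "ncpoly_eval Z (ncpoly_scale c p) = c *\<^sub>C ncpoly_eval Z p"
  by (induction p) (auto simp: ncpoly_scale_def ncpoly_eval_Cons cscale_simps)

lemma ncpoly_eval_mult: "ncpoly_eval Z (ncpoly_mult p q) = ncpoly_eval Z p ** ncpoly_eval Z q"
proof (induction p)
  case (Cons a p)
  obtain c v where a: "a = (c, v)" by (cases a)
  have "ncpoly_eval Z (map (\<lambda>(d, w). (c * d, v @ w)) q) = c *\<^sub>C word Z v ** ncpoly_eval Z q"
    by (induction q)
      (auto simp: ncpoly_eval_Cons word_append cscale_mult mat_mult_simps cscale_simps mult.commute)
  then show ?case
    using Cons by (simp add: a ncpoly_mult_def ncpoly_eval_append ncpoly_eval_Cons mat_mult_simps)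
qed (simp add: ncpoly_mult_def mat_mult_simps)

lemma ncpoly_eval_adj: "ncpoly_eval Z (ncpoly_adj p) = adj (ncpoly_eval Z p)"
  by (induction p) (auto simp: ncpoly_adj_def ncpoly_eval_Cons adj_word)

lemma ntr_ncpoly_eval_eq:
  assumes "car_field Z" "car_field Z'"
  shows "ntr (ncpoly_eval Z p) = ntr (ncpoly_eval Z' p)"
  by (induction p) (auto simp: ncpoly_eval_Cons ntr_simps ntr_word_eq[OF assms])

lemma letter_in_star_algebra: "letter Z l \<in> star_algebra (range Z)"
  by (cases l) (auto intro: star_algebra.gen star_algebra.star)

lemma star_algebra_eq_ncpoly: "star_algebra (range Z) = range (ncpoly_eval Z)"
proof
  show "star_algebra (range Z) \<subseteq> range (ncpoly_eval Z)"
  proof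
    fix X assume "X \<in> star_algebra (range Z)"
    then have "\<exists>p. X = ncpoly_eval Z p"
    proof induction
      case (gen X)
      then obtain \<psi> where "X = Z \<psi>" by blast
      then have "X = ncpoly_eval Z [(1, [(False, \<psi>)])]"
        by (simp add: ncpoly_eval_Cons cscale_simps)
      then show ?case by blast
    next
      case one
      have "mat 1 = ncpoly_eval Z [(1, [])]" by (simp add: ncpoly_eval_Cons cscale_simps)
      then show ?case by blast
    qed (metis ncpoly_eval_append ncpoly_eval_scale ncpoly_eval_mult ncpoly_eval_adj)+
    then show "X \<in> range (ncpoly_eval Z)" by blast
  qed
next
  have w: "word Z w \<in> star_algebra (range Z)" for w
    by (induction w) (auto intro: star_algebra.one star_algebra.mult letter_in_star_algebra)
  have "ncpoly_eval Z p \<in> star_algebra (range Z)" for p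
    by (induction p) (auto simp: ncpoly_eval_Cons star_algebra_zero
        intro!: star_algebra.add star_algebra.scale w)
  then show "range (ncpoly_eval Z) \<subseteq> star_algebra (range Z)" by blast
qed

text \<open>For the formal difference \<open>r\<close>, the trace of \<open>adj r ** r\<close> is a
  combination of traces of words and hence the same for both fields. Faithfulness of the trace turns
  its vanishing into \<open>r = 0\<close> at \<open>Z'\<close>, so every relation valid for one
  field is valid for the other.\<close>

lemma ncpoly_eval_transfer:
  assumes "car_field Z" "car_field Z'" "ncpoly_eval Z p = ncpoly_eval Z q"
  shows "ncpoly_eval Z' p = ncpoly_eval Z' q"
proof -
  define r where "r = p @ ncpoly_scale (-1) q"
  have "ncpoly_eval Z r = 0"
    by (simp add: r_def ncpoly_eval_append ncpoly_eval_scale assms cscale_simps)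
  then have "ntr (ncpoly_eval Z (ncpoly_mult (ncpoly_adj r) r)) = 0"
    by (simp add: ncpoly_eval_mult mat_mult_simps ntr_simps)
  then have "ntr (adj (ncpoly_eval Z' r) ** ncpoly_eval Z' r) = 0"
    using ntr_ncpoly_eval_eq[OF assms(1,2), of "ncpoly_mult (ncpoly_adj r) r"]
    by (simp add: ncpoly_eval_mult ncpoly_eval_adj)
  then have "ncpoly_eval Z' r = 0" by (rule ntr_adj_self_eq_0)
  then show ?thesis
    by (simp add: r_def ncpoly_eval_append ncpoly_eval_scale cscale_simps)
qed

section \<open>Homomorphisms determined by field operators\<close>

lemma star_hom_simps:
  assumes "star_hom f"
  shows "f (X + Y) = f X + f Y" "f (c *\<^sub>C X) = c *\<^sub>C f X" "f (X ** Y) = f X ** f Y"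
    "f (adj X) = adj (f X)" "f (mat 1) = mat 1" "f 0 = 0" "f (- X) = - f X" "f (X - Y) = f X - f Y"
    "f (r *\<^sub>R X) = r *\<^sub>R f X"
proof -
  show a: "f (X + Y) = f X + f Y" "f (c *\<^sub>C X) = c *\<^sub>C f X" "f (X ** Y) = f X ** f Y"
    "f (adj X) = adj (f X)" "f (mat 1) = mat 1" for X Y c
    using assms by (simp_all add: star_hom_def)
  show "f 0 = 0" using a(2)[of 0 0] by (simp add: cscale_simps)
  show m: "f (- X) = - f X" for X using a(2)[of "-1" X] by (simp add: cscale_simps)
  show "f (X - Y) = f X - f Y" using a(1)[of X "- Y"] by (simp add: m)
  show "f (r *\<^sub>R X) = r *\<^sub>R f X" by (simp add: scaleR_cscale a)
qed

lemma star_hom_eqI: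
  assumes "star_hom f" "star_hom g" "\<And>X. X \<in> G \<Longrightarrow> f X = g X" "X \<in> star_algebra G"
  shows "f X = g X"
  using assms(4) by induction (simp_all add: assms(3) star_hom_simps[OF assms(1)] star_hom_simps[OF assms(2)])

text \<open>The isomorphism re-evaluates at \<open>Z'\<close> any polynomial that represents
  \<open>X\<close> at \<open>Z\<close>. Transfer from \<open>Z\<close> to \<open>Z'\<close> makes
  this well defined, and transfer back makes it injective. Trace preservation is recorded because it
  moves all later computations through \<open>iota_A\<close>, \<open>iota_B\<close> and
  \<open>alpha\<close>.\<close>

lemma car_iso_props:
  assumes Z: "car_field Z" and Z': "car_field Z'" and full: "star_algebra (range Z) = UNIV"
  shows "star_hom (car_iso Z Z')" "bij_betw (car_iso Z Z') UNIV (star_algebra (range Z'))"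
    "car_iso Z Z' (Z \<psi>) = Z' \<psi>" "ntr (car_iso Z Z' X) = ntr X"
proof -
  have ex: "\<exists>p. ncpoly_eval Z p = X" for X
    using full star_algebra_eq_ncpoly[of Z] by (metis UNIV_I imageE)
  define f where "f X = ncpoly_eval Z' (SOME p. ncpoly_eval Z p = X)" for X
  have f: "f (ncpoly_eval Z p) = ncpoly_eval Z' p" for p
    unfolding f_def by (rule ncpoly_eval_transfer[OF Z Z']) (rule someI_ex[OF ex])
  have hom: "star_hom f"
    unfolding star_hom_def
  proof (intro conjI allI)
    fix X Y c
    obtain p q where X: "X = ncpoly_eval Z p" and Y: "Y = ncpoly_eval Z q" using ex by metis
    show "f (X + Y) = f X + f Y" unfolding X Y by (simp add: f flip: ncpoly_eval_append)
    show "f (c *\<^sub>C X) = c *\<^sub>C f X" unfolding X by (simp add: f flip: ncpoly_eval_scale)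
    show "f (X ** Y) = f X ** f Y" unfolding X Y by (simp add: f flip: ncpoly_eval_mult)
    show "f (adj X) = adj (f X)" unfolding X by (simp add: f flip: ncpoly_eval_adj)
    show "f (mat 1) = mat 1"
      using f[of "[(1, [])]"] by (simp add: ncpoly_eval_Cons cscale_simps)
  qed
  have gen: "f (Z \<psi>) = Z' \<psi>" for \<psi>
    using f[of "[(1, [(False, \<psi>)])]"] by (simp add: ncpoly_eval_Cons cscale_simps)
  have bij: "bij_betw f UNIV (star_algebra (range Z'))"
    unfolding bij_betw_def
  proof
    show "inj_on f UNIV"
    proof
      fix X Y assume eq: "f X = f Y"
      obtain p q where "X = ncpoly_eval Z p" "Y = ncpoly_eval Z q" using ex by metis
      then show "X = Y" using ncpoly_eval_transfer[OF Z' Z, of p q] eq f by simp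
    qed
    show "f ` UNIV = star_algebra (range Z')"
      unfolding star_algebra_eq_ncpoly using ex f by (metis (no_types, lifting) image_cong surj_def rangeI subset_antisym image_subset_iff UNIV_I)
  qed
  have "car_iso Z Z' = f"
    unfolding car_iso_def
  proof (rule the_equality)
    fix g assume g: "star_hom g \<and> bij_betw g UNIV (star_algebra (range Z')) \<and> (\<forall>\<psi>. g (Z \<psi>) = Z' \<psi>)"
    show "g = f"
    proof
      fix X
      show "g X = f X"
        by (rule star_hom_eqI[of _ _ "range Z"]) (use g hom gen full in auto)
    qed
  qed (use hom bij gen in blast)
  moreover have "ntr (f X) = ntr X" for X
    using ex[of X] f ntr_ncpoly_eval_eq[OF Z Z'] by metis
  ultimately show "star_hom (car_iso Z Z')" "bij_betw (car_iso Z Z') UNIV (star_algebra (range Z'))"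
    "car_iso Z Z' (Z \<psi>) = Z' \<psi>" "ntr (car_iso Z Z' X) = ntr X"
    using hom bij gen by simp_all
qed

section \<open>Irreducible fields and the double field\<close>

text \<open>The commutation requirement on \<open>X\<close> is relaxed one generator at a time.
  Conjugation by \<open>g\<close> splits \<open>X\<close> into \<open>P\<close>, which commutes with
  \<open>g\<close>, and \<open>Q\<close>, which anticommutes with it; both still commute with the
  generators outside \<open>insert g F\<close>. Since \<open>g ** W\<close> anticommutes with
  \<open>g\<close> and commutes with every other generator, \<open>g ** W ** Q\<close> has the sign
  repaired and falls under the induction hypothesis.\<close>

lemma clifford_generates:
  fixes W :: "complex ^ 'k ^ 'k"
  assumes fin: "finite G" and G: "G \<subseteq> star_algebra S" and W: "W \<in> star_algebra S"
    and sq: "\<And>g. g \<in> G \<Longrightarrow> g ** g = mat 1" and WW: "W ** W = mat 1"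
    and anti: "\<And>g h. g \<in> G \<Longrightarrow> h \<in> G \<Longrightarrow> g \<noteq> h \<Longrightarrow> g ** h = - (h ** g)"
    and Wg: "\<And>g. g \<in> G \<Longrightarrow> W ** g = - (g ** W)"
    and comm: "\<And>X. (\<And>g. g \<in> G \<Longrightarrow> X ** g = g ** X) \<Longrightarrow> X \<in> star_algebra S"
  shows "star_algebra S = UNIV"
proof -
  have "F \<subseteq> G \<Longrightarrow> (\<forall>X. (\<forall>g\<in>G - F. X ** g = g ** X) \<longrightarrow> X \<in> star_algebra S)" if "finite F" for F
    using that
  proof (induction F)
    case empty
    then show ?case using comm by blast
  next
    case (insert g F)
    have gG: "g \<in> G" using insert by blast
    have assoc: "A ** (B ** Y) = - (C ** (D ** Y))" if "A ** B = - (C ** D)"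
      for A B C D Y :: "complex ^ 'k ^ 'k"
      by (simp add: matrix_mul_assoc that mat_mult_simps)
    have assoc': "A ** (B ** Y) = C ** (D ** Y)" if "A ** B = C ** D"
      for A B C D Y :: "complex ^ 'k ^ 'k"
      by (simp add: matrix_mul_assoc that)
    have gg: "g ** (g ** X) = X" for X by (simp add: matrix_mul_assoc sq[OF gG])
    have ww: "W ** (W ** X) = X" for X by (simp add: matrix_mul_assoc WW)
    note wg = assoc[OF Wg[OF gG]]
    note [simp] = mat_mult_simps matrix_mul_assoc[symmetric]
    show ?case
    proof (intro allI impI)
      fix X assume X: "\<forall>h\<in>G - insert g F. X ** h = h ** X"
      define P where "P = X + g ** X ** g"
      define Q where "Q = X - g ** X ** g"
      have "P \<in> star_algebra S"
      proof -
        have "P ** h = h ** P" if h: "h \<in> G - F" for h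
        proof (cases "h = g")
          case True
          then show ?thesis by (simp add: P_def gg sq[OF gG])
        next
          case False
          then have Xh: "X ** h = h ** X" and gh: "g ** h = - (h ** g)"
            using X h anti[OF gG] by auto
          show ?thesis by (simp add: P_def Xh gh assoc[OF gh] assoc'[OF Xh])
        qed
        then show ?thesis using insert by blast
      qed
      moreover have "Q \<in> star_algebra S"
      proof -
        have gQ: "Q ** g = - (g ** Q)" by (simp add: Q_def gg sq[OF gG])
        have "(g ** W ** Q) ** h = h ** (g ** W ** Q)" if h: "h \<in> G - F" for h
        proof (cases "h = g")
          case True
          then show ?thesis by (simp add: gQ wg gg)
        next
          case False
          then have Xh: "X ** h = h ** X" and gh: "g ** h = - (h ** g)" and Wh: "W ** h = - (h ** W)"
            using X h anti[OF gG] Wg by auto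
          have Qh: "Q ** h = h ** Q" by (simp add: Q_def Xh gh assoc[OF gh] assoc'[OF Xh])
          show ?thesis by (simp add: Qh assoc[OF gh] assoc[OF Wh])
        qed
        then have "g ** W ** Q \<in> star_algebra S" using insert by blast
        \<comment> \<open>The square of \<open>g ** W\<close> is minus the identity, so this
          recovers \<open>Q\<close>.\<close>
        then have "- ((g ** W) ** (g ** W ** Q)) \<in> star_algebra S"
          using G gG W by (meson star_algebra_neg star_algebra.mult subsetD)
        then show ?thesis by (simp add: wg gg ww)
      qed
      ultimately have "(1/2) *\<^sub>C (P + Q) \<in> star_algebra S"
        by (intro star_algebra.scale star_algebra.add)
      moreover have "(1/2) *\<^sub>C (P + Q) = X"
        by (simp add: P_def Q_def vec_eq_iff)
      ultimately show "X \<in> star_algebra S" by simp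
    qed
  qed
  from this[OF fin] show ?thesis by blast
qed

context car
begin

text \<open>Schur's lemma: an eigenspace of a self-adjoint element of the commutant is invariant
  under the field, and a general element is split into two self-adjoint ones.\<close>

lemma commutant_scalar:
  assumes irr: "irreducible_field Z"
    and comm: "\<And>\<psi>. X ** Z \<psi> = Z \<psi> ** X" "\<And>\<psi>. X ** adj (Z \<psi>) = adj (Z \<psi>) ** X"
  shows "\<exists>c. X = c *\<^sub>C mat 1"
proof -
  have herm: "\<exists>c. X = c *\<^sub>C mat 1" if a: "adj X = X" and
    c: "\<And>\<psi>. X ** Z \<psi> = Z \<psi> ** X" "\<And>\<psi>. X ** adj (Z \<psi>) = adj (Z \<psi>) ** X" for X
  proof -
    have sub: "vec.subspace (UNIV :: (complex ^ 'k) set)" by simp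
    obtain v \<mu> where v: "norm v = 1" "X *v v = complex_of_real \<mu> *s v"
      by (rule invariant_subspace_eigenvector[OF sub, of "axis undefined 1" X])
        (use a in \<open>auto simp: axis_eq_0_iff\<close>)
    define V where "V = {v. X *v v = complex_of_real \<mu> *s v}"
    have "vec.subspace V"
      unfolding V_def vec.subspace_def
      by (auto simp: matrix_vector_right_distrib mult_vec_smult vec.scale_right_distrib mult.commute)
    moreover have "Z \<psi> *v w \<in> V \<and> adj (Z \<psi>) *v w \<in> V" if "w \<in> V" for \<psi> w
    proof -
      have "X *v (Z \<psi> *v w) = Z \<psi> *v (X *v w)" "X *v (adj (Z \<psi>) *v w) = adj (Z \<psi>) *v (X *v w)"
        by (simp_all add: matrix_vector_mul_assoc c)
      then show ?thesis using that by (simp add: V_def mult_vec_smult)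
    qed
    ultimately have "V = {0} \<or> V = UNIV"
      using irr unfolding irreducible_field_def by blast
    moreover have "v \<in> V" "v \<noteq> 0" using v by (auto simp: V_def)
    ultimately have "V = UNIV" by blast
    then have "X *v w = (complex_of_real \<mu> *\<^sub>C mat 1) *v w" for w
      unfolding V_def by (auto simp: cscale_mult_vec)
    then show ?thesis using matrix_eqI_vec by blast
  qed
  have adj_comm: "adj X ** Z \<psi> = Z \<psi> ** adj X" "adj X ** adj (Z \<psi>) = adj (Z \<psi>) ** adj X" for \<psi>
  proof -
    have "adj (X ** Z \<psi>) = adj (Z \<psi> ** X)" "adj (X ** adj (Z \<psi>)) = adj (adj (Z \<psi>) ** X)"
      by (simp_all only: comm)
    then show "adj X ** Z \<psi> = Z \<psi> ** adj X" "adj X ** adj (Z \<psi>) = adj (Z \<psi>) ** adj X"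
      by simp_all
  qed
  obtain c where c: "X + adj X = c *\<^sub>C mat 1"
    using herm[of "X + adj X"] by (auto simp: mat_mult_simps comm adj_comm add.commute)
  obtain d where d: "\<i> *\<^sub>C (X - adj X) = d *\<^sub>C mat 1"
    using herm[of "\<i> *\<^sub>C (X - adj X)"]
    by (auto simp: mat_mult_simps comm adj_comm cscale_mult cscale_left cscale_simps)
  have "X = (1/2) *\<^sub>C ((X + adj X) + (-\<i>) *\<^sub>C \<i> *\<^sub>C (X - adj X))"
    by (simp add: vec_eq_iff)
  also have "\<dots> = ((1/2) * (c - \<i> * d)) *\<^sub>C mat 1"
    unfolding c d by (simp add: cscale_simps cscale_left[symmetric])
  finally show ?thesis by blast
qed

text \<open>The Majorana operators \<open>\<gamma>\<close> at the vectors e and i e, for e in the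
  standard basis, are anticommuting involutions from which \<open>Z\<close> can be recovered. Their
  commutant is therefore scalar, and the Clifford argument applies.\<close>

lemma irreducible_full:
  assumes irr: "irreducible_field Z"
  shows "star_algebra (range Z) = UNIV"
proof -
  define \<gamma> where "\<gamma> \<psi> = Z \<psi> + adj (Z \<psi>)" for \<psi>
  have gam: "\<gamma> \<psi> ** \<gamma> \<phi> = (cinner \<psi> \<phi> + cinner \<phi> \<psi>) *\<^sub>C mat 1 - \<gamma> \<phi> ** \<gamma> \<psi>" for \<psi> \<phi>
    by (simp add: \<gamma>_def mat_mult_simps adj_Z_swap cscale_left Z_anti[of \<psi> \<phi>] adj_Z_anti[of \<psi> \<phi>])
  have \<gamma>_alg: "\<gamma> \<psi> \<in> star_algebra (range Z)" for \<psi>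
    unfolding \<gamma>_def by (intro star_algebra.add star_algebra.star star_algebra.gen) auto
  define B :: "(complex ^ 'n) set" where "B = range (\<lambda>j. axis j 1) \<union> range (\<lambda>j. axis j \<i>)"
  have B1: "cinner \<psi> \<psi> = 1" if "\<psi> \<in> B" for \<psi>
    using that by (auto simp: B_def cinner_def axis_def if_distrib[of "\<lambda>x. _ * x"] cong: if_cong)
  \<comment> \<open>The two inner products add up to twice the real part, which is why e and i e
    count as orthogonal.\<close>
  have B2: "cinner \<psi> \<phi> + cinner \<phi> \<psi> = 0" if "\<psi> \<in> B" "\<phi> \<in> B" "\<psi> \<noteq> \<phi>" for \<psi> \<phi>
  proof -
    have ax: "cinner (axis i a) (axis j b) = (if i = j then cnj a * b else 0)" for i j :: 'n and a b
      by (simp add: cinner_def axis_def if_distrib[of "\<lambda>x. _ * x"] cong: if_cong)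
    show ?thesis using that by (auto simp: B_def ax)
  qed
  show ?thesis
  proof (rule clifford_generates[where G = "\<gamma> ` B" and W = W])
    show "finite (\<gamma> ` B)" by (simp add: B_def)
    show "\<gamma> ` B \<subseteq> star_algebra (range Z)" using \<gamma>_alg by blast
    show "W \<in> star_algebra (range Z)" by (rule W_in_star_algebra)
    show "g ** g = mat 1" if gB: "g \<in> \<gamma> ` B" for g
    proof -
      obtain \<psi> where g: "g = \<gamma> \<psi>" "\<psi> \<in> B" using gB by blast
      have "g ** g + g ** g = (cinner \<psi> \<psi> + cinner \<psi> \<psi>) *\<^sub>C mat 1"
        unfolding g by (rule eq_diff_eq[THEN iffD1, OF gam])
      then have "g ** g + g ** g = 2 *\<^sub>C mat 1" by (simp add: B1[OF g(2)])
      then have "2 *\<^sub>C (g ** g) = 2 *\<^sub>C mat 1" by (simp add: cscale_left(1)[of 1 1, simplified] cscale_simps)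
      then show ?thesis by (simp add: cscale_cancel)
    qed
    show "g ** h = - (h ** g)" if gh: "g \<in> \<gamma> ` B" "h \<in> \<gamma> ` B" "g \<noteq> h" for g h
    proof -
      obtain \<psi> \<phi> where "g = \<gamma> \<psi>" "\<psi> \<in> B" "h = \<gamma> \<phi>" "\<phi> \<in> B" using gh by blast
      moreover from this have "cinner \<psi> \<phi> + cinner \<phi> \<psi> = 0" using B2 gh(3) by blast
      ultimately show ?thesis using gam[of \<psi> \<phi>] by (simp add: cscale_simps)
    qed
    show "W ** W = mat 1" by (rule W_W)
    show "W ** g = - (g ** W)" if "g \<in> \<gamma> ` B" for g
      using that by (auto simp: \<gamma>_def mat_mult_simps W_Z W_adj_Z)
    fix X assume X: "\<And>g. g \<in> \<gamma> ` B \<Longrightarrow> X ** g = g ** X"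
    have ax: "X ** Z (axis j 1) = Z (axis j 1) ** X \<and> X ** adj (Z (axis j 1)) = adj (Z (axis j 1)) ** X" for j
    proof -
      have i: "axis j \<i> = \<i> *s axis j 1" by (simp add: vec_eq_iff axis_def)
      \<comment> \<open>\<open>Z\<close> is conjugate linear, so \<open>\<gamma>\<close> at i e
        equals - i Z + i \<open>adj\<close> Z at e; this separates the two summands of
        \<open>\<gamma>\<close> at e.\<close>
      have z: "Z (axis j 1) = (1/2) *\<^sub>C (\<gamma> (axis j 1) + \<i> *\<^sub>C \<gamma> (axis j \<i>))"
        "adj (Z (axis j 1)) = (1/2) *\<^sub>C (\<gamma> (axis j 1) - \<i> *\<^sub>C \<gamma> (axis j \<i>))"
        unfolding \<gamma>_def i Z_smult by (simp_all add: vec_eq_iff algebra_simps)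
      have c: "X ** \<gamma> (axis j 1) = \<gamma> (axis j 1) ** X" "X ** \<gamma> (axis j \<i>) = \<gamma> (axis j \<i>) ** X"
        by (rule X, simp add: B_def)+
      have "adj (\<gamma> \<psi>) = \<gamma> \<psi>" for \<psi> by (simp add: \<gamma>_def add.commute)
      then show ?thesis unfolding z by (simp add: mat_mult_simps cscale_mult c)
    qed
    have "X ** Z \<psi> = Z \<psi> ** X \<and> X ** adj (Z \<psi>) = adj (Z \<psi>) ** X" for \<psi>
    proof -
      have "\<psi> = (\<Sum>j\<in>UNIV. \<psi> $ j *s axis j 1)" by (simp add: basis_expansion)
      then have "Z \<psi> = (\<Sum>j\<in>UNIV. cnj (\<psi> $ j) *\<^sub>C Z (axis j 1))"
        by (metis (no_types, lifting) Z_smult Z_sum sum.cong)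
      then show ?thesis by (simp add: mat_mult_sum adj_sum cscale_mult ax)
    qed
    then obtain c where "X = c *\<^sub>C mat 1" using commutant_scalar[OF irr] by blast
    then show "X \<in> star_algebra (range Z)" by (simp add: star_algebra.scale star_algebra.one)
  qed
qed

end

section \<open>Tensor products and the double field\<close>

lemma kron_mult: "kron X Y ** kron X' Y' = kron (X ** X') (Y ** Y')"
  by (simp add: vec_eq_iff kron_def matrix_matrix_mult_def sum_product UNIV_Times_UNIV[symmetric]
      sum.cartesian_product case_prod_beta mult_ac del: UNIV_Times_UNIV)

lemma kron_simps:
  "kron (X + X') Y = kron X Y + kron X' Y" "kron X (Y + Y') = kron X Y + kron X Y'"
  "kron (- X) Y = - kron X Y" "kron X (- Y) = - kron X Y"
  "kron (c *\<^sub>C X) Y = c *\<^sub>C kron X Y" "kron X (c *\<^sub>C Y) = c *\<^sub>C kron X Y"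
  "kron 0 Y = 0" "kron X 0 = 0" "kron (mat 1) (mat 1) = mat 1" "adj (kron X Y) = kron (adj X) (adj Y)"
  by (simp_all add: vec_eq_iff kron_def algebra_simps mat_def prod_eq_iff)

lemma cinner_dsum: "cinner (dsum \<psi> \<eta>) (dsum \<psi>' \<eta>') = cinner \<psi> \<psi>' + cinner \<eta> \<eta>'"
  by (simp add: cinner_def dsum_def UNIV_Plus_UNIV[symmetric] sum.Plus del: UNIV_Plus_UNIV)

lemma dsum_simps:
  "dsum (\<psi> + \<psi>') (\<eta> + \<eta>') = dsum \<psi> \<eta> + dsum \<psi>' \<eta>'" "dsum (c *s \<psi>) (c *s \<eta>) = c *s dsum \<psi> \<eta>"
  "dsum 0 0 = 0"
  by (simp_all add: vec_eq_iff dsum_def split: sum.splits)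

lemma dsum_exhaust: obtains \<psi> \<eta> where "\<xi> = dsum \<psi> \<eta>"
proof
  show "\<xi> = dsum (\<chi> i. \<xi> $ Inl i) (\<chi> i. \<xi> $ Inr i)"
    by (simp add: vec_eq_iff dsum_def split: sum.splits)
qed

lemma double_field_dsum: "double_field Z (dsum \<psi> \<eta>) = kron (Z \<psi>) (W_op Z) + kron (mat 1) (Z \<eta>)"
  by (simp add: double_field_def dsum_def)

lemma car_field_comp:
  assumes "car_field Z" "\<And>x y. f (x + y) = f x + f y" "\<And>c x. f (c *s x) = c *s f x"
    "\<And>x y. cinner (f x) (f y) = cinner x y"
  shows "car_field (\<lambda>x. Z (f x))"
  using assms by (simp add: car_field_def)

context car
begin

text \<open>The parity factor on the first leg supplies the sign by which the two legs anticommute;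
  being a self-adjoint involution it leaves the relations within the first leg intact.\<close>

lemma double_field_car: "car_field (double_field Z)"
  unfolding car_field_def
proof (intro conjI allI)
  fix \<psi> \<phi> :: "complex ^ ('n + 'n)" and c
  obtain \<psi>1 \<psi>2 where \<psi>: "\<psi> = dsum \<psi>1 \<psi>2" by (rule dsum_exhaust)
  obtain \<phi>1 \<phi>2 where \<phi>: "\<phi> = dsum \<phi>1 \<phi>2" by (rule dsum_exhaust)
  show "double_field Z (\<psi> + \<phi>) = double_field Z \<psi> + double_field Z \<phi>"
    by (simp add: \<psi> \<phi> dsum_simps[symmetric] double_field_dsum Z_add kron_simps)
  show "double_field Z (c *s \<psi>) = cnj c *\<^sub>C double_field Z \<psi>"
    by (simp add: \<psi> dsum_simps[symmetric] double_field_dsum Z_smult kron_simps cscale_simps)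
  show "double_field Z \<psi> ** adj (double_field Z \<phi>) + adj (double_field Z \<phi>) ** double_field Z \<psi>
      = cinner \<psi> \<phi> *\<^sub>C mat 1"
    by (simp add: \<psi> \<phi> double_field_dsum kron_simps mat_mult_simps kron_mult cinner_dsum
        W_def[symmetric] W_adj W_W W_Z W_adj_Z adj_Z_swap cscale_left)
      (simp add: vec_eq_iff kron_def algebra_simps mat_def prod_eq_iff)
  show "double_field Z \<psi> ** double_field Z \<phi> + double_field Z \<phi> ** double_field Z \<psi> = 0"
    by (simp add: \<psi> \<phi> double_field_dsum kron_simps mat_mult_simps kron_mult
        W_def[symmetric] W_W W_Z Z_anti[of \<psi>1 \<phi>1] Z_anti[of \<psi>2 \<phi>2])
qed

text \<open>The second leg alone yields \<open>kron (mat 1) W\<close>, which cancels the parity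
  factor of the first leg. Products of the two legs then give all matrix units.\<close>

lemma double_field_full:
  assumes full: "star_algebra (range Z) = UNIV"
  shows "star_algebra (range (double_field Z)) = UNIV"
proof -
  let ?D = "star_algebra (range (double_field Z))"
  have r: "kron (mat 1) Y \<in> ?D" for Y
  proof -
    have "Y \<in> star_algebra (range Z)" using full by simp
    then show ?thesis
    proof induction
      case (gen X)
      then obtain \<psi> where "X = Z \<psi>" by blast
      then have "kron (mat 1) X = double_field Z (dsum 0 \<psi>)"
        by (simp add: double_field_dsum kron_simps)
      then show ?case by (simp add: star_algebra.gen)
    next
      case (mult X Y)
      then have "kron (mat 1) X ** kron (mat 1) Y \<in> ?D" by (intro star_algebra.mult)
      then show ?case by (simp add: kron_mult)
    next
      case (star X)
      then have "adj (kron (mat 1) X) \<in> ?D" by (intro star_algebra.star)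
      then show ?case by (simp add: kron_simps)
    qed (auto simp: kron_simps intro: star_algebra.intros)
  qed
  have l: "kron X (mat 1) \<in> ?D" for X
  proof -
    have "X \<in> star_algebra (range Z)" using full by simp
    then show ?thesis
    proof induction
      case (gen X)
      then obtain \<psi> where "X = Z \<psi>" by blast
      then have "kron X (mat 1) = double_field Z (dsum \<psi> 0) ** kron (mat 1) W"
        by (simp add: double_field_dsum kron_simps kron_mult W_def[symmetric] W_W)
      then show ?case by (simp add: star_algebra.gen star_algebra.mult r)
    next
      case (mult X Y)
      then have "kron X (mat 1) ** kron Y (mat 1) \<in> ?D" by (intro star_algebra.mult)
      then show ?case by (simp add: kron_mult)
    next
      case (star X)
      then have "adj (kron X (mat 1)) \<in> ?D" by (intro star_algebra.star)
      then show ?case by (simp add: kron_simps)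
    qed (auto simp: kron_simps intro: star_algebra.intros)
  qed
  have "outer (axis i 1) (axis j 1) \<in> ?D" for i j :: "'k \<times> 'k"
  proof -
    have "outer (axis i 1) (axis j 1) = kron (outer (axis (fst i) 1) (axis (fst j) 1)) (mat 1) **
        kron (mat 1) (outer (axis (snd i) 1) (axis (snd j) 1))"
      unfolding kron_mult matrix_mul_lid matrix_mul_rid
      by (auto simp: vec_eq_iff kron_def outer_def axis_def prod_eq_iff)
    then show ?thesis using l r star_algebra.mult by metis
  qed
  then have "X \<in> ?D" for X
    by (subst matrix_unit_expansion[of X]) (intro star_algebra_sum star_algebra.scale)
  then show ?thesis by blast
qed

end

section \<open>Single fermionic modes\<close>

definition fermi_mode :: "complex ^ 'k ^ 'k \<Rightarrow> bool" where
  "fermi_mode z \<longleftrightarrow> z ** z = 0 \<and> z ** adj z + adj z ** z = mat 1"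

definition star_comm :: "complex ^ 'k ^ 'k \<Rightarrow> complex ^ 'k ^ 'k \<Rightarrow> bool" where
  "star_comm z X \<longleftrightarrow> X ** z = z ** X \<and> X ** adj z = adj z ** X"

definition star_anti :: "complex ^ 'k ^ 'k \<Rightarrow> complex ^ 'k ^ 'k \<Rightarrow> bool" where
  "star_anti z X \<longleftrightarrow> X ** z = - (z ** X) \<and> X ** adj z = - (adj z ** X)"

text \<open>For \<open>0 < l < 1\<close> this is the KMS relation $R^{-1} z R = \frac{l}{1-l} z$ for the mode \<open>z\<close>;
  the form below makes sense for all \<open>l\<close> and singular \<open>R\<close>.\<close>

definition kms :: "real \<Rightarrow> complex ^ 'k ^ 'k \<Rightarrow> complex ^ 'k ^ 'k \<Rightarrow> bool" where
  "kms l z R \<longleftrightarrow> (1 - complex_of_real l) *\<^sub>C (z ** R) = complex_of_real l *\<^sub>C (R ** z) \<and>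
     (1 - complex_of_real l) *\<^sub>C (R ** adj z) = complex_of_real l *\<^sub>C (adj z ** R)"

lemma star_comm_intros:
  "star_comm z (mat 1)" "star_comm z X \<Longrightarrow> star_comm z Y \<Longrightarrow> star_comm z (X + Y)"
  "star_comm z X \<Longrightarrow> star_comm z Y \<Longrightarrow> star_comm z (X - Y)"
  "star_comm z X \<Longrightarrow> star_comm z (c *\<^sub>C X)" "star_comm z X \<Longrightarrow> star_comm z Y \<Longrightarrow> star_comm z (X ** Y)"
proof -
  show "star_comm z (mat 1)" "star_comm z X \<Longrightarrow> star_comm z Y \<Longrightarrow> star_comm z (X + Y)"
    "star_comm z X \<Longrightarrow> star_comm z Y \<Longrightarrow> star_comm z (X - Y)"
    "star_comm z X \<Longrightarrow> star_comm z (c *\<^sub>C X)"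
    by (simp_all add: star_comm_def mat_mult_simps cscale_mult)
  show "star_comm z (X ** Y)" if "star_comm z X" "star_comm z Y"
    using that unfolding star_comm_def by (metis matrix_mul_assoc)
qed

lemma star_comm_adj: "star_comm z X \<Longrightarrow> star_comm z (adj X)"
  unfolding star_comm_def by (metis adj_mult adj_simps(5))

lemma star_comm_number: assumes "star_comm z X" shows "(adj z ** z) ** X = X ** (adj z ** z)"
proof -
  have X: "X ** z = z ** X" "X ** adj z = adj z ** X" using assms by (auto simp: star_comm_def)
  show ?thesis
    by (subst matrix_mul_assoc[of X], subst X(2), subst matrix_mul_assoc[symmetric], subst X(1)[symmetric])
      (rule matrix_mul_assoc)
qed

lemma star_comm_star_algebra:
  assumes "\<And>X. X \<in> G \<Longrightarrow> star_comm z X" "X \<in> star_algebra G" shows "star_comm z X"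
  using assms(2) by induction (auto intro: assms(1) star_comm_intros star_comm_adj)

lemma fermi_modeD:
  assumes "fermi_mode z"
  shows "z ** z = 0" "adj z ** adj z = 0" "z ** adj z = mat 1 - adj z ** z"
    "adj z ** z ** z = 0" "z ** (adj z ** z) = z" "adj z ** z ** adj z = adj z" "adj z ** (adj z ** z) = 0"
    "(adj z ** z) ** (adj z ** z) = adj z ** z"
proof -
  have zz: "z ** z = 0" and ac: "z ** adj z + adj z ** z = mat 1" using assms by (auto simp: fermi_mode_def)
  show "z ** z = 0" by fact
  have "adj (z ** z) = 0" by (simp only: zz adj_simps)
  then show azz: "adj z ** adj z = 0" by simp
  show zaz: "z ** adj z = mat 1 - adj z ** z" using ac by (simp add: algebra_simps)
  show "adj z ** z ** z = 0" by (simp add: matrix_mul_assoc[symmetric] zz mat_mult_simps)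
  show 1: "z ** (adj z ** z) = z"
    by (simp add: matrix_mul_assoc zaz mat_mult_simps) (simp add: matrix_mul_assoc[symmetric] zz mat_mult_simps)
  have "adj (z ** (adj z ** z)) = adj z" by (simp only: 1)
  then show 2: "adj z ** z ** adj z = adj z" by simp
  show "adj z ** (adj z ** z) = 0" by (simp add: matrix_mul_assoc azz mat_mult_simps)
  show "(adj z ** z) ** (adj z ** z) = adj z ** z" by (simp add: matrix_mul_assoc 2)
qed

text \<open>The relation involves a single mode, so factors commuting with that mode can be attached
  on either side. This carries it from a density to a whole stretch of a cyclic trace.\<close>

lemma kms_mult:
  assumes "kms l z R" "star_comm z X"
  shows "kms l z (R ** X)" "kms l z (X ** R)"
proof -
  have R: "(1 - complex_of_real l) *\<^sub>C (z ** R) = complex_of_real l *\<^sub>C (R ** z)"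
     "(1 - complex_of_real l) *\<^sub>C (R ** adj z) = complex_of_real l *\<^sub>C (adj z ** R)"
    and X: "X ** z = z ** X" "X ** adj z = adj z ** X"
    using assms by (auto simp: kms_def star_comm_def)
  have "(1 - complex_of_real l) *\<^sub>C (z ** (R ** X)) = complex_of_real l *\<^sub>C ((R ** X) ** z)"
    using arg_cong[OF R(1), of "\<lambda>Y. Y ** X"] by (simp add: cscale_mult matrix_mul_assoc[symmetric] X)
  moreover have "(1 - complex_of_real l) *\<^sub>C ((R ** X) ** adj z) = complex_of_real l *\<^sub>C (adj z ** (R ** X))"
  proof -
    have "(R ** X) ** adj z = (R ** adj z) ** X" by (simp add: matrix_mul_assoc[symmetric] X)
    then show ?thesis using arg_cong[OF R(2), of "\<lambda>Y. Y ** X"]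
      by (simp add: cscale_mult matrix_mul_assoc)
  qed
  ultimately show "kms l z (R ** X)" by (simp add: kms_def)
  have "(1 - complex_of_real l) *\<^sub>C (z ** (X ** R)) = complex_of_real l *\<^sub>C ((X ** R) ** z)"
  proof -
    have "z ** (X ** R) = X ** (z ** R)" by (simp add: matrix_mul_assoc X)
    then show ?thesis using arg_cong[OF R(1), of "\<lambda>Y. X ** Y"]
      by (simp add: cscale_mult matrix_mul_assoc)
  qed
  moreover have "(1 - complex_of_real l) *\<^sub>C ((X ** R) ** adj z) = complex_of_real l *\<^sub>C (adj z ** (X ** R))"
  proof -
    have "adj z ** (X ** R) = X ** (adj z ** R)" by (simp add: matrix_mul_assoc X)
    then show ?thesis using arg_cong[OF R(2), of "\<lambda>Y. X ** Y"]
      by (simp add: cscale_mult matrix_mul_assoc)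
  qed
  ultimately show "kms l z (X ** R)" by (simp add: kms_def)
qed

text \<open>Going through \<open>adj z ** z\<close> gives the claim multiplied by
  \<open>1 - l\<close>, going through \<open>z ** adj z\<close> gives it multiplied by
  \<open>l\<close>. At least one of these weights is nonzero, which also covers singular
  \<open>R\<close>.\<close>

lemma kms_number_comm:
  assumes z: "fermi_mode z" and R: "kms l z R"
  shows "(adj z ** z) ** R = R ** (adj z ** z)"
proof -
  define b where "b = complex_of_real l"
  have R1: "(1 - b) *\<^sub>C (z ** R) = b *\<^sub>C (R ** z)" and R2: "(1 - b) *\<^sub>C (R ** adj z) = b *\<^sub>C (adj z ** R)"
    using R by (auto simp: kms_def b_def)
  have "(1 - b) *\<^sub>C (adj z ** z ** R) = b *\<^sub>C (adj z ** R ** z)"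
    using arg_cong[OF R1, of "\<lambda>Y. adj z ** Y"] by (simp add: cscale_mult matrix_mul_assoc)
  also have "\<dots> = (1 - b) *\<^sub>C (R ** (adj z ** z))"
    using arg_cong[OF R2, of "\<lambda>Y. Y ** z"] by (simp add: cscale_mult matrix_mul_assoc)
  finally have 1: "(1 - b) *\<^sub>C (adj z ** z ** R) = (1 - b) *\<^sub>C (R ** (adj z ** z))" .
  have "b *\<^sub>C (z ** adj z ** R) = (1 - b) *\<^sub>C (z ** R ** adj z)"
    using arg_cong[OF R2, of "\<lambda>Y. z ** Y"] by (simp add: cscale_mult matrix_mul_assoc)
  also have "\<dots> = b *\<^sub>C (R ** (z ** adj z))"
    using arg_cong[OF R1, of "\<lambda>Y. Y ** adj z"] by (simp add: cscale_mult matrix_mul_assoc)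
  finally have "b *\<^sub>C (adj z ** z ** R) = b *\<^sub>C (R ** (adj z ** z))"
    by (simp add: fermi_modeD(3)[OF z] mat_mult_simps cscale_simps)
  with 1 show ?thesis by (auto simp: cscale_cancel)
qed

text \<open>Writing \<open>z\<close> as \<open>z ** (adj z ** z)\<close> and cycling the number
  operator, which commutes with \<open>R\<close>, to the front produces
  \<open>adj z ** z ** z = 0\<close>; similarly for \<open>adj z\<close>.\<close>

lemma number_comm_ntr:
  assumes z: "fermi_mode z" and n: "(adj z ** z) ** R = R ** (adj z ** z)"
  shows "ntr (z ** R) = 0" "ntr (adj z ** R) = 0"
proof -
  have "ntr (z ** R) = ntr (z ** ((adj z ** z) ** R))"
    by (simp add: matrix_mul_assoc fermi_modeD(5)[OF z, unfolded matrix_mul_assoc])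
  also have "\<dots> = ntr ((z ** R) ** (adj z ** z))" by (simp only: n) (simp add: matrix_mul_assoc)
  also have "\<dots> = ntr ((adj z ** z) ** (z ** R))" by (rule ntr_commute)
  also have "\<dots> = 0"
    by (simp add: matrix_mul_assoc fermi_modeD(4)[OF z] mat_mult_simps ntr_simps)
  finally show "ntr (z ** R) = 0" .
  have "ntr (adj z ** R) = ntr ((adj z ** z) ** (adj z ** R))"
    by (simp add: matrix_mul_assoc fermi_modeD(6)[OF z])
  also have "\<dots> = ntr ((adj z ** R) ** (adj z ** z))" by (rule ntr_commute)
  also have "\<dots> = ntr (adj z ** ((adj z ** z) ** R))" by (simp only: n) (simp add: matrix_mul_assoc)
  also have "\<dots> = 0"
    by (simp add: matrix_mul_assoc fermi_modeD(7)[OF z, unfolded matrix_mul_assoc] mat_mult_simps ntr_simps)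
  finally show "ntr (adj z ** R) = 0" .
qed

text \<open>This identifies \<open>l\<close> as the occupation number: cycling \<open>adj z\<close>
  around the trace balances \<open>adj z ** z\<close> with weight \<open>1 - l\<close> against
  \<open>z ** adj z\<close> with weight \<open>l\<close>, and the two operators add up to the
  identity.\<close>

lemma kms_ntr:
  assumes z: "fermi_mode z" and R: "kms l z R"
  shows "ntr ((adj z ** z - complex_of_real l *\<^sub>C mat 1) ** R) = 0"
proof -
  define b where "b = complex_of_real l"
  have R2: "(1 - b) *\<^sub>C (R ** adj z) = b *\<^sub>C (adj z ** R)"
    using R by (auto simp: kms_def b_def)
  have "b * ntr (z ** adj z ** R) = (1 - b) * ntr (z ** R ** adj z)"
    using arg_cong[OF R2, of "\<lambda>Y. ntr (z ** Y)"] by (simp add: cscale_mult ntr_simps matrix_mul_assoc)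
  also have "ntr (z ** R ** adj z) = ntr (adj z ** (z ** R))" by (rule ntr_commute)
  finally have "b * (ntr R - ntr (adj z ** z ** R)) = (1 - b) * ntr (adj z ** z ** R)"
    by (simp add: fermi_modeD(3)[OF z] mat_mult_simps ntr_simps matrix_mul_assoc)
  then show "ntr ((adj z ** z - complex_of_real l *\<^sub>C mat 1) ** R) = 0"
    by (simp add: b_def mat_mult_simps ntr_simps cscale_mult algebra_simps)
qed

text \<open>Klein transformation: the parity factor squares away in the number operator, while it
  will turn anticommutation with other odd operators into commutation.\<close>

lemma fermi_mode_hat:
  assumes z: "fermi_mode z" and W: "W ** W = mat 1" "adj W = W" "star_anti z W"
  shows "fermi_mode (W ** z)" "adj (W ** z) ** (W ** z) = adj z ** z"
proof -
  have Wz: "W ** z = - (z ** W)" "W ** adj z = - (adj z ** W)" using W by (auto simp: star_anti_def)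
  have zW: "z ** W = - (W ** z)" by (simp add: Wz)
  have "(W ** z) ** (W ** z) = W ** (z ** W) ** z" by (simp add: matrix_mul_assoc)
  also have "\<dots> = - (W ** W ** (z ** z))" by (simp only: zW mat_mult_simps matrix_mul_assoc)
  finally have 1: "(W ** z) ** (W ** z) = 0" by (simp add: fermi_modeD(1)[OF z] mat_mult_simps)
  show 2: "adj (W ** z) ** (W ** z) = adj z ** z"
    by (simp add: W) (simp add: matrix_mul_assoc[symmetric], simp add: matrix_mul_assoc[of W] W)
  have "(W ** z) ** adj (W ** z) = z ** (W ** W) ** adj z"
    by (simp only: Wz(1)) (simp add: W(2) mat_mult_simps matrix_mul_assoc)
  then have "(W ** z) ** adj (W ** z) = z ** adj z" by (simp only: W(1) matrix_mul_rid)
  with 1 2 z show "fermi_mode (W ** z)" unfolding fermi_mode_def by (simp del: adj_mult)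
qed

lemma star_comm_hat:
  assumes "star_anti z X" "X ** W = - (W ** X)" "adj W = W"
  shows "star_comm (W ** z) X"
proof -
  have z: "X ** z = - (z ** X)" "X ** adj z = - (adj z ** X)" using assms by (auto simp: star_anti_def)
  have "X ** (W ** z) = (W ** z) ** X"
    by (simp add: matrix_mul_assoc assms(2) mat_mult_simps)
      (simp add: matrix_mul_assoc[symmetric] z mat_mult_simps)
  moreover have "X ** (adj z ** W) = (adj z ** W) ** X"
    by (simp add: matrix_mul_assoc z mat_mult_simps)
      (simp add: matrix_mul_assoc[symmetric] assms(2) mat_mult_simps)
  ultimately show ?thesis by (simp add: star_comm_def assms(3))
qed

lemma kms_hat:
  assumes R: "kms l z R" and W: "adj W = W" "R ** W = W ** R"
  shows "kms l (W ** z) R"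
proof -
  have R1: "(1 - complex_of_real l) *\<^sub>C (z ** R) = complex_of_real l *\<^sub>C (R ** z)"
    and R2: "(1 - complex_of_real l) *\<^sub>C (R ** adj z) = complex_of_real l *\<^sub>C (adj z ** R)"
    using R by (auto simp: kms_def)
  have e1: "R ** (W ** z) = W ** (R ** z)" by (simp add: matrix_mul_assoc W)
  have e2: "(adj z ** W) ** R = (adj z ** R) ** W" by (simp add: matrix_mul_assoc[symmetric] W)
  show ?thesis
    unfolding kms_def
  proof
    show "(1 - complex_of_real l) *\<^sub>C (W ** z ** R) = complex_of_real l *\<^sub>C (R ** (W ** z))"
      using arg_cong[OF R1, of "\<lambda>Y. W ** Y"] by (simp add: e1 cscale_mult matrix_mul_assoc[symmetric])
    show "(1 - complex_of_real l) *\<^sub>C (R ** adj (W ** z)) = complex_of_real l *\<^sub>C (adj (W ** z) ** R)"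
      using arg_cong[OF R2, of "\<lambda>Y. Y ** W"] by (simp add: e2 W cscale_mult) (simp add: matrix_mul_assoc)
  qed
qed

section \<open>Factors of the Gaussian product\<close>

definition gfactor :: "complex ^ 'k ^ 'k \<Rightarrow> real \<Rightarrow> complex ^ 'k ^ 'k" where
  "gfactor z m = (1 - m) *\<^sub>R (2 *\<^sub>R (z ** adj z)) + m *\<^sub>R (2 *\<^sub>R (adj z ** z))"

lemma gfactor_cscale:
  "gfactor z m = (2 * (1 - complex_of_real m)) *\<^sub>C (z ** adj z) + (2 * complex_of_real m) *\<^sub>C (adj z ** z)"
  by (simp add: gfactor_def scaleR_cscale cscale_simps mult.commute)

lemma gfactor_anti_comm:
  assumes "star_anti z X" shows "X ** gfactor z m = gfactor z m ** X"
proof -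
  have z: "X ** z = - (z ** X)" "X ** adj z = - (adj z ** X)" using assms by (auto simp: star_anti_def)
  have "X ** (z ** adj z) = (z ** adj z) ** X"
    by (simp add: matrix_mul_assoc z mat_mult_simps)
      (simp add: matrix_mul_assoc[symmetric] z mat_mult_simps)
  moreover have "X ** (adj z ** z) = (adj z ** z) ** X"
    by (simp add: matrix_mul_assoc z mat_mult_simps)
      (simp add: matrix_mul_assoc[symmetric] z mat_mult_simps)
  ultimately show ?thesis by (simp add: gfactor_cscale mat_mult_simps cscale_mult)
qed

lemma star_anti_adj: "star_anti z X \<Longrightarrow> star_anti z (adj X)"
  unfolding star_anti_def by (metis adj_mult adj_simps(3) adj_simps(5) minus_minus)

lemma gfactor_kms:
  assumes z: "fermi_mode z" shows "kms m z (gfactor z m)"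
proof -
  note zz = fermi_modeD[OF z]
  have 1: "z ** (z ** adj z) = 0" "(z ** adj z) ** adj z = 0" "z ** adj z ** z = z" "adj z ** (z ** adj z) = adj z"
    by (simp_all add: zz mat_mult_simps)
  show ?thesis
    by (simp add: kms_def gfactor_cscale mat_mult_simps cscale_mult 1 zz(4-7) cscale_simps mult_ac)
qed

context car
begin

lemma Z_fermi_mode: "cinner \<psi> \<psi> = 1 \<Longrightarrow> fermi_mode (Z \<psi>)"
proof -
  assume "cinner \<psi> \<psi> = 1"
  moreover have "2 *\<^sub>C (Z \<psi> ** Z \<psi>) = 0" using Z_Z[of \<psi> \<psi>] cscale_left(1)[of 1 1 "Z \<psi> ** Z \<psi>"]
    by (simp add: cscale_simps)
  then have "Z \<psi> ** Z \<psi> = 0" by (simp add: vec_eq_iff)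
  ultimately show "fermi_mode (Z \<psi>)" by (simp add: fermi_mode_def Z_adj cscale_simps)
qed

lemma Z_star_anti: "cinner \<psi> \<phi> = 0 \<Longrightarrow> star_anti (Z \<psi>) (Z \<phi>)"
  using cnj_cinner[of \<psi> \<phi>] Z_anti[of \<phi> \<psi>] Z_adj[of \<phi> \<psi>]
  by (simp add: star_anti_def cscale_simps eq_neg_iff_add_eq_0)

lemma W_star_anti: "star_anti (Z \<psi>) W"
  by (simp add: star_anti_def W_Z W_adj_Z)

end

section \<open>Gaussian states and mode monomials\<close>

lemma gig_product_gfactor:
  "gig_product Z \<psi> \<mu> = foldr (\<lambda>j M. gfactor (Z (\<psi> j)) (\<mu> j) ** M) [0..<CARD('n)] (mat 1)"
  for Z :: "complex ^ 'n \<Rightarrow> complex ^ 'k ^ 'k"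
  by (simp add: gig_product_def gfactor_def)

lemma psd_conj: "psd M \<Longrightarrow> psd (adj X ** M ** X)"
proof -
  assume "psd M"
  moreover have "cinner v ((adj X ** M ** X) *v v) = cinner (X *v v) (M *v (X *v v))" for v
    using cinner_adj[of "adj X" v "M *v (X *v v)"] by (simp add: matrix_vector_mul_assoc matrix_mul_assoc)
  ultimately show ?thesis by (simp add: psd_def)
qed

lemma psd_mat1: "psd (mat 1)"
  by (simp add: psd_def cinner_self flip: of_real_power)

text \<open>The factor is the square of a self-adjoint \<open>X\<close> formed from the two spectral
  projections of the number operator. As \<open>X\<close> commutes with \<open>M\<close>, the
  product is the conjugation of \<open>M\<close> by \<open>X\<close>.\<close>

lemma psd_gfactor_mult:
  assumes z: "fermi_mode z" and m: "0 \<le> m" "m \<le> 1" and M: "psd M" "M ** (adj z ** z) = (adj z ** z) ** M"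
  shows "psd (gfactor z m ** M)"
proof -
  let ?n = "adj z ** z"
  define X where "X = complex_of_real (sqrt (2 * (1 - m))) *\<^sub>C (mat 1 - ?n) + complex_of_real (sqrt (2 * m)) *\<^sub>C ?n"
  note nn = fermi_modeD(8)[OF z]
  have sq: "complex_of_real (sqrt (2 * (1 - m))) * complex_of_real (sqrt (2 * (1 - m))) = 2 * (1 - complex_of_real m)"
    "complex_of_real (sqrt (2 * m)) * complex_of_real (sqrt (2 * m)) = 2 * complex_of_real m"
    using m by (simp_all flip: of_real_mult) simp_all
  have "X ** X = (complex_of_real (sqrt (2 * (1 - m))) * complex_of_real (sqrt (2 * (1 - m)))) *\<^sub>C (mat 1 - ?n)
      + (complex_of_real (sqrt (2 * m)) * complex_of_real (sqrt (2 * m))) *\<^sub>C ?n"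
    by (simp add: X_def mat_mult_simps cscale_mult nn cscale_simps)
  then have XX: "X ** X = gfactor z m"
    unfolding sq gfactor_cscale fermi_modeD(3)[OF z] .
  have Xa: "adj X = X" by (simp add: X_def)
  have XM: "M ** X = X ** M" by (simp add: X_def mat_mult_simps cscale_mult M(2))
  have "gfactor z m ** M = adj X ** M ** X"
    unfolding XX[symmetric] Xa by (simp add: matrix_mul_assoc[symmetric] XM)
  then show ?thesis using psd_conj[OF M(1)] by simp
qed

section \<open>Mode monomials and their span\<close>

datatype mode_op = Unit | Lower | Raise | Diag

text \<open>Subtracting \<open>l\<close> centres the number operator at occupation \<open>l\<close>,
  which makes the four elements orthogonal there.\<close>

fun mode_mat :: "real \<Rightarrow> complex ^ 'k ^ 'k \<Rightarrow> mode_op \<Rightarrow> complex ^ 'k ^ 'k" where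
  "mode_mat l z Unit = mat 1"
| "mode_mat l z Lower = z"
| "mode_mat l z Raise = adj z"
| "mode_mat l z Diag = adj z ** z - complex_of_real l *\<^sub>C mat 1"

inductive_set lspan :: "(complex ^ 'k ^ 'k) set \<Rightarrow> (complex ^ 'k ^ 'k) set" for S where
  base: "X \<in> S \<Longrightarrow> X \<in> lspan S"
| zero: "0 \<in> lspan S"
| add: "X \<in> lspan S \<Longrightarrow> Y \<in> lspan S \<Longrightarrow> X + Y \<in> lspan S"
| scale: "X \<in> lspan S \<Longrightarrow> c *\<^sub>C X \<in> lspan S"

lemma lspan_neg: "X \<in> lspan S \<Longrightarrow> - X \<in> lspan S"
  using lspan.scale[of X S "-1"] by (simp add: cscale_simps)

lemma lspan_diff: "X \<in> lspan S \<Longrightarrow> Y \<in> lspan S \<Longrightarrow> X - Y \<in> lspan S"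
  using lspan.add[OF _ lspan_neg, of X S Y] by simp

lemma lspan_sum: "(\<And>i. i \<in> I \<Longrightarrow> f i \<in> lspan S) \<Longrightarrow> (\<Sum>i\<in>I. f i) \<in> lspan S"
  by (induction I rule: infinite_finite_induct) (auto intro: lspan.zero lspan.add)

lemma lspan_mult_right:
  assumes "X \<in> lspan S" "\<And>X. X \<in> S \<Longrightarrow> X ** Y \<in> lspan S'" shows "X ** Y \<in> lspan S'"
  using assms(1) by induction (auto simp: mat_mult_simps cscale_mult intro: lspan.intros assms(2))

lemma lspan_mult_left:
  assumes "Y \<in> lspan S" "\<And>Y. Y \<in> S \<Longrightarrow> X ** Y \<in> lspan S'" shows "X ** Y \<in> lspan S'"
  using assms(1) by induction (auto simp: mat_mult_simps cscale_mult intro: lspan.intros assms(2))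

lemma mode_mat_mult:
  assumes z: "fermi_mode z"
  shows "mode_mat l z k ** z \<in> lspan (range (mode_mat l z))"
    "mode_mat l z k ** adj z \<in> lspan (range (mode_mat l z))"
proof -
  let ?S = "range (mode_mat l z)"
  have b: "mat 1 \<in> lspan ?S" "z \<in> lspan ?S" "adj z \<in> lspan ?S"
    "adj z ** z - complex_of_real l *\<^sub>C mat 1 \<in> lspan ?S"
    using lspan.base[of "mode_mat l z k" ?S for k] by (metis mode_mat.simps rangeI)+
  have "(adj z ** z - complex_of_real l *\<^sub>C mat 1) + complex_of_real l *\<^sub>C mat 1 \<in> lspan ?S"
    by (intro lspan.add lspan.scale b)
  then have n: "adj z ** z \<in> lspan ?S" by simp
  note zz = fermi_modeD[OF z]
  show "mode_mat l z k ** z \<in> lspan ?S"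
    by (cases k) (auto simp: zz mat_mult_simps cscale_mult intro: b n lspan.zero lspan_neg lspan.scale)
  show "mode_mat l z k ** adj z \<in> lspan ?S"
    by (cases k) (auto simp: zz(2,3,6) mat_mult_simps cscale_mult
        intro!: b n lspan.zero lspan_diff lspan.scale)
qed

lemma mode_mat_anti:
  assumes "star_anti z X"
  shows "mode_mat l z k ** X = (if k = Lower \<or> k = Raise then - (X ** mode_mat l z k) else X ** mode_mat l z k)"
proof -
  have z: "X ** z = - (z ** X)" "X ** adj z = - (adj z ** X)" using assms by (auto simp: star_anti_def)
  have "X ** (adj z ** z) = (adj z ** z) ** X"
    by (simp add: matrix_mul_assoc z mat_mult_simps)
      (simp add: matrix_mul_assoc[symmetric] z mat_mult_simps)
  then show ?thesis by (cases k) (simp_all add: z mat_mult_simps cscale_mult)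
qed

lemma mode_mat_star_comm: "star_comm h z \<Longrightarrow> star_comm h (mode_mat l z k)"
  by (cases k) (auto intro: star_comm_intros star_comm_adj)

text \<open>Orthogonality in algebraic form: distinct elements multiply to a multiple of a charged
  or centred one, and equal elements leave only a scalar and a centred term.\<close>

lemma mode_mat_adj_mult:
  assumes z: "fermi_mode z"
  shows "k \<noteq> k' \<Longrightarrow> \<exists>c. \<exists>m \<in> {Lower, Raise, Diag}. mode_mat l z k ** adj (mode_mat l z k') = c *\<^sub>C mode_mat l z m"
    "\<exists>c d. mode_mat l z k ** adj (mode_mat l z k) = c *\<^sub>C mat 1 + d *\<^sub>C mode_mat l z Diag"
proof -
  note zz = fermi_modeD[OF z]
  define b where "b = complex_of_real l"
  show "\<exists>c. \<exists>m \<in> {Lower, Raise, Diag}. mode_mat l z k ** adj (mode_mat l z k') = c *\<^sub>C mode_mat l z m"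
    if "k \<noteq> k'"
  proof -
    have "mode_mat l z k ** adj (mode_mat l z k') = 0 \<or>
        mode_mat l z k ** adj (mode_mat l z k') \<in> {z, adj z, mode_mat l z Diag,
          (1 - b) *\<^sub>C z, (1 - b) *\<^sub>C adj z, (- b) *\<^sub>C z, (- b) *\<^sub>C adj z}"
      using that
      by (cases k; cases k')
        (simp_all add: zz mat_mult_simps cscale_mult cscale_left cscale_simps b_def)
    moreover have "z = 1 *\<^sub>C mode_mat l z Lower" "adj z = 1 *\<^sub>C mode_mat l z Raise"
      "mode_mat l z Diag = 1 *\<^sub>C mode_mat l z Diag" "(0 :: complex ^ 'a ^ 'a) = 0 *\<^sub>C mode_mat l z Diag"
      "(1 - b) *\<^sub>C z = (1 - b) *\<^sub>C mode_mat l z Lower" "(- b) *\<^sub>C z = (- b) *\<^sub>C mode_mat l z Lower"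
      "(1 - b) *\<^sub>C adj z = (1 - b) *\<^sub>C mode_mat l z Raise" "(- b) *\<^sub>C adj z = (- b) *\<^sub>C mode_mat l z Raise"
      by (simp_all add: cscale_simps)
    ultimately show ?thesis by (elim disjE insertE emptyE) (metis insertCI)+
  qed
  \<comment> \<open>The coefficients of the identity are the expectations of the product at
    occupation \<open>l\<close>, since the remaining term is centred.\<close>
  have "mode_mat l z k ** adj (mode_mat l z k) =
      (case k of Unit \<Rightarrow> 1 | Lower \<Rightarrow> 1 - b | Raise \<Rightarrow> b | Diag \<Rightarrow> b * (1 - b)) *\<^sub>C mat 1 +
      (case k of Unit \<Rightarrow> 0 | Lower \<Rightarrow> -1 | Raise \<Rightarrow> 1 | Diag \<Rightarrow> 1 - 2 * b) *\<^sub>C mode_mat l z Diag"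
    by (cases k) (simp_all add: zz(3,8) mat_mult_simps cscale_mult b_def[symmetric] cscale_simps,
       simp_all add: vec_eq_iff algebra_simps b_def)
  then show "\<exists>c d. mode_mat l z k ** adj (mode_mat l z k) = c *\<^sub>C mat 1 + d *\<^sub>C mode_mat l z Diag"
    by blast
qed

fun mode_monomial :: "(complex ^ 'n \<Rightarrow> complex ^ 'k ^ 'k) \<Rightarrow> (nat \<Rightarrow> complex ^ 'n) \<Rightarrow> (nat \<Rightarrow> real)
    \<Rightarrow> nat \<Rightarrow> (nat \<Rightarrow> mode_op) \<Rightarrow> complex ^ 'k ^ 'k" where
  "mode_monomial Z \<psi> l 0 f = mat 1"
| "mode_monomial Z \<psi> l (Suc n) f = mode_monomial Z \<psi> l n f ** mode_mat (l n) (Z (\<psi> n)) (f n)"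

lemma mode_monomial_cong: "(\<And>j. j < n \<Longrightarrow> f j = g j) \<Longrightarrow> mode_monomial Z \<psi> l n f = mode_monomial Z \<psi> l n g"
  by (induction n) simp_all

lemma mode_monomial_star_comm: "(\<And>j. j < n \<Longrightarrow> star_comm h (Z (\<psi> j))) \<Longrightarrow> star_comm h (mode_monomial Z \<psi> l n f)"
  by (induction n) (auto intro: star_comm_intros mode_mat_star_comm)

lemma mode_monomial_Unit: "(\<And>j. j < n \<Longrightarrow> f j = Unit) \<Longrightarrow> mode_monomial Z \<psi> l n f = mat 1"
  by (induction n) simp_all

text \<open>A grading operator \<open>P\<close> turns each mode \<open>z\<close> into \<open>P ** z\<close>, which has the same number operator but commutes
  with the other modes.\<close>

locale car_modes = car Z for Z :: "complex ^ 'n \<Rightarrow> complex ^ 'k ^ 'k" +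
  fixes \<psi> :: "nat \<Rightarrow> complex ^ 'n" and P :: "complex ^ 'k ^ 'k"
  assumes onb: "orthonormal_basis \<psi>"
    and P_P: "P ** P = mat 1" and P_adj: "adj P = P" and P_star_anti: "star_anti (Z \<phi>) P"
begin

lemma psi_fermi_mode: "j < CARD('n) \<Longrightarrow> fermi_mode (Z (\<psi> j))"
  by (simp add: Z_fermi_mode onb_cinner[OF onb])

lemma psi_star_anti: "i < CARD('n) \<Longrightarrow> j < CARD('n) \<Longrightarrow> i \<noteq> j \<Longrightarrow> star_anti (Z (\<psi> i)) (Z (\<psi> j))"
  by (simp add: Z_star_anti onb_cinner[OF onb])

lemma psi_hat:
  "i < CARD('n) \<Longrightarrow> fermi_mode (P ** Z (\<psi> i))"
  "i < CARD('n) \<Longrightarrow> adj (P ** Z (\<psi> i)) ** (P ** Z (\<psi> i)) = adj (Z (\<psi> i)) ** Z (\<psi> i)"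
  "i < CARD('n) \<Longrightarrow> j < CARD('n) \<Longrightarrow> i \<noteq> j \<Longrightarrow> star_comm (P ** Z (\<psi> i)) (Z (\<psi> j))"
proof -
  show "i < CARD('n) \<Longrightarrow> fermi_mode (P ** Z (\<psi> i))"
    "i < CARD('n) \<Longrightarrow> adj (P ** Z (\<psi> i)) ** (P ** Z (\<psi> i)) = adj (Z (\<psi> i)) ** Z (\<psi> i)"
    by (rule fermi_mode_hat[OF psi_fermi_mode P_P P_adj P_star_anti]; assumption)+
  show "star_comm (P ** Z (\<psi> i)) (Z (\<psi> j))" if "i < CARD('n)" "j < CARD('n)" "i \<noteq> j"
    by (rule star_comm_hat[OF psi_star_anti[OF that] _ P_adj]) (use P_star_anti in \<open>simp add: star_anti_def\<close>)
qed

abbreviation gprod :: "(nat \<Rightarrow> real) \<Rightarrow> nat list \<Rightarrow> complex ^ 'k ^ 'k" where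
  "gprod \<mu> js \<equiv> foldr (\<lambda>j M. gfactor (Z (\<psi> j)) (\<mu> j) ** M) js (mat 1)"

lemma gprod_comm:
  assumes "\<And>j. j \<in> set js \<Longrightarrow> star_anti (Z (\<psi> j)) X"
  shows "X ** gprod \<mu> js = gprod \<mu> js ** X"
  using assms
proof (induction js)
  case (Cons j js)
  have "X ** gfactor (Z (\<psi> j)) (\<mu> j) = gfactor (Z (\<psi> j)) (\<mu> j) ** X"
    by (rule gfactor_anti_comm) (use Cons.prems in simp)
  then show ?case using Cons
    by (simp add: matrix_mul_assoc) (simp add: matrix_mul_assoc[symmetric])
qed simp

lemma gfactor_star_comm: "star_comm h z \<Longrightarrow> star_comm h (gfactor z m)"
  unfolding gfactor_cscale by (intro star_comm_intros star_comm_adj)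

lemma gprod_star_comm:
  "(\<And>j. j \<in> set js \<Longrightarrow> star_comm h (Z (\<psi> j))) \<Longrightarrow> star_comm h (gprod \<mu> js)"
  by (induction js) (auto intro: star_comm_intros gfactor_star_comm)

lemma gprod_P: "P ** gprod \<mu> js = gprod \<mu> js ** P"
  by (rule gprod_comm) (rule P_star_anti)

text \<open>Each factor is even in its own mode, so a different mode commutes with it without any
  parity dressing.\<close>

lemma gprod_star_comm_psi:
  assumes "set js \<subseteq> {..<CARD('n)}" "i < CARD('n)" "i \<notin> set js"
  shows "star_comm (Z (\<psi> i)) (gprod \<mu> js)"
proof -
  have s: "star_anti (Z (\<psi> j)) (Z (\<psi> i))" if "j \<in> set js" for j
    using that assms psi_star_anti by (metis lessThan_iff subset_iff)
  then have "star_anti (Z (\<psi> j)) (adj (Z (\<psi> i)))" if "j \<in> set js" for j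
    using that star_anti_adj by blast
  with s show ?thesis unfolding star_comm_def by (simp add: gprod_comm)
qed

lemma gprod_kms:
  assumes "set js \<subseteq> {..<CARD('n)}" "distinct js" "i \<in> set js"
  shows "kms (\<mu> i) (Z (\<psi> i)) (gprod \<mu> js)"
  using assms
proof (induction js)
  case (Cons j js)
  show ?case
  proof (cases "i = j")
    case True
    then have "star_comm (Z (\<psi> i)) (gprod \<mu> js)" using Cons.prems by (intro gprod_star_comm_psi) auto
    moreover have "kms (\<mu> i) (Z (\<psi> i)) (gfactor (Z (\<psi> i)) (\<mu> i))"
      using True Cons.prems by (intro gfactor_kms psi_fermi_mode) auto
    ultimately have "kms (\<mu> i) (Z (\<psi> i)) (gfactor (Z (\<psi> i)) (\<mu> i) ** gprod \<mu> js)"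
      by (intro kms_mult(1))
    then show ?thesis by (simp add: True)
  next
    case False
    have "star_comm (Z (\<psi> i)) (gprod \<mu> [j])" using Cons.prems False by (intro gprod_star_comm_psi) auto
    then have "star_comm (Z (\<psi> i)) (gfactor (Z (\<psi> j)) (\<mu> j))" by simp
    moreover have "kms (\<mu> i) (Z (\<psi> i)) (gprod \<mu> js)" using Cons False by auto
    ultimately have "kms (\<mu> i) (Z (\<psi> i)) (gfactor (Z (\<psi> j)) (\<mu> j) ** gprod \<mu> js)"
      by (intro kms_mult(2))
    then show ?thesis by simp
  qed
qed simp

text \<open>Under the plain trace every dressed mode has occupation 1/2, and this persists after
  multiplication by anything commuting with the mode. Both halves of a factor then have expectation
  1/2 relative to the rest, and the weights 2 (1 - \<mu>) and 2 \<mu> contribute a total of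
  one.\<close>

lemma gprod_ntr_mult:
  assumes "set js \<subseteq> {..<CARD('n)}" "distinct js" "\<And>j. j \<in> set js \<Longrightarrow> star_comm (P ** Z (\<psi> j)) X"
  shows "ntr (gprod \<mu> js ** X) = ntr X"
  using assms
proof (induction js)
  case (Cons j js)
  let ?z = "Z (\<psi> j)" let ?h = "P ** ?z" let ?R = "gprod \<mu> js ** X"
  have j: "j < CARD('n)" using Cons.prems by auto
  have "star_comm ?h (Z (\<psi> i))" if "i \<in> set js" for i
    by (rule psi_hat(3)) (use that Cons.prems in auto)
  then have "star_comm ?h (gprod \<mu> js)" by (rule gprod_star_comm)
  then have "star_comm ?h ?R" using Cons.prems by (intro star_comm_intros) auto
  moreover have "kms (1/2) ?h (mat 1)" by (simp add: kms_def)
  ultimately have kR: "kms (1/2) ?h ?R" using kms_mult(1) by fastforce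
  have "ntr ((adj ?z ** ?z - complex_of_real (1/2) *\<^sub>C mat 1) ** ?R) = 0"
    using kms_ntr[OF psi_hat(1)[OF j] kR] unfolding psi_hat(2)[OF j] .
  then have half: "ntr (adj ?z ** ?z ** ?R) = 1/2 * ntr ?R"
    by (simp add: mat_mult_simps ntr_simps cscale_mult)
  have "ntr (gfactor ?z (\<mu> j) ** ?R) = 2 * (1 - complex_of_real (\<mu> j)) * (ntr ?R - ntr (adj ?z ** ?z ** ?R))
      + 2 * complex_of_real (\<mu> j) * ntr (adj ?z ** ?z ** ?R)"
    by (simp add: gfactor_cscale fermi_modeD(3)[OF psi_fermi_mode[OF j]] mat_mult_simps ntr_simps cscale_mult)
  also have "\<dots> = ntr ?R" unfolding half by (simp add: field_simps)
  finally show ?case using Cons by (simp add: matrix_mul_assoc)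
qed simp

lemma gprod_ntr:
  "set js \<subseteq> {..<CARD('n)} \<Longrightarrow> distinct js \<Longrightarrow> ntr (gprod \<mu> js) = 1"
  using gprod_ntr_mult[of js "mat 1" \<mu>] by (simp add: star_comm_intros ntr_simps)

lemma gprod_psd:
  assumes "set js \<subseteq> {..<CARD('n)}" "distinct js" "\<And>j. j \<in> set js \<Longrightarrow> 0 \<le> \<mu> j \<and> \<mu> j \<le> 1"
  shows "psd (gprod \<mu> js)"
  using assms
proof (induction js)
  case (Cons j js)
  have "star_comm (Z (\<psi> j)) (gprod \<mu> js)" using Cons.prems by (intro gprod_star_comm_psi) auto
  note star_comm_number[OF this, symmetric]
  then show ?case using Cons by (simp add: psd_gfactor_mult psi_fermi_mode)
qed (simp add: psd_mat1)

text \<open>Normalization, evenness and the KMS relation at each mode. When the field generates the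
  full algebra they determine the operator, so densities can be compared without their product
  formulas.\<close>

definition gaussian :: "(nat \<Rightarrow> real) \<Rightarrow> complex ^ 'k ^ 'k \<Rightarrow> bool" where
  "gaussian \<mu> R \<longleftrightarrow> ntr R = 1 \<and> R ** P = P ** R \<and> (\<forall>j<CARD('n). kms (\<mu> j) (Z (\<psi> j)) R)"

lemma gig_product_gaussian: "gaussian \<mu> (gig_product Z \<psi> \<mu>)"
  unfolding gaussian_def gig_product_gfactor
  by (auto simp: gprod_P intro!: gprod_ntr gprod_kms)

lemma gig_product_psd: "(\<And>j. j < CARD('n) \<Longrightarrow> 0 \<le> \<mu> j \<and> \<mu> j \<le> 1) \<Longrightarrow> psd (gig_product Z \<psi> \<mu>)"
  unfolding gig_product_gfactor by (rule gprod_psd) auto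

lemma mode_monomial_hat_star_comm: "n \<le> i \<Longrightarrow> i < CARD('n) \<Longrightarrow> star_comm (P ** Z (\<psi> i)) (mode_monomial Z \<psi> l n f)"
  by (rule mode_monomial_star_comm) (simp add: psi_hat(3))

text \<open>Induction on the last mode. Cycling the trace collects the earlier factors and the
  density into one operator, which keeps the KMS relation of the dressed mode because the earlier
  factors commute with that mode. If the last entries differ, their product is charged or centred
  and has expectation zero; if they agree, only a scalar survives and the difference lies at an
  earlier mode.\<close>

lemma gaussian_orthogonal:
  assumes R: "gaussian l R" and n: "n \<le> CARD('n)" and ne: "\<exists>j<n. f j \<noteq> g j"
  shows "ntr (mode_monomial Z \<psi> l n f ** adj (mode_monomial Z \<psi> l n g) ** R) = 0"
  using n ne
proof (induction n)
  case (Suc n)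
  let ?F = "mode_monomial Z \<psi> l n f" let ?G = "adj (mode_monomial Z \<psi> l n g)" let ?z = "Z (\<psi> n)"
  let ?x = "mode_mat (l n) ?z (f n)" let ?y = "adj (mode_mat (l n) ?z (g n))"
  have nN: "n < CARD('n)" using Suc.prems by simp
  let ?R = "?G ** R ** ?F"
  have cyc: "ntr (?F ** Q ** ?G ** R) = ntr (Q ** ?R)" for Q
    using ntr_commute[of ?F "Q ** ?G ** R"] by (simp add: matrix_mul_assoc)
  have "kms (l n) (Z (\<psi> n)) R" "R ** P = P ** R" using R nN by (auto simp: gaussian_def)
  then have "kms (l n) (P ** ?z) R" by (intro kms_hat P_adj)
  then have kR: "kms (l n) (P ** ?z) ?R"
    by (intro kms_mult star_comm_adj mode_monomial_hat_star_comm) (use nN in auto)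
  have WR: "ntr (mode_mat (l n) ?z m ** ?R) = 0" if "m \<in> {Lower, Raise, Diag}" for m
  proof -
    have D: "ntr (mode_mat (l n) ?z Diag ** ?R) = 0"
      using kms_ntr[OF psi_hat(1)[OF nN] kR] psi_hat(2)[OF nN] by simp
    have n: "(adj ?z ** ?z) ** ?R = ?R ** (adj ?z ** ?z)"
      using kms_number_comm[OF psi_hat(1)[OF nN] kR] psi_hat(2)[OF nN] by simp
    show ?thesis using that number_comm_ntr[OF psi_fermi_mode[OF nN] n] D by auto
  qed
  have e: "mode_monomial Z \<psi> l (Suc n) f ** adj (mode_monomial Z \<psi> l (Suc n) g) ** R = ?F ** (?x ** ?y) ** ?G ** R"
    by (simp add: matrix_mul_assoc)
  show ?case
  proof (cases "f n = g n")
    case False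
    then obtain c m where m: "m \<in> {Lower, Raise, Diag}" "?x ** ?y = c *\<^sub>C mode_mat (l n) ?z m"
      using mode_mat_adj_mult(1)[OF psi_fermi_mode[OF nN], of "f n" "g n" "l n"] by blast
    show ?thesis unfolding e cyc m(2) using WR[OF m(1)] by (simp add: cscale_mult ntr_simps)
  next
    case True
    then obtain c d where cd: "?x ** ?y = c *\<^sub>C mat 1 + d *\<^sub>C mode_mat (l n) ?z Diag"
      using mode_mat_adj_mult(2)[OF psi_fermi_mode[OF nN], of "l n" "g n"] by metis
    have "\<exists>j<n. f j \<noteq> g j" using Suc.prems True by (metis less_antisym)
    then have "ntr (?F ** ?G ** R) = 0" using Suc by auto
    then have "ntr ?R = 0" using cyc[of "mat 1"] by simp
    then show ?thesis unfolding e cyc cd using WR[of Diag]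
      by (simp add: cscale_mult mat_mult_simps ntr_simps del: mode_mat.simps)
  qed
qed simp

text \<open>A generator appended on the right is sorted into its place: passing a later mode costs
  at most a sign, and at its own mode the span of the four elements is closed under right
  multiplication.\<close>

lemma mode_monomial_span_mult:
  assumes "n \<le> CARD('n)" "j < n"
  shows "mode_monomial Z \<psi> l n f ** Z (\<psi> j) \<in> lspan (range (mode_monomial Z \<psi> l n))"
    "mode_monomial Z \<psi> l n f ** adj (Z (\<psi> j)) \<in> lspan (range (mode_monomial Z \<psi> l n))"
proof -
  have "mode_monomial Z \<psi> l n f ** Z (\<psi> j) \<in> lspan (range (mode_monomial Z \<psi> l n)) \<and>
    mode_monomial Z \<psi> l n f ** adj (Z (\<psi> j)) \<in> lspan (range (mode_monomial Z \<psi> l n))"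
    using assms
  proof (induction n arbitrary: f)
    case (Suc n)
    let ?z = "Z (\<psi> n)" let ?S = "range (mode_monomial Z \<psi> l n)" let ?S' = "range (mode_monomial Z \<psi> l (Suc n))"
    have nN: "n < CARD('n)" using Suc.prems by simp
    have up: "mode_monomial Z \<psi> l n g ** mode_mat (l n) ?z k \<in> ?S'" for g k
    proof -
      have "mode_monomial Z \<psi> l n g ** mode_mat (l n) ?z k = mode_monomial Z \<psi> l (Suc n) (g(n := k))"
        by (simp add: mode_monomial_cong[of n g "g(n := k)"])
      then show ?thesis by (simp del: mode_monomial.simps)
    qed
    show ?case
    proof (cases "j = n")
      case True
      have "mode_monomial Z \<psi> l n f ** (mode_mat (l n) ?z (f n) ** ?z) \<in> lspan ?S'"
        "mode_monomial Z \<psi> l n f ** (mode_mat (l n) ?z (f n) ** adj ?z) \<in> lspan ?S'"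
        by (rule lspan_mult_left[OF mode_mat_mult(1)[OF psi_fermi_mode[OF nN]]] lspan_mult_left[OF mode_mat_mult(2)[OF psi_fermi_mode[OF nN]]],
            use up in \<open>auto intro: lspan.base\<close>)+
      then show ?thesis using True by (simp add: matrix_mul_assoc)
    next
      case False
      then have jn: "j < n" using Suc.prems by simp
      have sa: "star_anti ?z (Z (\<psi> j))" using jn nN by (intro psi_star_anti) auto
      have step: "mode_monomial Z \<psi> l (Suc n) f ** Y \<in> lspan ?S'"
        if Y: "star_anti ?z Y" "mode_monomial Z \<psi> l n f ** Y \<in> lspan ?S" for Y
      proof -
        have "mode_monomial Z \<psi> l n f ** Y ** mode_mat (l n) ?z (f n) \<in> lspan ?S'"
          by (rule lspan_mult_right[OF Y(2)]) (use up in \<open>auto intro: lspan.base\<close>)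
        moreover have "mode_monomial Z \<psi> l (Suc n) f ** Y = mode_monomial Z \<psi> l n f ** Y ** mode_mat (l n) ?z (f n) \<or>
            mode_monomial Z \<psi> l (Suc n) f ** Y = - (mode_monomial Z \<psi> l n f ** Y ** mode_mat (l n) ?z (f n))"
          using mode_mat_anti[OF Y(1), of "l n" "f n"]
          by (auto simp: matrix_mul_assoc[symmetric] mat_mult_simps split: if_splits)
        ultimately show ?thesis using lspan_neg by metis
      qed
      show ?thesis using step[OF sa] step[OF star_anti_adj[OF sa]] Suc.IH[of f] jn nN by auto
    qed
  qed simp
  then show "mode_monomial Z \<psi> l n f ** Z (\<psi> j) \<in> lspan (range (mode_monomial Z \<psi> l n))"
    "mode_monomial Z \<psi> l n f ** adj (Z (\<psi> j)) \<in> lspan (range (mode_monomial Z \<psi> l n))" by auto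
qed

lemma mode_monomial_span:
  assumes full: "star_algebra (range Z) = UNIV"
  shows "X \<in> lspan (range (mode_monomial Z \<psi> l CARD('n)))"
proof -
  let ?S = "range (mode_monomial Z \<psi> l CARD('n))"
  have step: "Y ** letter Z a \<in> lspan ?S" if Y: "Y \<in> lspan ?S" for Y a
  proof -
    obtain b \<phi> where a: "a = (b, \<phi>)" by (cases a)
    have "Z \<phi> = Z (\<Sum>j<CARD('n). cinner (\<psi> j) \<phi> *s \<psi> j)" using onb_expand[OF onb, of \<phi>] by simp
    then have e: "Z \<phi> = (\<Sum>j<CARD('n). cnj (cinner (\<psi> j) \<phi>) *\<^sub>C Z (\<psi> j))"
      by (simp add: Z_sum Z_smult)
    have "Y ** Z (\<psi> j) \<in> lspan ?S" "Y ** adj (Z (\<psi> j)) \<in> lspan ?S" if "j < CARD('n)" for j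
      by (rule lspan_mult_right[OF Y], use mode_monomial_span_mult[OF order_refl that] in auto)+
    then show ?thesis
      by (auto simp: a e adj_sum mat_mult_sum cscale_mult intro!: lspan_sum lspan.scale)
  qed
  have w: "Y \<in> lspan ?S \<Longrightarrow> Y ** word Z w \<in> lspan ?S" for Y w
  proof (induction w arbitrary: Y)
    case (Cons a w)
    then show ?case using step by (simp add: matrix_mul_assoc)
  qed simp
  have "mat 1 \<in> ?S" using mode_monomial_Unit[of "CARD('n)" "\<lambda>_. Unit"] by (metis rangeI)
  then have w1: "word Z w \<in> lspan ?S" for w using w[OF lspan.base] by (metis matrix_mul_lid)
  have "ncpoly_eval Z p \<in> lspan ?S" for p
    by (induction p) (auto simp: ncpoly_eval_Cons lspan.zero intro!: lspan.add lspan.scale w1)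
  moreover have "\<exists>p. X = ncpoly_eval Z p"
    using full star_algebra_eq_ncpoly[of Z] by (metis UNIV_I imageE)
  ultimately show ?thesis by auto
qed

text \<open>Orthogonality to the identity, which is the monomial with all entries
  \<open>Unit\<close>.\<close>

lemma gaussian_mode_monomial:
  assumes "gaussian l R"
  shows "ntr (mode_monomial Z \<psi> l CARD('n) f ** R) = (if \<forall>j<CARD('n). f j = Unit then 1 else 0)"
proof (cases "\<forall>j<CARD('n). f j = Unit")
  case True
  then have "mode_monomial Z \<psi> l CARD('n) f = mat 1" by (intro mode_monomial_Unit) auto
  then show ?thesis using assms True by (simp add: gaussian_def)
next
  case False
  then show ?thesis
    using gaussian_orthogonal[OF assms order_refl, of f "\<lambda>_. Unit"]
      mode_monomial_Unit[of "CARD('n)" "\<lambda>_. Unit" Z \<psi> l] by auto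
qed

lemma ntr_mode_monomial_eqI:
  assumes full: "star_algebra (range Z) = UNIV"
    and eq: "\<And>f. ntr (mode_monomial Z \<psi> l CARD('n) f ** R) = ntr (mode_monomial Z \<psi> l CARD('n) f ** R')"
  shows "R = R'"
proof (rule ntr_eqI)
  fix V
  show "ntr (V ** R) = ntr (V ** R')"
    using mode_monomial_span[OF full, of V l]
    by induction (auto simp: eq mat_mult_simps cscale_mult ntr_simps)
qed

lemma gaussian_unique:
  assumes "star_algebra (range Z) = UNIV" "gaussian l R" "gaussian l R'"
  shows "R = R'"
  by (rule ntr_mode_monomial_eqI[OF assms(1), of l]) (simp add: gaussian_mode_monomial assms)

text \<open>The relations at the eigenvectors are combined linearly; the eigenvalues are real and so
  pass through the conjugate linear \<open>Z\<close>. Only \<open>Q\<close> remains in the result,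
  which makes different diagonalizations of a degenerate \<open>Q\<close> comparable.\<close>

lemma kms_basis_free:
  assumes Q: "Q = spec \<psi> (\<lambda>j. complex_of_real (\<mu> j))" and R: "\<And>j. j < CARD('n) \<Longrightarrow> kms (\<mu> j) (Z (\<psi> j)) R"
  shows "Z ((mat 1 - Q) *v \<phi>) ** R = R ** Z (Q *v \<phi>)"
    "R ** adj (Z ((mat 1 - Q) *v \<phi>)) = adj (Z (Q *v \<phi>)) ** R"
proof -
  have Zs: "Z (spec \<psi> d *v \<phi>) = (\<Sum>j<CARD('n). (cnj (cinner (\<psi> j) \<phi>) * cnj (d j)) *\<^sub>C Z (\<psi> j))" for d
    by (simp add: spec_mult_vec Z_sum Z_smult mult.commute)
  have Q1: "mat 1 - Q = spec \<psi> (\<lambda>j. 1 - complex_of_real (\<mu> j))"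
    by (simp add: Q spec_one[OF onb, symmetric] spec_linear)
  note k = R[unfolded kms_def, THEN conjunct1] R[unfolded kms_def, THEN conjunct2]
  have "(\<Sum>j<CARD('n). cnj (cinner (\<psi> j) \<phi>) *\<^sub>C (1 - complex_of_real (\<mu> j)) *\<^sub>C (Z (\<psi> j) ** R)) =
      (\<Sum>j<CARD('n). cnj (cinner (\<psi> j) \<phi>) *\<^sub>C complex_of_real (\<mu> j) *\<^sub>C (R ** Z (\<psi> j)))"
    by (intro sum.cong refl) (simp only: k lessThan_iff)
  then show "Z ((mat 1 - Q) *v \<phi>) ** R = R ** Z (Q *v \<phi>)"
    unfolding Q1 unfolding Q Zs by (simp add: mat_mult_sum cscale_mult cscale_simps)
  have "(\<Sum>j<CARD('n). cinner (\<psi> j) \<phi> *\<^sub>C (1 - complex_of_real (\<mu> j)) *\<^sub>C (R ** adj (Z (\<psi> j)))) =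
      (\<Sum>j<CARD('n). cinner (\<psi> j) \<phi> *\<^sub>C complex_of_real (\<mu> j) *\<^sub>C (adj (Z (\<psi> j)) ** R))"
    by (intro sum.cong refl) (simp only: k lessThan_iff)
  then show "R ** adj (Z ((mat 1 - Q) *v \<phi>)) = adj (Z (Q *v \<phi>)) ** R"
    unfolding Q1 unfolding Q Zs by (simp add: mat_mult_sum adj_sum cscale_mult cscale_simps)
qed

lemma kms_of_basis_free:
  assumes Q: "Q *v \<phi> = complex_of_real m *s \<phi>"
    and R: "Z ((mat 1 - Q) *v \<phi>) ** R = R ** Z (Q *v \<phi>)" "R ** adj (Z ((mat 1 - Q) *v \<phi>)) = adj (Z (Q *v \<phi>)) ** R"
  shows "kms m (Z \<phi>) R"
proof -
  have Q': "(mat 1 - Q) *v \<phi> = (1 - complex_of_real m) *s \<phi>"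
    by (simp add: matrix_vector_mult_diff_rdistrib Q vec.scale_left_diff_distrib)
  show ?thesis using R unfolding Q Q' Z_smult kms_def by (simp add: cscale_mult)
qed

end

lemma (in car_modes) gig_state_eq:
  assumes full: "star_algebra (range Z) = UNIV" and Q: "Q = spec \<psi> (\<lambda>j. complex_of_real (\<mu> j))"
  shows "gig_state Z Q = gig_product Z \<psi> \<mu>"
  unfolding gig_state_def
proof (rule the_equality)
  have s: "spec \<phi> (\<lambda>j. complex_of_real (\<nu> j)) = (\<Sum>j<CARD('n). \<nu> j *\<^sub>R outer (\<phi> j) (\<phi> j))"
    for \<phi> :: "nat \<Rightarrow> complex ^ 'n" and \<nu>
    by (simp add: spec_def scaleR_cscale)
  show "\<exists>\<psi>' \<mu>'. orthonormal_basis \<psi>' \<and> Q = (\<Sum>j<CARD('n). \<mu>' j *\<^sub>R outer (\<psi>' j) (\<psi>' j)) \<and>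
      gig_product Z \<psi> \<mu> = gig_product Z \<psi>' \<mu>'"
    using onb Q s by blast
  fix \<rho> assume "\<exists>\<psi>' \<mu>'. orthonormal_basis \<psi>' \<and> Q = (\<Sum>j<CARD('n). \<mu>' j *\<^sub>R outer (\<psi>' j) (\<psi>' j)) \<and>
      \<rho> = gig_product Z \<psi>' \<mu>'"
  then obtain \<psi>' \<mu>' where on': "orthonormal_basis \<psi>'" and Q': "Q = spec \<psi>' (\<lambda>j. complex_of_real (\<mu>' j))"
    and \<rho>: "\<rho> = gig_product Z \<psi>' \<mu>'"
    unfolding s[symmetric] by blast
  interpret M': car_modes Z \<psi>' P by unfold_locales (rule on' P_P P_adj P_star_anti)+
  have g': "M'.gaussian \<mu>' \<rho>" unfolding \<rho> by (rule M'.gig_product_gaussian)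
  have "gaussian \<mu> \<rho>"
    unfolding gaussian_def
  proof (intro conjI allI impI)
    fix j assume j: "j < CARD('n)"
    show "kms (\<mu> j) (Z (\<psi> j)) \<rho>"
      by (rule kms_of_basis_free[of Q]; (rule M'.kms_basis_free[OF Q'])?)
        (use g' Q spec_basis[OF onb j] in \<open>auto simp: M'.gaussian_def\<close>)
  qed (use g' in \<open>auto simp: M'.gaussian_def\<close>)
  then show "\<rho> = gig_product Z \<psi> \<mu>"
    using gaussian_unique[OF full] gig_product_gaussian by blast
qed

section \<open>Evans--Hugenholtz--Kadison operations on mode monomials\<close>

lemma block_matrix_dsum:
  "block_matrix M11 M12 M21 M22 *v dsum u v = dsum (M11 *v u + M12 *v v) (M21 *v u + M22 *v v)"
  by (simp add: vec_eq_iff block_matrix_def dsum_def matrix_vector_mult_def UNIV_Plus_UNIV[symmetric]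
      sum.Plus sum.distrib del: UNIV_Plus_UNIV split: sum.splits)

lemma adj_block_matrix:
  "adj (block_matrix M11 M12 M21 M22) = block_matrix (adj M11) (adj M21) (adj M12) (adj M22)"
  by (simp add: vec_eq_iff block_matrix_def split: sum.splits)

text \<open>The shape of \<open>U_op S\<close> for self-adjoint \<open>S\<close>, where both square
  roots are the same operator \<open>C\<close>.\<close>

lemma self_adjoint_involution_block:
  fixes S C :: "complex ^ 'n ^ 'n"
  assumes "adj S = S" "adj C = C" "S ** C = C ** S" "C ** C + S ** S = mat 1"
  defines "U \<equiv> block_matrix (- C) S S C"
  shows "U *v (U *v \<xi>) = \<xi>" "cinner (U *v \<xi>) (U *v \<zeta>) = cinner \<xi> \<zeta>"
proof -
  show UU: "U *v (U *v \<xi>) = \<xi>" for \<xi>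
  proof -
    obtain u v where \<xi>: "\<xi> = dsum u v" by (rule dsum_exhaust)
    have m: "(- M) *v w = - (M *v w)" "M *v (- w) = - (M *v w)" for M :: "complex ^ 'n ^ 'n" and w
      by (simp_all add: vec_eq_iff matrix_vector_mult_def sum_negf)
    have e: "C *v (C *v w) + S *v (S *v w) = w" for w
      using assms(4) by (simp add: matrix_vector_mul_assoc flip: matrix_vector_mult_add_rdistrib)
    have c: "S *v (C *v w) = C *v (S *v w)" for w by (simp add: matrix_vector_mul_assoc assms(3))
    show ?thesis
      using e[of u] e[of v]
      by (simp add: U_def \<xi> block_matrix_dsum m c matrix_vector_right_distrib
          matrix_vector_mult_diff_distrib algebra_simps)
  qed
  have "adj U = U" by (simp add: U_def adj_block_matrix assms(1,2))
  then show "cinner (U *v \<xi>) (U *v \<zeta>) = cinner \<xi> \<zeta>"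
    using cinner_adj[of U \<xi> "U *v \<zeta>"] by (simp add: UU)
qed

lemma bij_betw_UNIV_D:
  assumes "bij_betw f UNIV S" shows "inj f" "range f = S"
  using assms by (auto simp: bij_betw_def)

section \<open>The EHK operation through its trace pairings\<close>

locale car_full = car Z for Z :: "complex ^ 'n \<Rightarrow> complex ^ 'k ^ 'k" +
  assumes full: "star_algebra (range Z) = UNIV"
begin

sublocale D: car "double_field Z"
  by unfold_locales (rule double_field_car)

lemma field_A_car: "car_field (field_A Z)"
  unfolding field_A_def
  by (rule car_field_comp[OF double_field_car]) (use dsum_simps(1)[of _ _ 0 0] dsum_simps(2)[of _ _ 0] in
      \<open>auto simp: cinner_dsum cinner_simps\<close>)

lemma field_B_car: "car_field (field_B Z)"
  unfolding field_B_def
  by (rule car_field_comp[OF double_field_car]) (use dsum_simps(1)[of 0 0] dsum_simps(2)[of _ 0] in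
      \<open>auto simp: cinner_dsum cinner_simps\<close>)

lemmas iota_A_props = car_iso_props[OF car field_A_car full, folded iota_A_def]
lemmas iota_B_props = car_iso_props[OF car field_B_car full, folded iota_B_def]
lemmas iota_A_hom = star_hom_simps[OF iota_A_props(1)]
lemmas iota_B_hom = star_hom_simps[OF iota_B_props(1)]

lemma iota_B_in: "iota_B Z X \<in> star_algebra (range (field_B Z))"
  using bij_betw_UNIV_D(2)[OF iota_B_props(2)] by blast

text \<open>\<open>alpha\<close> composed with itself fixes all generators and hence everything.
  Involutivity together with trace invariance lets \<open>alpha\<close> be moved to the other factor
  of a pairing.\<close>

lemma alpha_props:
  assumes "\<And>\<xi>. U *v (U *v \<xi>) = \<xi>" "\<And>\<xi> \<zeta>. cinner (U *v \<xi>) (U *v \<zeta>) = cinner \<xi> \<zeta>"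
  shows "star_hom (alpha Z U)" "alpha Z U (double_field Z \<xi>) = double_field Z (U *v \<xi>)"
    "ntr (alpha Z U X) = ntr X" "alpha Z U (alpha Z U X) = X"
proof -
  have c: "car_field (\<lambda>\<xi>. double_field Z (U *v \<xi>))"
    by (rule car_field_comp[OF double_field_car])
      (auto simp: matrix_vector_right_distrib mult_vec_smult assms(2))
  note p = car_iso_props[OF double_field_car c double_field_full[OF full], folded alpha_def]
  show "star_hom (alpha Z U)" "alpha Z U (double_field Z \<xi>) = double_field Z (U *v \<xi>)"
    "ntr (alpha Z U X) = ntr X" for \<xi> X by (fact p)+
  have "star_hom (\<lambda>X. alpha Z U (alpha Z U X))"
    by (simp add: star_hom_def star_hom_simps[OF p(1)])
  moreover have "star_hom (\<lambda>X :: complex ^ ('k \<times> 'k) ^ ('k \<times> 'k). X)" by (simp add: star_hom_def)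
  ultimately show "alpha Z U (alpha Z U X) = X"
    by (rule star_hom_eqI[of _ _ "range (double_field Z)"])
      (auto simp: p(3) assms(1) double_field_full[OF full])
qed

text \<open>Pairing with \<open>X\<close> is a linear functional on \<A>, represented by some
  \<open>Y\<close>; trace preservation of \<open>iota_A\<close> identifies the projection of
  \<open>X\<close> with the image of \<open>Y\<close>.\<close>

lemma cond_exp_A_iota:
  obtains Y where "cond_exp_A Z X = iota_A Z Y" "\<And>V. ntr (iota_A Z V ** X) = ntr (V ** Y)"
proof -
  obtain Y where Y: "\<And>V. ntr (iota_A Z V ** X) = ntr (V ** Y)"
    by (rule linear_functional_ntr[of "\<lambda>V. ntr (iota_A Z V ** X)"])
      (simp_all add: iota_A_hom mat_mult_simps cscale_mult ntr_simps)
  have A: "alg_A Z = range (iota_A Z)"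
    unfolding alg_A_def using bij_betw_UNIV_D(2)[OF iota_A_props(2)] by simp
  have tr: "ntr (adj (iota_A Z V) ** (X - iota_A Z B)) = ntr (adj V ** Y) - ntr (adj V ** B)" for V B
    using Y[of "adj V"] iota_A_props(4)[of "adj V ** B"]
    by (simp add: iota_A_hom mat_mult_simps ntr_simps)
  have "cond_exp_A Z X = iota_A Z Y"
    unfolding cond_exp_A_def A
  proof (rule the_equality)
    show "iota_A Z Y \<in> range (iota_A Z) \<and> (\<forall>V\<in>range (iota_A Z). ntr (adj V ** (X - iota_A Z Y)) = 0)"
      by (auto simp: tr)
    fix B assume "B \<in> range (iota_A Z) \<and> (\<forall>V\<in>range (iota_A Z). ntr (adj V ** (X - B)) = 0)"
    then obtain B' where B: "B = iota_A Z B'" "\<And>V. ntr (adj V ** Y) = ntr (adj V ** B')"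
      by (auto simp: tr)
    have "Y = B'" by (rule ntr_eqI) (metis B(2) adj_simps(5))
    then show "B = iota_A Z Y" by (simp add: B)
  qed
  then show ?thesis using that Y by blast
qed

text \<open>Paired with an observable, both the conditional expectation and the inverse
  identification disappear.\<close>

lemma ntr_ehk:
  "ntr (V ** ehk Z S R Y) =
    ntr (iota_A Z V ** alpha Z (U_op S) (iota_A Z (gig_state Z (T_symbol S R)) ** iota_B Z Y))"
proof -
  let ?X = "alpha Z (U_op S) (iota_A Z (gig_state Z (T_symbol S R)) ** iota_B Z Y)"
  obtain B where B: "cond_exp_A Z ?X = iota_A Z B" "\<And>V. ntr (iota_A Z V ** ?X) = ntr (V ** B)"
    using cond_exp_A_iota[of ?X] by blast
  have "ehk Z S R Y = B"
    unfolding ehk_def B(1) by (rule inv_f_f) (rule bij_betw_UNIV_D(1)[OF iota_A_props(2)])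
  then show ?thesis by (simp add: B(2))
qed

end

lemma star_hom_mode_mat: "star_hom f \<Longrightarrow> f (mode_mat l z k) = mode_mat l (f z) k"
  by (cases k) (simp_all add: star_hom_simps)

lemma star_hom_mode_monomial: "star_hom f \<Longrightarrow> f (mode_monomial Z \<psi> l n g) = mode_monomial (\<lambda>\<phi>. f (Z \<phi>)) \<psi> l n g"
  by (induction n) (simp_all add: star_hom_simps star_hom_mode_mat)

lemma star_hom_gig_product:
  "star_hom f \<Longrightarrow> f (gig_product Z \<psi> \<mu>) = gig_product (\<lambda>\<phi>. f (Z \<phi>)) \<psi> \<mu>"
proof -
  assume f: "star_hom f"
  have "f (foldr (\<lambda>j M. gfactor (Z (\<psi> j)) (\<mu> j) ** M) js (mat 1)) =
      foldr (\<lambda>j M. gfactor (f (Z (\<psi> j))) (\<mu> j) ** M) js (mat 1)" for js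
    by (induction js) (simp_all add: star_hom_simps[OF f] gfactor_cscale)
  then show ?thesis by (simp add: gig_product_gfactor)
qed

text \<open>The number of field operators in the factor; each contributes one power of
  \<open>s j\<close>.\<close>

fun mode_degree :: "mode_op \<Rightarrow> nat" where
  "mode_degree Unit = 0" | "mode_degree Lower = 1" | "mode_degree Raise = 1" | "mode_degree Diag = 2"

context car_full
begin

text \<open>Modes are stripped off from the right with \<open>Y\<close> left arbitrary, because the
  \<B>-part of the stripped factor commutes with the density and is absorbed into \<open>Y\<close>.
  The occupation \<open>m j\<close> of the auxiliary state may differ from the centring
  \<open>l j\<close> only where \<open>s j = 1\<close>: there the weight \<open>c j\<close> of \<A>
  is 0.\<close>

lemma ntr_mode_monomial_ehk:
  fixes \<psi> :: "nat \<Rightarrow> complex ^ 'n" and s l m :: "nat \<Rightarrow> real"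
  assumes onb: "orthonormal_basis \<psi>"
    and S: "S = spec \<psi> (\<lambda>j. complex_of_real (s j))" and s: "\<And>j. j < CARD('n) \<Longrightarrow> 0 \<le> s j \<and> s j \<le> 1"
    and T: "T_symbol S R = spec \<psi> (\<lambda>j. complex_of_real (m j))"
    and lm: "\<And>j. j < CARD('n) \<Longrightarrow> s j = 1 \<or> m j = l j"
  shows "ntr (mode_monomial Z \<psi> l CARD('n) f ** ehk Z S R Y) =
    (\<Prod>j<CARD('n). complex_of_real (s j) ^ mode_degree (f j)) * ntr (mode_monomial Z \<psi> l CARD('n) f ** Y)"
proof -
  define c where "c j = sqrt (1 - s j * s j)" for j
  define C where "C = spec \<psi> (\<lambda>j. complex_of_real (c j))"
  let ?a = "\<lambda>j. field_A Z (\<psi> j)" and ?b = "\<lambda>j. field_B Z (\<psi> j)"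
  have ss: "0 \<le> 1 - s j * s j" if "j < CARD('n)" for j
    using s[OF that] mult_le_one[of "s j" "s j"] by simp
  have cs: "complex_of_real (c j) * complex_of_real (c j) + complex_of_real (s j) * complex_of_real (s j) = 1"
    if "j < CARD('n)" for j
    using ss[OF that] by (simp add: c_def flip: of_real_mult of_real_add)
  have aS: "adj S = S" by (simp add: S spec_adj)
  have "mat 1 - S ** S = spec \<psi> (\<lambda>j. complex_of_real (1 - s j * s j))"
    by (simp add: S spec_mult[OF onb] spec_one[OF onb, symmetric] spec_linear)
  then have sq: "op_sqrt (mat 1 - S ** S) = C"
    by (simp only: op_sqrt_spec[OF onb ss] C_def c_def)
  have U: "U_op S = block_matrix (- C) S S C"
    by (simp add: U_op_def aS sq)
  have "C ** C + S ** S = mat 1"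
    unfolding C_def S spec_mult[OF onb] spec_linear spec_one[OF onb, symmetric]
    by (rule spec_cong) (rule cs)
  then have inv: "U_op S *v (U_op S *v \<xi>) = \<xi>" "cinner (U_op S *v \<xi>) (U_op S *v \<zeta>) = cinner \<xi> \<zeta>" for \<xi> \<zeta>
    unfolding U by (intro self_adjoint_involution_block[OF aS];
        simp add: C_def spec_adj S spec_mult[OF onb] mult.commute)+
  note \<alpha> = alpha_props[of "U_op S", OF inv]
  note \<alpha>_hom = star_hom_simps[OF \<alpha>(1)]
  have Ua: "alpha Z (U_op S) (?a j) = (- complex_of_real (c j)) *\<^sub>C ?a j + complex_of_real (s j) *\<^sub>C ?b j"
    if "j < CARD('n)" for j
  proof -
    have "U_op S *v dsum (\<psi> j) 0 = dsum ((- complex_of_real (c j)) *s \<psi> j) (complex_of_real (s j) *s \<psi> j)"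
      unfolding U block_matrix_dsum
      by (simp add: C_def S spec_basis[OF onb that] spec_linear(5))
    also have "\<dots> = (- complex_of_real (c j)) *s dsum (\<psi> j) 0 + complex_of_real (s j) *s dsum 0 (\<psi> j)"
      by (simp add: vec_eq_iff dsum_def split: sum.splits)
    finally show ?thesis
      unfolding field_A_def field_B_def \<alpha>(2) by (simp only: D.Z_add D.Z_smult) simp
  qed
  \<comment> \<open>The parity of the whole double field anticommutes with the operators of both
    legs, so the dressed \<A>-modes commute with all of \<B>.\<close>
  define P where "P = W_op (double_field Z)"
  interpret A: car_modes "field_A Z" \<psi> P
    using field_A_car onb D.W_W D.W_adj D.W_star_anti
    by unfold_locales (auto simp: P_def D.W_def field_A_def)
  have ab: "star_anti (?a i) (field_B Z \<phi>)" for i \<phi>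
    unfolding field_A_def field_B_def by (rule D.Z_star_anti) (simp add: cinner_dsum cinner_simps)
  have hb: "star_comm (P ** ?a i) (field_B Z \<phi>)" for i \<phi>
    by (rule star_comm_hat[OF ab _ A.P_adj]) (use D.W_star_anti in \<open>simp add: star_anti_def P_def D.W_def field_B_def\<close>)
  have hB: "star_comm (P ** ?a i) (iota_B Z X)" for i X
    by (rule star_comm_star_algebra[OF _ iota_B_in]) (use hb in auto)
  define \<rho> where "\<rho> = gig_product (field_A Z) \<psi> m"
  have \<rho>A: "iota_A Z (gig_state Z (T_symbol S R)) = \<rho>"
  proof -
    interpret Z: car_modes Z \<psi> W by unfold_locales (rule onb W_W W_adj W_star_anti)+
    show ?thesis
      unfolding Z.gig_state_eq[OF full T] star_hom_gig_product[OF iota_A_props(1)] iota_A_props(3) \<rho>_def ..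
  qed
  have kms_\<rho>: "kms (m j) (P ** ?a j) \<rho>" if "j < CARD('n)" for j
    using A.gig_product_gaussian[of m] that by (auto simp: A.gaussian_def \<rho>_def intro: kms_hat A.P_adj)
  have "star_comm \<rho> (field_B Z \<phi>)" for \<phi>
  proof -
    have "X ** \<rho> = \<rho> ** X" if "\<And>i. star_anti (?a i) X" for X
      unfolding \<rho>_def gig_product_gfactor by (rule A.gprod_comm) (rule that)
    note c = this[OF ab] this[OF star_anti_adj[OF ab]]
    have "adj (adj (field_B Z \<phi>) ** \<rho>) = adj (\<rho> ** adj (field_B Z \<phi>))" by (simp only: c)
    then have "adj \<rho> ** field_B Z \<phi> = field_B Z \<phi> ** adj \<rho>" by simp
    with c show ?thesis by (simp add: star_comm_def)
  qed
  then have "star_comm \<rho> (iota_B Z X)" for X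
    by (intro star_comm_star_algebra[OF _ iota_B_in]) auto
  then have \<rho>B: "iota_B Z X ** \<rho> = \<rho> ** iota_B Z X" for X
    by (simp add: star_comm_def)
  \<comment> \<open>The pairing of \<open>V\<close> with the operation, after \<alpha> has been
    moved from the density onto the observable.\<close>
  define \<Omega> where "\<Omega> V Y = ntr (alpha Z (U_op S) (iota_A Z V) ** (\<rho> ** iota_B Z Y))" for V Y
  have "\<Omega> (mode_monomial Z \<psi> l n f) Y =
      (\<Prod>j<n. complex_of_real (s j) ^ mode_degree (f j)) * ntr (mode_monomial Z \<psi> l n f ** Y)"
    if "n \<le> CARD('n)" for n
    using that
  proof (induction n arbitrary: Y)
    case 0
    \<comment> \<open>Elements of \<B> commute with the dressed \<A>-modes, so the factors of \<rho>
      drop out of the trace one by one.\<close>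
    have "ntr (\<rho> ** iota_B Z Y) = ntr (iota_B Z Y)"
      unfolding \<rho>_def gig_product_gfactor by (rule A.gprod_ntr_mult) (auto intro: hB)
    then show ?case by (simp add: \<Omega>_def iota_A_hom \<alpha>_hom iota_B_props(4))
  next
    case (Suc n)
    have n: "n < CARD('n)" using Suc.prems by simp
    let ?h = "P ** ?a n" and ?q = "?a n" and ?b = "?b n" and ?z = "Z (\<psi> n)"
    define \<sigma> \<kappa> where "\<sigma> = complex_of_real (s n)" and "\<kappa> = complex_of_real (c n)"
    define M where "M = alpha Z (U_op S) (iota_A Z (mode_monomial Z \<psi> l n f))"
    \<comment> \<open>The expectation of the factor at mode \<open>n\<close>, everything else being
      fixed.\<close>
    define \<Psi> where "\<Psi> Q = ntr (M ** Q ** (\<rho> ** iota_B Z Y))" for Q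
    have \<Psi>_lin: "\<Psi> (X + X') = \<Psi> X + \<Psi> X'" "\<Psi> (X - X') = \<Psi> X - \<Psi> X'" "\<Psi> (r *\<^sub>C X) = r * \<Psi> X" for X X' r
      by (simp_all add: \<Psi>_def mat_mult_simps cscale_mult ntr_simps)
    have M_eq: "M = mode_monomial (\<lambda>\<phi>. alpha Z (U_op S) (field_A Z \<phi>)) \<psi> l n f"
      by (simp add: M_def star_hom_mode_monomial[OF iota_A_props(1)] star_hom_mode_monomial[OF \<alpha>(1)] iota_A_props(3))
    \<comment> \<open>The rotated earlier modes mix \<A>- and \<B>-operators of other indices, and
      the dressed mode \<open>n\<close> commutes with both kinds.\<close>
    have sM: "star_comm ?h M"
      unfolding M_eq
    proof (rule mode_monomial_star_comm)
      fix j assume "j < n"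
      then have j: "j < CARD('n)" and "n \<noteq> j" using n by auto
      then have "star_comm ?h (?a j)" by (intro A.psi_hat(3) n)
      then show "star_comm ?h (alpha Z (U_op S) (?a j))"
        unfolding Ua[OF j] by (intro star_comm_intros hb)
    qed
    note hf = A.psi_hat(1)[OF n] and hn = A.psi_hat(2)[OF n]
    have cyc: "\<Psi> (X ** X') = ntr (X ** (X' ** \<rho> ** iota_B Z Y ** M))" for X X'
      using ntr_commute[of M "X ** X' ** \<rho> ** iota_B Z Y"] by (simp add: \<Psi>_def matrix_mul_assoc)
    have kX: "kms (m n) ?h (X ** \<rho> ** iota_B Z Y ** M)" if "star_comm ?h X" for X
      by (intro kms_mult kms_\<rho> n that hB sM)
    have charged: "\<Psi> (?q ** X) = 0" "\<Psi> (adj ?q ** X) = 0" if "star_comm ?h X" for X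
      unfolding cyc
      by (rule number_comm_ntr[OF A.psi_fermi_mode[OF n]], use kms_number_comm[OF hf kX[OF that]] hn in simp)+
    have charged1: "\<Psi> ?q = 0" "\<Psi> (adj ?q) = 0"
      using charged[OF star_comm_intros(1)] by simp_all
    have diag: "\<kappa> = 0 \<or> \<Psi> (adj ?q ** ?q - complex_of_real (l n) *\<^sub>C mat 1) = 0"
    proof (cases "s n = 1")
      case True
      then show ?thesis by (simp add: \<kappa>_def c_def)
    next
      case False
      then have "m n = l n" using lm[OF n] by simp
      then have "\<Psi> ((adj ?q ** ?q - complex_of_real (l n) *\<^sub>C mat 1) ** mat 1) = 0"
        unfolding cyc using kms_ntr[OF hf kX[OF star_comm_intros(1)]] hn by simp
      then show ?thesis by simp
    qed
    \<comment> \<open>A factor from \<B> slides past \<rho> and turns \<open>Y\<close> into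
      \<open>X ** Y\<close>, an instance of the induction hypothesis.\<close>
    have B: "\<Psi> (iota_B Z X) = (\<Prod>j<n. complex_of_real (s j) ^ mode_degree (f j)) * ntr (mode_monomial Z \<psi> l n f ** X ** Y)"
      for X
    proof -
      have "\<Psi> (iota_B Z X) = \<Omega> (mode_monomial Z \<psi> l n f) (X ** Y)"
        unfolding \<Psi>_def \<Omega>_def M_def iota_B_hom(3)
        by (simp add: matrix_mul_assoc) (simp add: matrix_mul_assoc[symmetric, of _ "iota_B Z X" \<rho>] \<rho>B, simp add: matrix_mul_assoc)
      then show ?thesis using Suc.IH[of "X ** Y"] n by (simp add: matrix_mul_assoc)
    qed
    have qb: "star_comm ?h ?b" "star_comm ?h (adj ?b)" using hb star_comm_adj by auto
    have main: "\<Psi> (mode_mat (l n) (alpha Z (U_op S) ?q) (f n)) =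
        \<sigma> ^ mode_degree (f n) * \<Psi> (iota_B Z (mode_mat (l n) ?z (f n)))"
    proof (cases "f n")
      case Unit
      then show ?thesis by (simp add: iota_B_hom)
    next
      case Lower
      then show ?thesis
        by (simp add: Ua[OF n] \<Psi>_lin charged1 iota_B_props(3) \<sigma>_def)
    next
      case Raise
      then show ?thesis
        by (simp add: Ua[OF n] \<Psi>_lin charged1 iota_B_props(3) iota_B_hom \<sigma>_def)
    next
      case Diag
      have bq: "adj ?b ** ?q = - (?q ** adj ?b)"
        using star_anti_adj[OF ab] by (simp add: star_anti_def)
      have "mode_mat (l n) (alpha Z (U_op S) ?q) Diag =
          (\<kappa> * \<kappa>) *\<^sub>C (adj ?q ** ?q - complex_of_real (l n) *\<^sub>C mat 1)
          + (\<sigma> * \<sigma>) *\<^sub>C (adj ?b ** ?b - complex_of_real (l n) *\<^sub>C mat 1)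
          - (\<kappa> * \<sigma>) *\<^sub>C (adj ?q ** ?b) + (\<kappa> * \<sigma>) *\<^sub>C (?q ** adj ?b)"
      proof -
        \<comment> \<open>Splitting the constant by \<kappa>^2 + \<sigma>^2 = 1 centres both number
          operators with the same \<open>l n\<close>.\<close>
        have one: "complex_of_real (l n) *\<^sub>C mat 1 =
            (\<kappa> * \<kappa>) *\<^sub>C complex_of_real (l n) *\<^sub>C mat 1 + (\<sigma> * \<sigma>) *\<^sub>C complex_of_real (l n) *\<^sub>C mat 1"
          using cs[OF n] by (simp add: \<kappa>_def \<sigma>_def cscale_simps flip: cscale_left distrib_right)
        show ?thesis
          unfolding mode_mat.simps(4) Ua[OF n] \<kappa>_def[symmetric] \<sigma>_def[symmetric]
          by (subst one)
            (simp add: \<kappa>_def \<sigma>_def mat_mult_simps cscale_mult cscale_simps cscale_left bq mult_ac algebra_simps)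
      qed
      then have "\<Psi> (mode_mat (l n) (alpha Z (U_op S) ?q) Diag) =
          (\<sigma> * \<sigma>) * \<Psi> (adj ?b ** ?b - complex_of_real (l n) *\<^sub>C mat 1)"
        using diag by (auto simp: \<Psi>_lin charged[OF qb(1)] charged[OF qb(2)])
      then show ?thesis using Diag by (simp add: iota_B_hom iota_B_props(3) power2_eq_square)
    qed
    have "\<Omega> (mode_monomial Z \<psi> l (Suc n) f) Y = \<Psi> (mode_mat (l n) (alpha Z (U_op S) ?q) (f n))"
      by (simp add: \<Omega>_def \<Psi>_def M_def iota_A_hom \<alpha>_hom star_hom_mode_mat[OF iota_A_props(1)]
          star_hom_mode_mat[OF \<alpha>(1)] iota_A_props(3))
    then show ?case unfolding main B by (simp add: \<sigma>_def mult_ac)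
  qed
  from this[OF order_refl] have "\<Omega> (mode_monomial Z \<psi> l CARD('n) f) Y =
      (\<Prod>j<CARD('n). complex_of_real (s j) ^ mode_degree (f j)) * ntr (mode_monomial Z \<psi> l CARD('n) f ** Y)" .
  moreover have "ntr (V ** ehk Z S R Y) = \<Omega> V Y" for V
  proof -
    have "ntr (V ** ehk Z S R Y) = ntr (alpha Z (U_op S) (iota_A Z V ** alpha Z (U_op S) (\<rho> ** iota_B Z Y)))"
      unfolding ntr_ehk \<alpha>(3) \<rho>A ..
    then show ?thesis by (simp add: \<Omega>_def \<alpha>_hom(3) \<alpha>(4))
  qed
  ultimately show ?thesis by simp
qed

end

section \<open>The Mehler semigroup\<close>

lemma component_ntr:
  fixes X :: "complex ^ 'k ^ 'k"
  shows "X $ i $ j = ntr ((of_nat CARD('k) *\<^sub>C outer (axis j 1) (axis i 1)) ** X)"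
proof -
  have "(outer (axis j 1) (axis i 1) ** X) $ k $ k = (if k = j then X $ i $ k else 0)" for k
    by (simp add: outer_def matrix_matrix_mult_def axis_def if_distrib[of cnj] if_distrib[of "\<lambda>x. x * _"]
        if_distrib[of "\<lambda>x. _ * x"] cong: if_cong)
  then have "ntr (outer (axis j 1) (axis i 1) ** X) = X $ i $ j / of_nat CARD('k)"
    by (simp add: ntr_def trace_def)
  then show ?thesis by (simp add: cscale_mult ntr_simps)
qed

lemma tendsto_ntr_iff:
  fixes F :: "'a \<Rightarrow> complex ^ 'k ^ 'k"
  shows "(F \<longlongrightarrow> L) G \<longleftrightarrow> (\<forall>V. ((\<lambda>x. ntr (V ** F x)) \<longlongrightarrow> ntr (V ** L)) G)"
proof
  assume L: "(F \<longlongrightarrow> L) G"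
  show "\<forall>V. ((\<lambda>x. ntr (V ** F x)) \<longlongrightarrow> ntr (V ** L)) G"
    unfolding ntr_def trace_def matrix_matrix_mult_def
    by (simp, intro allI tendsto_divide tendsto_sum tendsto_mult tendsto_const tendsto_vec_nth L) simp
next
  assume "\<forall>V. ((\<lambda>x. ntr (V ** F x)) \<longlongrightarrow> ntr (V ** L)) G"
  then show "(F \<longlongrightarrow> L) G"
    by (intro vec_tendstoI) (simp only: component_ntr)
qed

text \<open>Convergence is entrywise and entries are trace pairings, which linearity reduces to a
  spanning set.\<close>

lemma tendsto_ntr_lspan:
  fixes F :: "'a \<Rightarrow> complex ^ 'k ^ 'k"
  assumes span: "\<And>V. V \<in> lspan S"
    and lim: "\<And>V. V \<in> S \<Longrightarrow> ((\<lambda>x. ntr (V ** F x)) \<longlongrightarrow> ntr (V ** L)) G"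
  shows "(F \<longlongrightarrow> L) G"
  unfolding tendsto_ntr_iff
proof
  fix V show "((\<lambda>x. ntr (V ** F x)) \<longlongrightarrow> ntr (V ** L)) G"
    using span[of V] by induction (auto simp: lim mat_mult_simps ntr_simps cscale_mult intro!: tendsto_intros)
qed

lemma convergent_ntr_lspan:
  fixes F :: "'a \<Rightarrow> complex ^ 'k ^ 'k"
  assumes span: "\<And>V. V \<in> lspan S"
    and lim: "\<And>V. V \<in> S \<Longrightarrow> \<exists>l. ((\<lambda>x. ntr (V ** F x)) \<longlongrightarrow> l) G"
  shows "\<exists>L. (F \<longlongrightarrow> L) G"
proof -
  have "\<exists>l. ((\<lambda>x. ntr (V ** F x)) \<longlongrightarrow> l) G" for V
    using span[of V]
  proof induction
    case (base X)
    then show ?case by (rule lim)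
  next
    case zero
    then show ?case by (auto simp: mat_mult_simps ntr_simps)
  next
    case (add X Y)
    then show ?case by (auto simp: mat_mult_simps ntr_simps intro: tendsto_add)
  next
    case (scale X c)
    then show ?case by (auto simp: cscale_mult ntr_simps intro: tendsto_mult_left)
  qed
  then have "\<exists>l. ((\<lambda>x. F x $ i $ j) \<longlongrightarrow> l) G" for i j by (simp only: component_ntr)
  then obtain l where l: "\<And>i j. ((\<lambda>x. F x $ i $ j) \<longlongrightarrow> l i j) G" by metis
  have "(F \<longlongrightarrow> (\<chi> i j. l i j)) G" by (intro vec_tendstoI) (simp add: l)
  then show ?thesis by blast
qed

lemma dagger_eqI:
  assumes "\<And>X Y. ntr (adj (G X) ** Y) = ntr (adj X ** F Y)"
  shows "dagger F = G"
  unfolding dagger_def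
proof (rule the_equality)
  fix G' assume G': "\<forall>X Y. ntr (adj (G' X) ** Y) = ntr (adj X ** F Y)"
  show "G' = G"
  proof
    fix X
    have "adj (G' X) = adj (G X)"
      by (rule ntr_eqI) (metis G' assms ntr_commute)
    then show "G' X = G X" by simp
  qed
qed (use assms in blast)

text \<open>Linearity is what makes the adjoint exist, so it has to be established for
  \<open>\<Phi> t\<close> and \<open>gen\<close> before their \<open>dagger\<close> can be
  computed.\<close>

lemma ntr_dagger:
  assumes "\<And>X Y. F (X + Y) = F X + F Y" "\<And>c X. F (c *\<^sub>C X) = c *\<^sub>C F X"
  shows "ntr (adj (dagger F X) ** Y) = ntr (adj X ** F Y)"
proof -
  have "\<exists>B. \<forall>Y. ntr (adj X ** F Y) = ntr (Y ** B)" for X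
    by (rule linear_functional_ntr[of "\<lambda>Y. ntr (adj X ** F Y)"])
      (auto simp: assms mat_mult_simps cscale_mult ntr_simps)
  then obtain B where B: "\<And>X Y. ntr (adj X ** F Y) = ntr (Y ** B X)" by metis
  have "dagger F = (\<lambda>X. adj (B X))"
    by (rule dagger_eqI) (simp add: B ntr_commute)
  then show ?thesis by (simp add: B ntr_commute)
qed

abbreviation rspec :: "(nat \<Rightarrow> complex ^ 'n) \<Rightarrow> (nat \<Rightarrow> real) \<Rightarrow> complex ^ 'n ^ 'n" where
  "rspec \<eta> d \<equiv> spec \<eta> (\<lambda>j. complex_of_real (d j))"

text \<open>The kernel condition makes any admissible symbol vanish on \<open>\<eta> j\<close> with
  \<open>e j = 1\<close>. For the other indices the matrix elements follow by dividing by
  \<open>c i * c j\<close>, which is nonzero there.\<close>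

lemma T_symbol_rspec:
  fixes \<eta> :: "nat \<Rightarrow> complex ^ 'n"
  assumes onb: "orthonormal_basis \<eta>"
    and e: "\<And>j. j < CARD('n) \<Longrightarrow> 0 \<le> e j \<and> e j \<le> 1"
    and l: "\<And>j. j < CARD('n) \<Longrightarrow> 0 \<le> l j \<and> l j \<le> 1"
  shows "T_symbol (rspec \<eta> e) (rspec \<eta> (\<lambda>j. (1 - e j * e j) * l j)) =
    rspec \<eta> (\<lambda>j. if e j = 1 then 0 else l j)"
proof -
  define m where "m j = (if e j = 1 then 0 else l j)" for j
  define c where "c j = sqrt (1 - e j * e j)" for j
  let ?S = "rspec \<eta> e" and ?R = "rspec \<eta> (\<lambda>j. (1 - e j * e j) * l j)"
  have ee: "0 \<le> 1 - e j * e j" if "j < CARD('n)" for j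
    using e[OF that] mult_le_one[of "e j" "e j"] by simp
  have cc: "c j * c j = 1 - e j * e j" if "j < CARD('n)" for j
    using ee[OF that] by (simp add: c_def)
  have c0: "c j = 0 \<longleftrightarrow> e j = 1" if "j < CARD('n)" for j
    using e[OF that] by (auto simp: c_def abs_square_eq_1 square_eq_1_iff)
  have D: "mat 1 - ?S ** adj ?S = rspec \<eta> (\<lambda>j. 1 - e j * e j)"
    by (simp add: spec_adj spec_mult[OF onb] spec_one[OF onb, symmetric] spec_linear)
  have sq: "op_sqrt (mat 1 - ?S ** adj ?S) = rspec \<eta> c"
    unfolding D c_def by (rule op_sqrt_spec[OF onb ee])
  have sp: "cinner (\<eta> j) (spec \<eta> d *v v) = d j * cinner (\<eta> j) v" if "j < CARD('n)" for d v j
    using cinner_adj[of "spec \<eta> d" "\<eta> j" v] by (simp add: spec_adj spec_basis[OF onb that] cinner_simps)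
  have "T_symbol ?S ?R = rspec \<eta> m"
    unfolding T_symbol_def sq unfolding D
  proof (rule the_equality)
    have "0 \<preceq> rspec \<eta> m" unfolding op_le_def using l by (simp add: m_def psd_spec[OF onb])
    moreover have "rspec \<eta> m \<preceq> mat 1"
    proof -
      have M: "mat 1 - rspec \<eta> m = rspec \<eta> (\<lambda>j. 1 - m j)"
        by (simp add: spec_one[OF onb, symmetric] spec_linear)
      show ?thesis unfolding op_le_def M by (rule psd_spec[OF onb]) (use l in \<open>simp add: m_def\<close>)
    qed
    moreover have "op_ker (rspec \<eta> (\<lambda>j. 1 - e j * e j)) \<subseteq> op_ker (rspec \<eta> m)"
    proof
      fix v assume "v \<in> op_ker (rspec \<eta> (\<lambda>j. 1 - e j * e j))"
      then have v: "rspec \<eta> (\<lambda>j. 1 - e j * e j) *v v = 0" by (simp add: op_ker_def)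
      have "rspec \<eta> m *v v = 0"
      proof (rule onb_cinner_eqI[OF onb])
        fix j assume j: "j < CARD('n)"
        have "complex_of_real (1 - e j * e j) * cinner (\<eta> j) v = 0"
          using sp[OF j, of "\<lambda>j. complex_of_real (1 - e j * e j)" v] v by (simp add: cinner_simps)
        then have "e j = 1 \<or> cinner (\<eta> j) v = 0"
          using c0[OF j] cc[OF j] by (metis mult_eq_0_iff of_real_eq_0_iff)
        then show "cinner (\<eta> j) (rspec \<eta> m *v v) = cinner (\<eta> j) 0"
          by (auto simp: sp[OF j] m_def cinner_simps)
      qed
      then show "v \<in> op_ker (rspec \<eta> m)" by (simp add: op_ker_def)
    qed
    moreover have "?R = rspec \<eta> c ** rspec \<eta> m ** rspec \<eta> c"
      unfolding spec_mult[OF onb]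
    proof (rule spec_cong)
      fix j assume j: "j < CARD('n)"
      have "complex_of_real (c j) * complex_of_real (m j) * complex_of_real (c j) =
          complex_of_real (c j * c j * m j)" by (simp add: mult_ac)
      then show "complex_of_real ((1 - e j * e j) * l j) =
          complex_of_real (c j) * complex_of_real (m j) * complex_of_real (c j)"
        by (simp only: cc[OF j]) (simp add: m_def)
    qed
    ultimately show "0 \<preceq> rspec \<eta> m \<and> rspec \<eta> m \<preceq> mat 1 \<and>
        op_ker (rspec \<eta> (\<lambda>j. 1 - e j * e j)) \<subseteq> op_ker (rspec \<eta> m) \<and>
        ?R = rspec \<eta> c ** rspec \<eta> m ** rspec \<eta> c" by blast
  next
    fix Q assume Q: "0 \<preceq> Q \<and> Q \<preceq> mat 1 \<and> op_ker (rspec \<eta> (\<lambda>j. 1 - e j * e j)) \<subseteq> op_ker Q \<and>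
        ?R = rspec \<eta> c ** Q ** rspec \<eta> c"
    then have Qa: "adj Q = Q" by (intro psd_imp_adj) (simp add: op_le_def)
    have Q0: "Q *v \<eta> j = 0" if "j < CARD('n)" "e j = 1" for j
    proof -
      have "\<eta> j \<in> op_ker (rspec \<eta> (\<lambda>j. 1 - e j * e j))"
        using that by (simp add: op_ker_def spec_basis[OF onb])
      then show ?thesis using Q by (auto simp: op_ker_def)
    qed
    show "Q = rspec \<eta> m"
    proof (rule spec_eqI[OF onb], rule onb_cinner_eqI[OF onb])
      fix i j assume j: "j < CARD('n)" and i: "i < CARD('n)"
      show "cinner (\<eta> i) (Q *v \<eta> j) = cinner (\<eta> i) (complex_of_real (m j) *s \<eta> j)"
      proof (cases "e i = 1 \<or> e j = 1")
        case True
        moreover have "cinner (\<eta> i) (Q *v \<eta> j) = cinner (Q *v \<eta> i) (\<eta> j)"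
          using cinner_adj[of Q "\<eta> i" "\<eta> j"] by (simp add: Qa)
        ultimately show ?thesis
          using Q0[OF i] Q0[OF j] by (auto simp: cinner_simps onb_cinner[OF onb i j] m_def)
      next
        case False
        then have nz: "complex_of_real (c i) \<noteq> 0" "complex_of_real (c j) \<noteq> 0"
          using c0[OF i] c0[OF j] by simp_all
        have "complex_of_real (c i) * complex_of_real (c j) * cinner (\<eta> i) (Q *v \<eta> j) =
            cinner (\<eta> i) ((rspec \<eta> c ** Q ** rspec \<eta> c) *v \<eta> j)"
          by (simp add: matrix_vector_mul_assoc[symmetric] sp[OF i] spec_basis[OF onb j] mult_vec_smult
              cinner_simps)
        also have "rspec \<eta> c ** Q ** rspec \<eta> c = ?R" using Q by simp
        also have "cinner (\<eta> i) (?R *v \<eta> j) = (if i = j then complex_of_real (c j * c j * l j) else 0)"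
          by (simp only: cc[OF j]) (simp add: spec_basis[OF onb j] cinner_simps onb_cinner[OF onb i j])
        finally show ?thesis
          using nz False by (auto simp: cinner_simps onb_cinner[OF onb i j] m_def)
      qed
    qed
  qed
  then show ?thesis by (simp add: m_def[abs_def])
qed

section \<open>The semigroup in a common eigenbasis of \<open>H\<close> and \<open>A\<close>\<close>

locale mehler = car_full Z for Z :: "complex ^ 'n \<Rightarrow> complex ^ 'k ^ 'k" +
  fixes \<eta> :: "nat \<Rightarrow> complex ^ 'n" and h a :: "nat \<Rightarrow> real"
  assumes onb: "orthonormal_basis \<eta>"
    and ha: "\<And>j. j < CARD('n) \<Longrightarrow> 0 \<le> a j \<and> a j \<le> 2 * h j"
begin

abbreviation "H \<equiv> rspec \<eta> h"
abbreviation "A \<equiv> rspec \<eta> a"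

text \<open>Division by zero returns 0, so this is the eigenvalue of \<open>T\<close> on the kernel of \<open>H\<close> as well.\<close>

definition "lam j = a j / (2 * h j)"

abbreviation "T \<equiv> rspec \<eta> lam"

text \<open>The second identity survives \<open>h j = 0\<close>, since the bounds then force
  \<open>a j = 0\<close>.\<close>

lemma lam: assumes "j < CARD('n)" shows "0 \<le> lam j \<and> lam j \<le> 1" "2 * h j * lam j = a j" "0 \<le> h j"
  using ha[OF assms] by (auto simp: lam_def divide_le_eq)

sublocale modes: car_modes Z \<eta> W
  by unfold_locales (rule onb W_W W_adj W_star_anti)+

abbreviation "\<rho>T \<equiv> gig_product Z \<eta> lam"
abbreviation "mon f \<equiv> mode_monomial Z \<eta> lam CARD('n) f"

lemma op_exp_H: "op_exp (r *\<^sub>R H) = rspec \<eta> (\<lambda>j. exp (r * h j))"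
  by (simp add: spec_linear op_exp_spec[OF onb] exp_of_real flip: of_real_mult)

text \<open>The operator (1 - exp (- 2 t H)) T in the eigenbasis, with the exponential written as a
  product to fit \<open>T_symbol_rspec\<close>.\<close>

definition "R t = rspec \<eta> (\<lambda>j. (1 - exp (- t * h j) * exp (- t * h j)) * lam j)"

lemma R_eq: "(mat 1 - op_exp ((- 2 * t) *\<^sub>R H)) ** T = R t"
proof -
  have "exp (- 2 * t * h j) = exp (- t * h j) * exp (- t * h j)" for j
    by (simp flip: exp_add)
  then show ?thesis
    unfolding op_exp_H R_def
    by (simp add: spec_one[OF onb, symmetric] spec_linear spec_mult[OF onb])
qed

text \<open>\<open>R\<close> is an antiderivative of the integrand: its derivative has eigenvalues 2
  h_j \<lambda>_j exp (- 2 s h_j), and 2 h_j \<lambda>_j = a_j.\<close>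

lemma R_op_eq: assumes "0 \<le> t" shows "R_op H A t = R t"
proof -
  have "((\<lambda>s. op_exp ((- s) *\<^sub>R H) ** A ** op_exp ((- s) *\<^sub>R H)) has_integral R t - R 0) {0..t}"
  proof (rule fundamental_theorem_of_calculus[OF assms])
    fix s assume "s \<in> {0..t}"
    have e: "op_exp ((- s) *\<^sub>R H) ** A ** op_exp ((- s) *\<^sub>R H) =
        rspec \<eta> (\<lambda>j. exp (- s * h j) * a j * exp (- s * h j))"
      unfolding op_exp_H spec_mult[OF onb] by simp
    have R: "R = (\<lambda>s. \<Sum>j<CARD('n). ((1 - exp (- s * h j) * exp (- s * h j)) * lam j) *\<^sub>R outer (\<eta> j) (\<eta> j))"
      by (simp add: fun_eq_iff R_def spec_def scaleR_cscale)
    have "((\<lambda>s. (1 - exp (- s * h j) * exp (- s * h j)) * lam j) has_vector_derivative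
        exp (- s * h j) * a j * exp (- s * h j)) (at s within {0..t})" if "j < CARD('n)" for j
      unfolding lam(2)[OF that, symmetric] has_real_derivative_iff_has_vector_derivative[symmetric]
      by (auto intro!: derivative_eq_intros)
    then have "((\<lambda>s. ((1 - exp (- s * h j) * exp (- s * h j)) * lam j) *\<^sub>R outer (\<eta> j) (\<eta> j)) has_vector_derivative
        (exp (- s * h j) * a j * exp (- s * h j)) *\<^sub>R outer (\<eta> j) (\<eta> j)) (at s within {0..t})"
      if "j < CARD('n)" for j
      using bounded_linear.has_vector_derivative[OF bounded_linear_scaleR_left] that by blast
    then have "(R has_vector_derivative
        (\<Sum>j<CARD('n). (exp (- s * h j) * a j * exp (- s * h j)) *\<^sub>R outer (\<eta> j) (\<eta> j))) (at s within {0..t})"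
      unfolding R by (intro has_vector_derivative_sum) auto
    then show "(R has_vector_derivative op_exp ((- s) *\<^sub>R H) ** A ** op_exp ((- s) *\<^sub>R H)) (at s within {0..t})"
      unfolding e by (simp only: spec_def scaleR_cscale)
  qed
  moreover have "R 0 = 0" by (simp add: R_def spec_def cscale_simps)
  ultimately show ?thesis by (simp add: R_op_def integral_unique)
qed

text \<open>In the eigenbasis the regularized expression is a_j / (2 h_j + \<epsilon>). Where
  \<open>h j = 0\<close> the numerator is 0 too, so the limit there is 0.\<close>

lemma T_limit_eq: "T_limit H A = T"
proof -
  have "\<forall>\<^sub>F \<epsilon> in at_right 0. rspec \<eta> (\<lambda>j. a j / (2 * h j + \<epsilon>)) =
      matrix_inv (op_sqrt (2 *\<^sub>R H + \<epsilon> *\<^sub>R mat 1)) ** A ** matrix_inv (op_sqrt (2 *\<^sub>R H + \<epsilon> *\<^sub>R mat 1))"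
    using eventually_at_right_less[of 0]
  proof eventually_elim
    case (elim \<epsilon>)
    have pos: "0 < 2 * h j + \<epsilon>" if "j < CARD('n)" for j using lam(3)[OF that] elim by simp
    have "2 *\<^sub>R H + \<epsilon> *\<^sub>R mat 1 = rspec \<eta> (\<lambda>j. 2 * h j + \<epsilon>)"
      by (simp add: spec_one[OF onb, symmetric] spec_linear)
    then have "op_sqrt (2 *\<^sub>R H + \<epsilon> *\<^sub>R mat 1) = rspec \<eta> (\<lambda>j. sqrt (2 * h j + \<epsilon>))"
      using op_sqrt_spec[OF onb, of "\<lambda>j. 2 * h j + \<epsilon>"] pos by (simp add: less_imp_le)
    moreover have "matrix_inv (rspec \<eta> (\<lambda>j. sqrt (2 * h j + \<epsilon>))) =
        spec \<eta> (\<lambda>j. inverse (complex_of_real (sqrt (2 * h j + \<epsilon>))))"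
      by (rule matrix_inv_spec[OF onb]) (use pos in force)
    moreover have "a j / (2 * h j + \<epsilon>) = inverse (sqrt (2 * h j + \<epsilon>)) * a j * inverse (sqrt (2 * h j + \<epsilon>))"
      if "j < CARD('n)" for j
    proof -
      have "inverse (2 * h j + \<epsilon>) = inverse (sqrt (2 * h j + \<epsilon>)) * inverse (sqrt (2 * h j + \<epsilon>))"
        using pos[OF that] by (simp flip: inverse_mult_distrib)
      then show ?thesis by (simp add: divide_inverse)
    qed
    ultimately show ?case
      by (simp only: spec_mult[OF onb] of_real_inverse[symmetric] of_real_mult[symmetric] cong: spec_cong)
  qed
  moreover have "((\<lambda>\<epsilon>. rspec \<eta> (\<lambda>j. a j / (2 * h j + \<epsilon>))) \<longlongrightarrow> T) (at_right 0)"
  proof (rule tendsto_spec[OF onb], rule tendsto_of_real)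
    fix j assume j: "j < CARD('n)"
    show "((\<lambda>\<epsilon>. a j / (2 * h j + \<epsilon>)) \<longlongrightarrow> lam j) (at_right 0)"
    proof (cases "h j = 0")
      case True
      then have "a j = 0" using ha[OF j] by simp
      then show ?thesis by (simp add: lam_def)
    next
      case False
      have "((\<lambda>\<epsilon>. a j / (2 * h j + \<epsilon>)) \<longlongrightarrow> a j / (2 * h j + 0)) (at_right 0)"
        by (intro tendsto_intros) (use False in simp)
      then show ?thesis by (simp add: lam_def)
    qed
  qed
  ultimately show ?thesis
    unfolding T_limit_def by (intro tendsto_Lim) (auto elim: Lim_transform_eventually)
qed

text \<open>The candidate from the claim, kept apart from the power series until both are seen to
  have the same pairings with the monomials.\<close>

definition "\<Phi> t = ehk Z (op_exp ((- t) *\<^sub>R H)) (R t)"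

definition "rate f = (\<Sum>j<CARD('n). real (mode_degree (f j)) * h j)"

lemma ntr_mon_\<Phi>:
  assumes "0 \<le> t"
  shows "ntr (mon f ** \<Phi> t Y) = complex_of_real (exp (- t * rate f)) * ntr (mon f ** Y)"
proof -
  have e: "0 \<le> exp (- t * h j) \<and> exp (- t * h j) \<le> 1" if "j < CARD('n)" for j
    using assms lam(3)[OF that] by simp
  \<comment> \<open>The value 0 occurs when \<open>t = 0\<close> or \<open>h j = 0\<close>; the
    exponential is then 1, as the exception in the hypothesis on occupations requires.\<close>
  have Tsym: "T_symbol (op_exp ((- t) *\<^sub>R H)) (R t) =
      rspec \<eta> (\<lambda>j. if exp (- t * h j) = 1 then 0 else lam j)"
    unfolding op_exp_H R_def by (rule T_symbol_rspec[OF onb e lam(1)])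
  have "ntr (mon f ** \<Phi> t Y) =
      (\<Prod>j<CARD('n). complex_of_real (exp (- t * h j)) ^ mode_degree (f j)) * ntr (mon f ** Y)"
    unfolding \<Phi>_def
    by (rule ntr_mode_monomial_ehk[OF onb op_exp_H e Tsym]) simp_all
  also have "(\<Prod>j<CARD('n). complex_of_real (exp (- t * h j)) ^ mode_degree (f j)) =
      complex_of_real (exp (- t * rate f))"
    by (simp add: rate_def sum_distrib_left exp_sum mult_ac flip: exp_of_nat_mult of_real_power of_real_prod)
  finally show ?thesis .
qed

lemma mon_span: "V \<in> lspan (range (\<lambda>f. mon f))"
  using modes.mode_monomial_span[OF full, of V lam] by simp

lemmas mon_eqI = modes.ntr_mode_monomial_eqI[OF full, of lam]

lemma \<Phi>_linear:
  assumes "0 \<le> t"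
  shows "\<Phi> t (X + Y) = \<Phi> t X + \<Phi> t Y" "\<Phi> t (c *\<^sub>C X) = c *\<^sub>C \<Phi> t X"
  by (rule mon_eqI; simp add: ntr_mon_\<Phi>[OF assms] mat_mult_simps cscale_mult ntr_simps algebra_simps)+

text \<open>Each pairing is a scalar exponential with derivative \<open>- rate f\<close> at 0, and
  since the monomials span, the difference quotient itself converges.\<close>

lemma generator_exists:
  "\<exists>L. ((\<lambda>t. (1 / t) *\<^sub>R (\<Phi> t Y - Y)) \<longlongrightarrow> L) (at_right 0) \<and>
    (\<forall>f. ntr (mon f ** L) = - complex_of_real (rate f) * ntr (mon f ** Y))"
proof -
  have lim: "((\<lambda>t. ntr (mon f ** ((1 / t) *\<^sub>R (\<Phi> t Y - Y)))) \<longlongrightarrow>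
      - complex_of_real (rate f) * ntr (mon f ** Y)) (at_right 0)" for f
  proof -
    have "((\<lambda>t. exp (- t * rate f)) has_real_derivative - rate f) (at 0)"
      by (auto intro!: derivative_eq_intros)
    then have "((\<lambda>t. (exp (- t * rate f) - 1) / t) \<longlongrightarrow> - rate f) (at_right 0)"
      by (simp add: has_field_derivative_iff filterlim_at_split)
    then have "((\<lambda>t. complex_of_real ((exp (- t * rate f) - 1) / t) * ntr (mon f ** Y)) \<longlongrightarrow>
        complex_of_real (- rate f) * ntr (mon f ** Y)) (at_right 0)"
      by (intro tendsto_mult_right tendsto_of_real)
    moreover have "\<forall>\<^sub>F t in at_right 0. complex_of_real ((exp (- t * rate f) - 1) / t) * ntr (mon f ** Y) =
        ntr (mon f ** ((1 / t) *\<^sub>R (\<Phi> t Y - Y)))"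
      using eventually_at_right_less[of 0]
    proof eventually_elim
      case (elim t)
      then show ?case
        by (simp add: scaleR_cscale mat_mult_simps cscale_mult ntr_simps ntr_mon_\<Phi> field_simps)
    qed
    ultimately show ?thesis by (simp add: Lim_transform_eventually)
  qed
  have "\<exists>L. ((\<lambda>t. (1 / t) *\<^sub>R (\<Phi> t Y - Y)) \<longlongrightarrow> L) (at_right 0)"
    by (rule convergent_ntr_lspan[OF mon_span]) (use lim in blast)
  then obtain L where L: "((\<lambda>t. (1 / t) *\<^sub>R (\<Phi> t Y - Y)) \<longlongrightarrow> L) (at_right 0)" by blast
  have "ntr (mon f ** L) = - complex_of_real (rate f) * ntr (mon f ** Y)" for f
    using L[unfolded tendsto_ntr_iff] lim[of f] by (blast intro: tendsto_unique[OF trivial_limit_at_right_real])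
  with L show ?thesis by blast
qed

text \<open>The derivative of \<open>\<Phi>\<close> itself. In the definitions the generator is the
  adjoint of a limit of adjoints, and both layers are compared with this map.\<close>

definition "gen Y = (SOME L. ((\<lambda>t. (1 / t) *\<^sub>R (\<Phi> t Y - Y)) \<longlongrightarrow> L) (at_right 0) \<and>
    (\<forall>f. ntr (mon f ** L) = - complex_of_real (rate f) * ntr (mon f ** Y)))"

lemma gen: "((\<lambda>t. (1 / t) *\<^sub>R (\<Phi> t Y - Y)) \<longlongrightarrow> gen Y) (at_right 0)"
    "ntr (mon f ** gen Y) = - complex_of_real (rate f) * ntr (mon f ** Y)"
  using someI_ex[OF generator_exists[of Y]] unfolding gen_def by blast+

lemma gen_linear: "gen (X + Y) = gen X + gen Y" "gen (c *\<^sub>C X) = c *\<^sub>C gen X"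
  by (rule mon_eqI; simp add: gen(2) mat_mult_simps cscale_mult ntr_simps algebra_simps)+

text \<open>Pairings of \<open>dagger (\<Phi> t) X\<close> are conjugates of pairings of
  \<open>adj X\<close> with \<open>\<Phi> t\<close>, so the limit passes to adjoints.
  \<open>R_op\<close> is identified with \<open>R\<close> for nonnegative times, which suffices for
  a limit from the right.\<close>

lemma mehler_gen_dagger_eq: "mehler_gen_dagger Z H A = dagger gen"
proof
  fix X
  have flip: "ntr (V ** Y) = cnj (ntr (adj Y ** adj V))" for V Y :: "complex ^ 'k ^ 'k"
    by (simp flip: adj_mult add: ntr_adj)
  have "((\<lambda>t. (1 / t) *\<^sub>R (dagger (\<Phi> t) X - X)) \<longlongrightarrow> dagger gen X) (at_right 0)"
    unfolding tendsto_ntr_iff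
  proof
    fix V
    have "((\<lambda>t. cnj (ntr (adj X ** ((1 / t) *\<^sub>R (\<Phi> t (adj V) - adj V))))) \<longlongrightarrow>
        cnj (ntr (adj X ** gen (adj V)))) (at_right 0)"
      using gen(1)[of "adj V"] unfolding tendsto_ntr_iff by (intro tendsto_cnj) blast
    moreover have "\<forall>\<^sub>F t in at_right 0. cnj (ntr (adj X ** ((1 / t) *\<^sub>R (\<Phi> t (adj V) - adj V)))) =
        ntr (V ** ((1 / t) *\<^sub>R (dagger (\<Phi> t) X - X)))"
      using eventually_at_right_less[of 0]
    proof eventually_elim
      case (elim t)
      then have "ntr (adj (dagger (\<Phi> t) X) ** adj V) = ntr (adj X ** \<Phi> t (adj V))"
        by (intro ntr_dagger \<Phi>_linear) auto
      then show ?case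
        unfolding flip[of V] by (simp add: scaleR_cscale mat_mult_simps cscale_mult ntr_simps)
    qed
    moreover have "cnj (ntr (adj X ** gen (adj V))) = ntr (V ** dagger gen X)"
      unfolding flip[of V] using ntr_dagger[of gen X "adj V"] gen_linear by simp
    ultimately show "((\<lambda>t. ntr (V ** ((1 / t) *\<^sub>R (dagger (\<Phi> t) X - X)))) \<longlongrightarrow> ntr (V ** dagger gen X)) (at_right 0)"
      by (simp add: Lim_transform_eventually)
  qed
  moreover have "\<forall>\<^sub>F t in at_right 0. (1 / t) *\<^sub>R (dagger (\<Phi> t) X - X) =
      (1 / t) *\<^sub>R (dagger (ehk Z (op_exp ((- t) *\<^sub>R H)) (R_op H A t)) X - X)"
    using eventually_at_right_less[of 0] by eventually_elim (simp add: R_op_eq \<Phi>_def)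
  ultimately show "mehler_gen_dagger Z H A X = dagger gen X"
    unfolding mehler_gen_dagger_def by (intro tendsto_Lim) (auto elim: Lim_transform_eventually)
qed

lemma mehler_gen_eq: "mehler_gen Z H A = gen"
  unfolding mehler_gen_def mehler_gen_dagger_eq
proof (rule dagger_eqI)
  fix X Y
  have "ntr (adj (gen X) ** Y) = cnj (ntr (adj Y ** gen X))"
    by (simp flip: ntr_adj)
  also have "ntr (adj Y ** gen X) = ntr (adj (dagger gen Y) ** X)"
    using ntr_dagger[of gen Y X] gen_linear by simp
  also have "cnj \<dots> = ntr (adj X ** dagger gen Y)" by (simp flip: ntr_adj)
  finally show "ntr (adj (gen X) ** Y) = ntr (adj X ** dagger gen Y)" .
qed

text \<open>Paired with a monomial, the power series becomes the scalar exponential series at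
  \<open>- t * rate f\<close>.\<close>

lemma mehler_semigroup_eq: assumes "0 \<le> t" shows "mehler_semigroup Z H A t = \<Phi> t"
proof
  fix Y
  have pow: "ntr (mon f ** (gen ^^ m) Y) = (- complex_of_real (rate f)) ^ m * ntr (mon f ** Y)" for f m
    by (induction m) (simp_all add: gen(2))
  have "(\<lambda>m. (t ^ m / fact m) *\<^sub>R ((gen ^^ m) Y)) sums \<Phi> t Y"
    unfolding sums_def
  proof (rule tendsto_ntr_lspan[OF mon_span])
    fix V assume "V \<in> range (\<lambda>f. mon f)"
    then obtain f where V: "V = mon f" by blast
    have "(\<lambda>m. (- (t * rate f)) ^ m / fact m) sums exp (- (t * rate f))"
      using exp_converges[of "- (t * rate f)"] by (simp add: divide_inverse mult.commute)
    then have "(\<lambda>m. complex_of_real ((- (t * rate f)) ^ m / fact m) * ntr (mon f ** Y)) sums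
        (complex_of_real (exp (- (t * rate f))) * ntr (mon f ** Y))"
      by (intro sums_mult2) (simp only: sums_of_real_iff)
    moreover have "ntr (mon f ** (\<Sum>m<M. (t ^ m / fact m) *\<^sub>R ((gen ^^ m) Y))) =
        (\<Sum>m<M. complex_of_real ((- (t * rate f)) ^ m / fact m) * ntr (mon f ** Y))" for M
      by (simp add: mat_mult_sum ntr_sum scaleR_cscale cscale_mult ntr_simps pow power_mult_distrib
          power_minus[of "t * rate f"] power_minus[of "complex_of_real (rate f)"] mult_ac)
    ultimately show "(\<lambda>M. ntr (V ** (\<Sum>m<M. (t ^ m / fact m) *\<^sub>R ((gen ^^ m) Y)))) \<longlonglongrightarrow> ntr (V ** \<Phi> t Y)"
      by (simp add: V ntr_mon_\<Phi>[OF assms] sums_def)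
  qed
  then show "mehler_semigroup Z H A t Y = \<Phi> t Y"
    unfolding mehler_semigroup_def mehler_gen_eq by (rule sums_unique[symmetric])
qed

lemma gig_state_T: "gig_state Z T = \<rho>T"
  by (rule modes.gig_state_eq[OF full refl])

text \<open>Moving one adjoint across reduces the claim to detailed balance: \<open>\<Phi> t\<close>
  and \<open>dagger (\<Phi> t)\<close> are intertwined by right multiplication with \<rho>_T. On a
  pair of monomials either both sides vanish by orthogonality or the two rates agree.\<close>

lemma gns_selfadjoint:
  assumes t: "0 \<le> t"
  shows "gns_inner \<rho>T (dagger (\<Phi> t) X) Y = gns_inner \<rho>T X (dagger (\<Phi> t) Y)"
proof -
  have dag: "ntr (adj (dagger (\<Phi> t) X) ** Y) = ntr (adj X ** \<Phi> t Y)" for X Y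
    by (rule ntr_dagger) (rule \<Phi>_linear[OF t])+
  \<comment> \<open>The eigenvalue is real, so passing to the adjoint introduces no
    conjugate.\<close>
  have dag_mon: "dagger (\<Phi> t) (adj (mon g)) = complex_of_real (exp (- t * rate g)) *\<^sub>C adj (mon g)" for g
  proof -
    have "adj (dagger (\<Phi> t) (adj (mon g))) = complex_of_real (exp (- t * rate g)) *\<^sub>C mon g"
      by (rule ntr_eqI) (subst ntr_commute, subst (2) ntr_commute,
          simp add: dag ntr_mon_\<Phi>[OF t] cscale_mult ntr_simps)
    then have "adj (adj (dagger (\<Phi> t) (adj (mon g)))) = adj (complex_of_real (exp (- t * rate g)) *\<^sub>C mon g)"
      by (simp only:)
    then show ?thesis by simp
  qed
  have dag_lin: "dagger (\<Phi> t) (X + Y) = dagger (\<Phi> t) X + dagger (\<Phi> t) Y"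
    "dagger (\<Phi> t) (c *\<^sub>C X) = c *\<^sub>C dagger (\<Phi> t) X" for X Y c
  proof -
    have "adj (dagger (\<Phi> t) (X + Y)) = adj (dagger (\<Phi> t) X + dagger (\<Phi> t) Y)"
      by (rule ntr_eqI) (subst ntr_commute, subst (2) ntr_commute, simp add: dag mat_mult_simps ntr_simps)
    then show "dagger (\<Phi> t) (X + Y) = dagger (\<Phi> t) X + dagger (\<Phi> t) Y" by (simp only: adj_eq_iff)
    have "adj (dagger (\<Phi> t) (c *\<^sub>C X)) = adj (c *\<^sub>C dagger (\<Phi> t) X)"
      by (rule ntr_eqI) (subst ntr_commute, subst (2) ntr_commute, simp add: dag cscale_mult ntr_simps)
    then show "dagger (\<Phi> t) (c *\<^sub>C X) = c *\<^sub>C dagger (\<Phi> t) X" by (simp only: adj_eq_iff)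
  qed
  \<comment> \<open>Stated with \<open>adj Y\<close> because orthogonality pairs a monomial with the
    adjoint of a monomial.\<close>
  have main: "ntr (V ** \<Phi> t (adj Y ** \<rho>T)) = ntr (V ** (dagger (\<Phi> t) (adj Y) ** \<rho>T))" for V Y
    using mon_span[of V]
  proof induction
    case (base V)
    then obtain f where V: "V = mon f" by blast
    show ?case using mon_span[of Y]
    proof induction
      case (base Y)
      then obtain g where Y: "Y = mon g" by blast
      show ?case
      proof (cases "\<exists>j<CARD('n). f j \<noteq> g j")
        case True
        then have "ntr (mon f ** adj (mon g) ** \<rho>T) = 0"
          by (intro modes.gaussian_orthogonal[OF modes.gig_product_gaussian]) auto
        then show ?thesis
          by (simp add: V Y ntr_mon_\<Phi>[OF t] dag_mon cscale_mult ntr_simps matrix_mul_assoc)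
      next
        case False
        then have "rate f = rate g" by (simp add: rate_def)
        then show ?thesis by (simp add: V Y ntr_mon_\<Phi>[OF t] dag_mon cscale_mult ntr_simps)
      qed
    next
      case zero
      show ?case using \<Phi>_linear(2)[OF t, of 0 0] dag_lin(2)[of 0 0]
        by (simp add: cscale_simps mat_mult_simps)
    qed (simp_all add: mat_mult_simps cscale_mult \<Phi>_linear[OF t] dag_lin ntr_simps)
  qed (simp_all add: mat_mult_simps cscale_mult ntr_simps)
  have "gns_inner \<rho>T (dagger (\<Phi> t) X) Y = ntr (adj X ** \<Phi> t (Y ** \<rho>T))"
    by (simp add: gns_inner_def dag flip: matrix_mul_assoc)
  also have "\<dots> = gns_inner \<rho>T X (dagger (\<Phi> t) Y)"
    using main[of "adj X" "adj Y"] by (simp add: gns_inner_def flip: matrix_mul_assoc)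
  finally show ?thesis .
qed

lemma gig_state_is_state: "is_state \<rho>T"
  using modes.gig_product_gaussian[of lam] modes.gig_product_psd[of lam] lam(1)
  by (auto simp: is_state_def modes.gaussian_def)

lemma ntr_mon_\<rho>T: "ntr (mon f ** \<rho>T) = (if \<forall>j<CARD('n). f j = Unit then 1 else 0)"
  by (rule modes.gaussian_mode_monomial[OF modes.gig_product_gaussian])

text \<open>Every pairing with \<rho>_T vanishes except that of the constant monomial, whose rate is
  0.\<close>

lemma \<Phi>_\<rho>T: assumes "0 \<le> t" shows "\<Phi> t \<rho>T = \<rho>T"
  by (rule mon_eqI) (simp add: ntr_mon_\<Phi>[OF assms] ntr_mon_\<rho>T rate_def)

lemma \<Phi>_tendsto:
  assumes pos: "\<And>j. j < CARD('n) \<Longrightarrow> 0 < h j" and \<rho>: "is_state \<rho>"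
  shows "((\<lambda>t. \<Phi> t \<rho>) \<longlongrightarrow> \<rho>T) at_top"
proof (rule tendsto_ntr_lspan[OF mon_span])
  fix V assume "V \<in> range (\<lambda>f. mon f)"
  then obtain f where V: "V = mon f" by blast
  have ev: "\<forall>\<^sub>F t in at_top. complex_of_real (exp (- t * rate f)) * ntr (mon f ** \<rho>) = ntr (V ** \<Phi> t \<rho>)"
    using eventually_ge_at_top[of 0] by eventually_elim (simp add: V ntr_mon_\<Phi>)
  have "((\<lambda>t. complex_of_real (exp (- t * rate f)) * ntr (mon f ** \<rho>)) \<longlongrightarrow> ntr (V ** \<rho>T)) at_top"
  proof (cases "\<forall>j<CARD('n). f j = Unit")
    case True
    then have "mon f = mat 1" by (intro mode_monomial_Unit) auto
    moreover have "rate f = 0" using True by (simp add: rate_def)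
    ultimately show ?thesis using \<rho> ntr_mon_\<rho>T[of f] True by (simp add: V is_state_def)
  next
    case False
    then obtain j where j: "j < CARD('n)" "f j \<noteq> Unit" by blast
    then have "0 < real (mode_degree (f j)) * h j" using pos by (cases "f j") auto
    then have r: "0 < rate f"
      unfolding rate_def using j lam(3) by (intro sum_pos2[of _ j]) auto
    have "LIM t at_top. - t * rate f :> at_bot"
      using r by (simp add: filterlim_uminus_at_bot filterlim_at_top_mult_tendsto_pos[OF tendsto_const]
          filterlim_ident mult.commute)
    then have "((\<lambda>t. exp (- t * rate f)) \<longlongrightarrow> 0) at_top"
      by (rule filterlim_compose[OF exp_at_bot])
    then have "((\<lambda>t. complex_of_real (exp (- t * rate f)) * ntr (mon f ** \<rho>)) \<longlongrightarrow> complex_of_real 0 * ntr (mon f ** \<rho>)) at_top"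
      by (intro tendsto_mult_right tendsto_of_real)
    then show ?thesis using ntr_mon_\<rho>T[of f] False by (simp add: V)
  qed
  then show "((\<lambda>t. ntr (V ** \<Phi> t \<rho>)) \<longlongrightarrow> ntr (V ** \<rho>T)) at_top"
    by (rule Lim_transform_eventually) (rule ev)
qed

end

theorem theorem5p15:
  fixes Z :: "complex ^ 'n \<Rightarrow> complex ^ 'k ^ 'k"
    and H A T :: "complex ^ 'n ^ 'n"
    and P :: "real \<Rightarrow> complex ^ 'k ^ 'k \<Rightarrow> complex ^ 'k ^ 'k"
  assumes "car_field Z" and "irreducible_field Z"
    and "H ** A = A ** H"
    and "0 \<preceq> A" and "A \<preceq> 2 *\<^sub>R H"
    and P_def: "P = mehler_semigroup Z H A"
    and T_def: "T = T_limit H A"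
  shows "(\<forall>t\<ge>0. P t = ehk Z (op_exp ((- t) *\<^sub>R H)) ((mat 1 - op_exp ((- 2 * t) *\<^sub>R H)) ** T)) \<and>
    (\<forall>t\<ge>0. \<forall>X Y. gns_inner (gig_state Z T) (dagger (P t) X) Y
                = gns_inner (gig_state Z T) X (dagger (P t) Y)) \<and>
    steady_state P (gig_state Z T) \<and>
    (pos_def H \<longrightarrow>
      (\<forall>\<rho>. steady_state P \<rho> \<longrightarrow> \<rho> = gig_state Z T) \<and>
      (\<forall>\<rho>. is_state \<rho> \<longrightarrow> ((\<lambda>t. P t \<rho>) \<longlongrightarrow> gig_state Z T) at_top))"
proof -
  have pA: "psd A" and pHA: "psd (2 *\<^sub>R H - A)" using assms(4,5) by (simp_all add: op_le_def)
  have aA: "adj A = A" by (rule psd_imp_adj[OF pA])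
  \<comment> \<open>Self-adjointness of \<open>H\<close> comes from that of \<open>A\<close> and of
    \<open>2 *\<^sub>R H - A\<close>.\<close>
  then have aH: "adj H = H" using psd_imp_adj[OF pHA] by simp
  obtain \<eta> h a where onb: "orthonormal_basis \<eta>"
    and ev: "\<forall>j<CARD('n). H *v \<eta> j = complex_of_real (h j) *s \<eta> j"
      "\<forall>j<CARD('n). A *v \<eta> j = complex_of_real (a j) *s \<eta> j"
    using commuting_selfadjoint_onb[OF aH aA assms(3)] by blast
  have H: "H = rspec \<eta> h" and A: "A = rspec \<eta> a"
    using ev by (auto intro!: spec_eqI[OF onb])
  have "2 *\<^sub>R H - A = rspec \<eta> (\<lambda>j. 2 * h j - a j)" by (simp add: H A spec_linear)
  then have ha: "0 \<le> a j \<and> a j \<le> 2 * h j" if "j < CARD('n)" for j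
    using psd_spec_ge_0[OF onb _ that, of a] psd_spec_ge_0[OF onb _ that, of "\<lambda>j. 2 * h j - a j"] pA pHA
    by (simp add: A)
  interpret Z: car Z by unfold_locales fact
  interpret mehler Z \<eta> h a
    by unfold_locales (use Z.irreducible_full[OF assms(2)] onb ha in auto)
  have T: "T = rspec \<eta> lam" unfolding T_def H A by (rule T_limit_eq)
  have P: "P t = \<Phi> t" if "0 \<le> t" for t
    unfolding P_def H A by (rule mehler_semigroup_eq[OF that])
  have \<rho>T: "gig_state Z T = \<rho>T" unfolding T by (rule gig_state_T)
  have 1: "P t = ehk Z (op_exp ((- t) *\<^sub>R H)) ((mat 1 - op_exp ((- 2 * t) *\<^sub>R H)) ** T)" if "0 \<le> t" for t
    unfolding P[OF that] \<Phi>_def R_eq[symmetric] H T ..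
  have 3: "steady_state P (gig_state Z T)"
    unfolding steady_state_def \<rho>T using gig_state_is_state \<Phi>_\<rho>T P by simp
  have 4: "((\<lambda>t. P t \<rho>) \<longlongrightarrow> gig_state Z T) at_top" if "pos_def H" "is_state \<rho>" for \<rho>
  proof -
    have hpos: "0 < h j" if j: "j < CARD('n)" for j
    proof -
      have "\<eta> j \<noteq> 0" using onb_cinner[OF onb j j] by (auto simp: cinner_simps)
      then have "0 < Re (cinner (\<eta> j) (H *v \<eta> j))" using \<open>pos_def H\<close> by (simp add: pos_def_def)
      then show ?thesis using ev(1) j by (simp add: cinner_simps onb_cinner[OF onb j j])
    qed
    have "((\<lambda>t. \<Phi> t \<rho>) \<longlongrightarrow> \<rho>T) at_top" using hpos that(2) by (rule \<Phi>_tendsto)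
    moreover have "\<forall>\<^sub>F t in at_top. \<Phi> t \<rho> = P t \<rho>"
      using eventually_ge_at_top[of 0] by eventually_elim (simp add: P)
    ultimately show ?thesis unfolding \<rho>T by (rule Lim_transform_eventually)
  qed
  \<comment> \<open>The orbit of a steady state is constant, so convergence of all orbits forces
    equality with the limit.\<close>
  have 5: "\<rho> = gig_state Z T" if "pos_def H" "steady_state P \<rho>" for \<rho>
  proof -
    have s: "is_state \<rho>" and fixed: "\<And>t. 0 \<le> t \<Longrightarrow> P t \<rho> = \<rho>" using that(2) by (auto simp: steady_state_def)
    have "\<forall>\<^sub>F t in at_top. P t \<rho> = \<rho>"
      using eventually_ge_at_top[of 0] by eventually_elim (rule fixed)
    then have "((\<lambda>t. P t \<rho>) \<longlongrightarrow> \<rho>) at_top" by (rule tendsto_eventually)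
    then show ?thesis using 4[OF that(1) s] by (rule tendsto_unique[OF trivial_limit_at_top_linorder])
  qed
  have 2: "gns_inner (gig_state Z T) (dagger (P t) X) Y = gns_inner (gig_state Z T) X (dagger (P t) Y)"
    if "0 \<le> t" for t X Y
    unfolding \<rho>T P[OF that] by (rule gns_selfadjoint[OF that])
  show ?thesis
    by (intro conjI allI impI) (fact 1 2 3 4 5)+
qed

end
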